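(* Let $R$ be an integral domain, let $G,H$ be discrete groups, let $X,Y$ be totally disconnected, locally compact, Hausdorff spaces, and let $\theta=(\{X_g\}_{g\in G},\{\theta_g\}_{g\in G})$ and $\gamma=(\{Y_h\}_{h\in H},\{\gamma_h\}_{h\in H})$ be topologically free partial actions of $G$ on $X$ and of $H$ on $Y$, with all $X_g$ and all $Y_h$ clopen. Then the following are equivalent: (i) $\theta$ and $\gamma$ are continuously orbit equivalent; (ii) the transformation groupoids $G\ltimes_\theta X$ and $H\ltimes_\gamma Y$ are isomorphic as topological groupoids; (iii) there exists a diagonal-preserving isomorphism $\Gamma: A_R(G\ltimes_\theta X)\to A_R(H\ltimes_\gamma Y)$; (iv) there exists an isomorphism $\Phi:\mathcal{L}_c(X)\rtimes G\to\mathcal{L}_c(Y)\rtimes H$ with $\Phi(\mathcal{L}_c(X))=\mathcal{L}_c(Y)$; (v) there exists an isomorphism $\Phi: C_0(X)\rtimes_r G\to C_0(Y)\rtimes_r H$ with $\Phi(C_0(X))=C_0(Y)$. Moreover, the implication (ii) $\Rightarrow$ (i) holds in general (i.e., without the assumption of topological freeness).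
   Context: An integral domain is a commutative ring with unit and no zero-divisors. Isomorphisms in (iii) and (iv) are isomorphisms of $R$-algebras; in (v) they are isomorphisms of C*-algebras. Partial action: a (topological) partial action of a discrete group $G$ on a space $X$ is a family of open subsets $X_g\subseteq X$ and homeomorphisms $\theta_g: X_{g^{-1}}\to X_g$ ($g\in G$) with $X_1=X$, $\theta_1=\mathrm{id}_X$, $\theta_g^{-1}=\theta_{g^{-1}}$, $\theta_g(X_{g^{-1}}\cap X_h)\subseteq X_g\cap X_{gh}$, and $\theta_g(\theta_h(x))=\theta_{gh}(x)$ for all $x\in X_{h^{-1}}\cap X_{h^{-1}g^{-1}}$. It is topologically free if, for every $1\neq g\in G$, the set $\{x\in X_{g^{-1}}:\theta_g(x)\neq x\}$ is dense in $X_{g^{-1}}$. Continuous orbit equivalence: $\theta$ and $\gamma$ are continuously orbit equivalent if there exist a homeomorphism $\varphi:X\to Y$ and continuous maps $a:\bigcup_{g\in G}\{g\}\times X_{g^{-1}}\to H$ and $b:\bigcup_{h\in H}\{h\}\times Y_{h^{-1}}\to G$ (domains with the topology inherited from $G\times X$, $H\times Y$; $G,H$ discrete) such that $\varphi(\theta_g(x))=\gamma_{a(g,x)}(\varphi(x))$ and $\varphi^{-1}(\gamma_h(y))=\theta_{b(h,y)}(\varphi^{-1}(y))$. Implicitly it is required that $\varphi(x)\in Y_{a(g,x)^{-1}}$ and $\varphi^{-1}(y)\in X_{b(h,y)^{-1}}$. $\mathcal{L}_c(X)$: the commutative $R$-algebra (pointwise operations) of locally constant functions $f:X\to R$ with compact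 support, where $\mathrm{supp}(f)=\{x: f(x)\neq 0\}$. Partial skew group ring: put $D_g=\{f\in\mathcal{L}_c(X): f \text{ vanishes on } X\setminus X_g\}$ and let $\alpha_g:D_{g^{-1}}\to D_g$ be $\alpha_g(f)=f\circ\theta_{g^{-1}}$ on $X_g$, extended by $0$. $\mathcal{L}_c(X)\rtimes G$ is the set of finite formal sums $\sum_{g\in G} f_g\delta_g$ with $f_g\in D_g$, with componentwise addition and $R$-action, and product the linear extension of $(f_g\delta_g)(f_h\delta_h)=\alpha_g(\alpha_{g^{-1}}(f_g)f_h)\delta_{gh}$. $\mathcal{L}_c(X)$ is identified with $\mathcal{L}_c(X)\delta_1$. Analogously for $\mathcal{L}_c(Y)\rtimes H$. Reduced partial crossed product: $C_0(X)\rtimes_r G$ is the usual reduced C*-crossed product of $C_0(X)$ (complex-valued continuous functions vanishing at infinity) by the partial action of $G$ induced by $\theta$. Concretely, it is the completion of the $*$-algebra of finite sums $\sum f_g\delta_g$, $f_g\in C_0(X_g)\subseteq C_0(X)$, with product $(f_g\delta_g)(f_h\delta_h)=\alpha_g(\alpha_{g^{-1}}(f_g)f_h)\delta_{gh}$ and involution $(f_g\delta_g)^*=\alpha_{g^{-1}}(\overline{f_g})\delta_{g^{-1}}$, where $\alpha_g(f)=f\circ\theta_{g^{-1}}$, in the norm $\sup_{x\in X}\|\pi_x(\cdot)\|$; here $\pi_x$ is the representation on $\ell^2(G_x)$, $G_x=\{g\in G: x\in X_{g^{-1}}\}$, given by $\pi_x(f\delta_g)e_h=f(\theta_{gh}(x))e_{gh}$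 if $gh\in G_x$ and $0$ otherwise. $C_0(X)$ is identified with $C_0(X)\delta_1$. Transformation groupoid: $G\ltimes_\theta X=\{(t,x): t\in G,\ x\in X_t\}$ with the topology inherited from $G\times X$; $(t,x)^{-1}=(t^{-1},\theta_{t^{-1}}(x))$; $(s,y),(t,x)$ are composable iff $\theta_{s^{-1}}(y)=x$, and then $(s,y)(t,x)=(st,y)$. It is a Hausdorff ample groupoid with unit space $\{1\}\times X$. An isomorphism of topological groupoids is a homeomorphism carrying units to units, preserving range and source maps, and multiplicative on composable pairs. Steinberg algebra and diagonal: for a Hausdorff ample groupoid $\mathcal{G}$ with unit space $\mathcal{G}^{(0)}$, $A_R(\mathcal{G})$ is the $R$-algebra of locally constant, compactly supported functions $\mathcal{G}\to R$, with pointwise addition and convolution $(f*g)(b)=\sum_{cd=b}f(c)g(d)$. The diagonal is $D_R(\mathcal{G})=\{f\in A_R(\mathcal{G}):\mathrm{supp}(f)\subseteq\mathcal{G}^{(0)}\}$. An isomorphism $\phi:A_R(\mathcal{G}_1)\to A_R(\mathcal{G}_2)$ is diagonal-preserving if $\phi(D_R(\mathcal{G}_1))=D_R(\mathcal{G}_2)$. *)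

theory Defs
  imports "HOL-Analysis.Analysis"
begin

text \<open>
  Conventions. Groups are types of class \<^class>\<open>group_add\<close>. They need not be commutative but are written
  additively: \<open>g + h\<close>, \<open>- g\<close>, \<open>0\<close> stand for \<open>gh\<close>, \<open>g\<^sup>-\<^sup>1\<close>, \<open>1\<close>; their topology is
  \<open>discrete_topology UNIV\<close>. Scalar-valued functions on a space \<open>X :: 'x topology\<close> are represented
  by functions on the whole type that are \<open>0\<close> outside \<open>topspace X\<close>.
\<close>

section \<open>Topological spaces and partial actions\<close>

definition totally_disconnected_space :: "'x topology \<Rightarrow> bool" where
  "totally_disconnected_space X \<longleftrightarrow>
     (\<forall>S. connectedin X S \<longrightarrow> (\<forall>x\<in>S. \<forall>y\<in>S. x = y))"

text \<open>\<open>D g\<close> is the domain \<open>X\<^sub>g\<close>, so \<open>\<theta> g\<close> maps \<open>D (- g)\<close> onto \<open>D g\<close>; its values elsewhere are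
  irrelevant. \<^const>\<open>homeomorphic_maps\<close> includes that \<open>\<theta> (- g)\<close> is the inverse of \<open>\<theta> g\<close>.\<close>

locale partial_action =
  fixes X :: "'x topology" and D :: "'g::group_add \<Rightarrow> 'x set" and \<theta> :: "'g \<Rightarrow> 'x \<Rightarrow> 'x"
  assumes open_dom: "openin X (D g)"
    and homeo: "homeomorphic_maps (subtopology X (D (- g))) (subtopology X (D g)) (\<theta> g) (\<theta> (- g))"
    and dom_unit: "D 0 = topspace X"
    and act_unit: "x \<in> topspace X \<Longrightarrow> \<theta> 0 x = x"
    and image_dom: "\<theta> g ` (D (- g) \<inter> D h) \<subseteq> D g \<inter> D (g + h)"
    and act_comp: "x \<in> D (- h) \<inter> D (- h + - g) \<Longrightarrow> \<theta> g (\<theta> h x) = \<theta> (g + h) x"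

definition topologically_free ::
    "'x topology \<Rightarrow> ('g::group_add \<Rightarrow> 'x set) \<Rightarrow> ('g \<Rightarrow> 'x \<Rightarrow> 'x) \<Rightarrow> bool" where
  "topologically_free X D \<theta> \<longleftrightarrow>
     (\<forall>g. g \<noteq> 0 \<longrightarrow>
       subtopology X (D (- g)) closure_of {x \<in> D (- g). \<theta> g x \<noteq> x} = D (- g))"

definition action_space :: "'x topology \<Rightarrow> ('g::group_add \<Rightarrow> 'x set) \<Rightarrow> ('g \<times> 'x) topology" where
  "action_space X D = subtopology (prod_topology (discrete_topology UNIV) X) (SIGMA g:UNIV. D (- g))"

definition continuously_orbit_equivalent ::
    "'x topology \<Rightarrow> ('g::group_add \<Rightarrow> 'x set) \<Rightarrow> ('g \<Rightarrow> 'x \<Rightarrow> 'x) \<Rightarrow>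
     'y topology \<Rightarrow> ('h::group_add \<Rightarrow> 'y set) \<Rightarrow> ('h \<Rightarrow> 'y \<Rightarrow> 'y) \<Rightarrow> bool" where
  "continuously_orbit_equivalent X D \<theta> Y E \<gamma> \<longleftrightarrow>
     (\<exists>\<phi> \<psi> a b.
        homeomorphic_maps X Y \<phi> \<psi> \<and>
        continuous_map (action_space X D) (discrete_topology UNIV) a \<and>
        continuous_map (action_space Y E) (discrete_topology UNIV) b \<and>
        (\<forall>g. \<forall>x \<in> D (- g). \<phi> x \<in> E (- a (g, x)) \<and> \<phi> (\<theta> g x) = \<gamma> (a (g, x)) (\<phi> x)) \<and>
        (\<forall>h. \<forall>y \<in> E (- h). \<psi> y \<in> D (- b (h, y)) \<and> \<psi> (\<gamma> h y) = \<theta> (b (h, y)) (\<psi> y)))"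


section \<open>Topological groupoids\<close>

text \<open>A product \<open>c d\<close> is defined when \<open>gsrc c = grng d\<close>; units are elements of the groupoid.\<close>

record 'a groupoid =
  gtop :: "'a topology"
  gunits :: "'a set"
  gsrc :: "'a \<Rightarrow> 'a"
  grng :: "'a \<Rightarrow> 'a"
  gmul :: "'a \<Rightarrow> 'a \<Rightarrow> 'a"
  ginv :: "'a \<Rightarrow> 'a"

definition gcomposable :: "'a groupoid \<Rightarrow> ('a \<times> 'a) set" where
  "gcomposable \<G> =
     {(c, d). c \<in> topspace (gtop \<G>) \<and> d \<in> topspace (gtop \<G>) \<and> gsrc \<G> c = grng \<G> d}"

definition groupoid_iso :: "'a groupoid \<Rightarrow> 'b groupoid \<Rightarrow> ('a \<Rightarrow> 'b) \<Rightarrow> bool" where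
  "groupoid_iso \<G> \<H> \<kappa> \<longleftrightarrow>
     homeomorphic_map (gtop \<G>) (gtop \<H>) \<kappa> \<and>
     \<kappa> ` gunits \<G> = gunits \<H> \<and>
     (\<forall>c \<in> topspace (gtop \<G>). \<kappa> (grng \<G> c) = grng \<H> (\<kappa> c) \<and> \<kappa> (gsrc \<G> c) = gsrc \<H> (\<kappa> c)) \<and>
     (\<forall>(c, d) \<in> gcomposable \<G>. \<kappa> (gmul \<G> c d) = gmul \<H> (\<kappa> c) (\<kappa> d))"

definition transformation_groupoid ::
    "'x topology \<Rightarrow> ('g::group_add \<Rightarrow> 'x set) \<Rightarrow> ('g \<Rightarrow> 'x \<Rightarrow> 'x) \<Rightarrow> ('g \<times> 'x) groupoid" where
  "transformation_groupoid X D \<theta> =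
     \<lparr> gtop = subtopology (prod_topology (discrete_topology UNIV) X) (SIGMA t:UNIV. D t),
       gunits = {0} \<times> topspace X,
       gsrc = (\<lambda>(t, x). (0, \<theta> (- t) x)),
       grng = (\<lambda>(t, x). (0, x)),
       gmul = (\<lambda>(s, y) (t, x). (s + t, y)),
       ginv = (\<lambda>(t, x). (- t, \<theta> (- t) x)) \<rparr>"


section \<open>Algebras (without unit) and their isomorphisms\<close>

record ('k, 'a) alg =
  acarrier :: "'a set"
  aadd :: "'a \<Rightarrow> 'a \<Rightarrow> 'a"
  amult :: "'a \<Rightarrow> 'a \<Rightarrow> 'a"
  asmult :: "'k \<Rightarrow> 'a \<Rightarrow> 'a"

record ('k, 'a) star_alg = "('k, 'a) alg" +
  astar :: "'a \<Rightarrow> 'a"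

definition alg_iso ::
    "('k, 'a, 'm) alg_scheme \<Rightarrow> ('k, 'b, 'n) alg_scheme \<Rightarrow> ('a \<Rightarrow> 'b) \<Rightarrow> bool" where
  "alg_iso A B \<Phi> \<longleftrightarrow>
     bij_betw \<Phi> (acarrier A) (acarrier B) \<and>
     (\<forall>u \<in> acarrier A. \<forall>v \<in> acarrier A.
        \<Phi> (aadd A u v) = aadd B (\<Phi> u) (\<Phi> v) \<and> \<Phi> (amult A u v) = amult B (\<Phi> u) (\<Phi> v)) \<and>
     (\<forall>r. \<forall>u \<in> acarrier A. \<Phi> (asmult A r u) = asmult B r (\<Phi> u))"

text \<open>Isomorphisms of C*-algebras are bijective *-homomorphisms (which are automatically isometric).\<close>

definition star_alg_iso ::
    "('k, 'a, 'm) star_alg_scheme \<Rightarrow> ('k, 'b, 'n) star_alg_scheme \<Rightarrow> ('a \<Rightarrow> 'b) \<Rightarrow> bool" where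
  "star_alg_iso A B \<Phi> \<longleftrightarrow>
     alg_iso A B \<Phi> \<and> (\<forall>u \<in> acarrier A. \<Phi> (astar A u) = astar B (\<Phi> u))"


section \<open>Locally constant functions and Steinberg algebras\<close>

definition Lc :: "'x topology \<Rightarrow> ('x \<Rightarrow> 'r::zero) set" where
  "Lc X = {f. (\<forall>x. x \<notin> topspace X \<longrightarrow> f x = 0) \<and>
              (\<forall>x \<in> topspace X. \<exists>U. openin X U \<and> x \<in> U \<and> (\<forall>y\<in>U. f y = f x)) \<and>
              compactin X {x \<in> topspace X. f x \<noteq> 0}}"

text \<open>The sum runs over the nonzero terms only, because \<^const>\<open>sum\<close> over an infinite set is \<open>0\<close>.\<close>

definition convolution ::
    "'a groupoid \<Rightarrow> ('a \<Rightarrow> 'r::comm_ring_1) \<Rightarrow> ('a \<Rightarrow> 'r) \<Rightarrow> 'a \<Rightarrow> 'r" where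
  "convolution \<G> f f' b =
     (\<Sum>(c, d) \<in> {(c, d) \<in> gcomposable \<G>. gmul \<G> c d = b \<and> f c \<noteq> 0 \<and> f' d \<noteq> 0}. f c * f' d)"

definition steinberg_algebra :: "'a groupoid \<Rightarrow> ('r::comm_ring_1, 'a \<Rightarrow> 'r) alg" where
  "steinberg_algebra \<G> =
     \<lparr> acarrier = Lc (gtop \<G>),
       aadd = (\<lambda>f f' c. f c + f' c),
       amult = convolution \<G>,
       asmult = (\<lambda>r f c. r * f c) \<rparr>"

definition steinberg_diagonal :: "'a groupoid \<Rightarrow> ('a \<Rightarrow> 'r::comm_ring_1) set" where
  "steinberg_diagonal \<G> = {f \<in> Lc (gtop \<G>). {c. f c \<noteq> 0} \<subseteq> gunits \<G>}"


section \<open>Algebraic crossed products by partial actions\<close>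

definition pull :: "('g::group_add \<Rightarrow> 'x set) \<Rightarrow> ('g \<Rightarrow> 'x \<Rightarrow> 'x) \<Rightarrow> 'g \<Rightarrow> ('x \<Rightarrow> 'k::zero) \<Rightarrow> 'x \<Rightarrow> 'k" where
  "pull D \<theta> g f = (\<lambda>x. if x \<in> D g then f (\<theta> (- g) x) else 0)"

text \<open>A finite formal sum \<open>\<Sum>\<^sub>g f\<^sub>g \<delta>\<^sub>g\<close> is the finitely supported family \<open>g \<mapsto> f\<^sub>g\<close>;
  \<open>monomial g f\<close> is \<open>f \<delta>\<^sub>g\<close>.\<close>

definition fsupp :: "('g \<Rightarrow> 'x \<Rightarrow> 'k::zero) \<Rightarrow> 'g set" where
  "fsupp F = {g. F g \<noteq> (\<lambda>_. 0)}"

definition monomial :: "'g \<Rightarrow> ('x \<Rightarrow> 'k::zero) \<Rightarrow> 'g \<Rightarrow> 'x \<Rightarrow> 'k" where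
  "monomial g f = (\<lambda>k. if k = g then f else (\<lambda>_. 0))"

definition cp_mult ::
    "('g::group_add \<Rightarrow> 'x set) \<Rightarrow> ('g \<Rightarrow> 'x \<Rightarrow> 'x) \<Rightarrow>
     ('g \<Rightarrow> 'x \<Rightarrow> 'k::comm_ring_1) \<Rightarrow> ('g \<Rightarrow> 'x \<Rightarrow> 'k) \<Rightarrow> 'g \<Rightarrow> 'x \<Rightarrow> 'k" where
  "cp_mult D \<theta> F F' = (\<lambda>k x. \<Sum>g \<in> fsupp F. \<Sum>h \<in> {h \<in> fsupp F'. g + h = k}.
     pull D \<theta> g (\<lambda>y. pull D \<theta> (- g) (F g) y * F' h y) x)"

text \<open>The parameter \<open>C\<close> is the coefficient algebra: \<open>\<L>\<^sub>c(X)\<close> or \<open>C\<^sub>0(X)\<close>. The coefficient at \<open>\<delta>\<^sub>g\<close>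
  ranges over the elements of \<open>C\<close> that vanish off \<open>X\<^sub>g\<close>; for \<open>C = C\<^sub>0(X)\<close> this is \<open>C\<^sub>0(X\<^sub>g)\<close>
  included in \<open>C\<^sub>0(X)\<close> by extension with \<open>0\<close>.\<close>

definition crossed_product ::
    "('x \<Rightarrow> 'k) set \<Rightarrow> ('g::group_add \<Rightarrow> 'x set) \<Rightarrow> ('g \<Rightarrow> 'x \<Rightarrow> 'x) \<Rightarrow>
     ('k::comm_ring_1, 'g \<Rightarrow> 'x \<Rightarrow> 'k) alg" where
  "crossed_product C D \<theta> =
     \<lparr> acarrier = {F. finite (fsupp F) \<and> (\<forall>g. F g \<in> C \<and> (\<forall>x. x \<notin> D g \<longrightarrow> F g x = 0))},
       aadd = (\<lambda>F F' g x. F g x + F' g x),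
       amult = cp_mult D \<theta>,
       asmult = (\<lambda>r F g x. r * F g x) \<rparr>"

definition partial_skew_group_ring ::
    "'x topology \<Rightarrow> ('g::group_add \<Rightarrow> 'x set) \<Rightarrow> ('g \<Rightarrow> 'x \<Rightarrow> 'x) \<Rightarrow>
     ('r::comm_ring_1, 'g \<Rightarrow> 'x \<Rightarrow> 'r) alg" where
  "partial_skew_group_ring X D \<theta> = crossed_product (Lc X) D \<theta>"

lemma cp_mult_monomial:
  "cp_mult D \<theta> (monomial g f) (monomial h f') =
     monomial (g + h) (pull D \<theta> g (\<lambda>y. pull D \<theta> (- g) f y * f' y))"
proof -
  have 1: "fsupp (monomial g f) = (if f = (\<lambda>_. 0) then {} else {g})"
    for g f
    by (auto simp: fsupp_def monomial_def)
  have 2: "{h' \<in> fsupp (monomial h f'). g + h' = k} =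
      (if f' = (\<lambda>_. 0) \<or> k \<noteq> g + h then {} else {h})" for g k
    by (auto simp: 1)
  show ?thesis
    unfolding cp_mult_def 2 unfolding 1 by (auto simp: fun_eq_iff monomial_def pull_def)
qed


section \<open>Reduced crossed products\<close>

definition C0 :: "'x topology \<Rightarrow> ('x \<Rightarrow> complex) set" where
  "C0 X = {f. (\<forall>x. x \<notin> topspace X \<longrightarrow> f x = 0) \<and>
              continuous_map X euclidean f \<and>
              (\<forall>\<epsilon>>0. compactin X {x \<in> topspace X. cmod (f x) \<ge> \<epsilon>})}"

text \<open>The *-algebra of finite sums. In the involution the summand \<open>f \<delta>\<^sub>g\<close> with \<open>g = k\<^sup>-\<^sup>1\<close>
  contributes \<open>\<alpha>\<^sub>k(f\<^sup>* ) \<delta>\<^sub>k\<close>, where \<open>f\<^sup>*\<close> is the complex conjugate.\<close>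

definition crossed_product_C0 ::
    "'x topology \<Rightarrow> ('g::group_add \<Rightarrow> 'x set) \<Rightarrow> ('g \<Rightarrow> 'x \<Rightarrow> 'x) \<Rightarrow>
     (complex, 'g \<Rightarrow> 'x \<Rightarrow> complex) star_alg" where
  "crossed_product_C0 X D \<theta> =
     alg.extend (crossed_product (C0 X) D \<theta>)
       (star_alg.fields (\<lambda>F k. pull D \<theta> k (\<lambda>x. cnj (F (- k) x))))"

definition orbit_index :: "('g::group_add \<Rightarrow> 'x set) \<Rightarrow> 'x \<Rightarrow> 'g set" where
  "orbit_index D x = {g. x \<in> D (- g)}"

definition l2 :: "'i set \<Rightarrow> ('i \<Rightarrow> complex) set" where
  "l2 I = {\<xi>. (\<forall>i. i \<notin> I \<longrightarrow> \<xi> i = 0) \<and> (\<lambda>i. (cmod (\<xi> i))\<^sup>2) summable_on I}"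

definition l2_norm :: "'i set \<Rightarrow> ('i \<Rightarrow> complex) \<Rightarrow> real" where
  "l2_norm I \<xi> = sqrt (\<Sum>\<^sub>\<infinity>i\<in>I. (cmod (\<xi> i))\<^sup>2)"

text \<open>The operator \<open>\<pi>\<^sub>x(F)\<close> on \<open>\<ell>\<^sup>2(G\<^sub>x)\<close>, as the matrix acting on arbitrary square-summable
  vectors; its values on basis vectors are computed in \<open>reg_rep_basis\<close> below.\<close>

definition reg_rep ::
    "('g::group_add \<Rightarrow> 'x set) \<Rightarrow> ('g \<Rightarrow> 'x \<Rightarrow> 'x) \<Rightarrow> 'x \<Rightarrow> ('g \<Rightarrow> 'x \<Rightarrow> complex) \<Rightarrow>
     ('g \<Rightarrow> complex) \<Rightarrow> 'g \<Rightarrow> complex" where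
  "reg_rep D \<theta> x F \<xi> = (\<lambda>k. if k \<in> orbit_index D x
     then \<Sum>g \<in> {g \<in> fsupp F. - g + k \<in> orbit_index D x}. F g (\<theta> k x) * \<xi> (- g + k)
     else 0)"

lemma reg_rep_basis:
  assumes "h \<in> orbit_index D x"
  shows "reg_rep D \<theta> x (monomial g f) (\<lambda>k. if k = h then 1 else 0) =
     (if g + h \<in> orbit_index D x
      then (\<lambda>k. if k = g + h then f (\<theta> (g + h) x) else 0) else (\<lambda>_. 0))"
proof
  fix k
  have 1: "{g' \<in> fsupp (monomial g f). - g' + k \<in> orbit_index D x} =
      (if f = (\<lambda>_. 0) \<or> - g + k \<notin> orbit_index D x then {} else {g})"
    by (auto simp: fsupp_def monomial_def)
  have 2: "- g + k = h \<longleftrightarrow> k = g + h"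
    by (metis add.assoc add.left_neutral left_minus right_minus)
  show "reg_rep D \<theta> x (monomial g f) (\<lambda>k. if k = h then 1 else 0) k =
     (if g + h \<in> orbit_index D x
      then (\<lambda>k. if k = g + h then f (\<theta> (g + h) x) else 0) else (\<lambda>_. 0)) k"
    unfolding reg_rep_def 1 using assms by (auto simp: 2 monomial_def)
qed

definition operator_norm :: "'i set \<Rightarrow> (('i \<Rightarrow> complex) \<Rightarrow> 'i \<Rightarrow> complex) \<Rightarrow> real" where
  "operator_norm I T = (SUP \<xi> \<in> {\<xi> \<in> l2 I. l2_norm I \<xi> \<le> 1}. l2_norm I (T \<xi>))"

text \<open>Inserting \<open>0\<close> only matters for the empty space, where \<open>Sup {}\<close> is unspecified.\<close>

definition reduced_norm ::
    "'x topology \<Rightarrow> ('g::group_add \<Rightarrow> 'x set) \<Rightarrow> ('g \<Rightarrow> 'x \<Rightarrow> 'x) \<Rightarrow> ('g \<Rightarrow> 'x \<Rightarrow> complex) \<Rightarrow> real" where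
  "reduced_norm X D \<theta> F =
     Sup (insert 0 ((\<lambda>x. operator_norm (orbit_index D x) (reg_rep D \<theta> x F)) ` topspace X))"

text \<open>Completion of a normed *-algebra: Cauchy sequences modulo null sequences.\<close>

definition adist :: "(complex, 'a, 'm) star_alg_scheme \<Rightarrow> ('a \<Rightarrow> real) \<Rightarrow> 'a \<Rightarrow> 'a \<Rightarrow> real" where
  "adist A N u v = N (aadd A u (asmult A (- 1) v))"

definition cauchy_seqs :: "(complex, 'a, 'm) star_alg_scheme \<Rightarrow> ('a \<Rightarrow> real) \<Rightarrow> (nat \<Rightarrow> 'a) set" where
  "cauchy_seqs A N = {s. (\<forall>n. s n \<in> acarrier A) \<and>
     (\<forall>\<epsilon>>0. \<exists>M. \<forall>m\<ge>M. \<forall>n\<ge>M. adist A N (s m) (s n) < \<epsilon>)}"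

definition null_rel ::
    "(complex, 'a, 'm) star_alg_scheme \<Rightarrow> ('a \<Rightarrow> real) \<Rightarrow> ((nat \<Rightarrow> 'a) \<times> (nat \<Rightarrow> 'a)) set" where
  "null_rel A N = {(s, t). s \<in> cauchy_seqs A N \<and> t \<in> cauchy_seqs A N \<and>
     (\<lambda>n. adist A N (s n) (t n)) \<longlonglongrightarrow> 0}"

definition completion ::
    "(complex, 'a, 'm) star_alg_scheme \<Rightarrow> ('a \<Rightarrow> real) \<Rightarrow> (complex, (nat \<Rightarrow> 'a) set) star_alg" where
  "completion A N =
     \<lparr> acarrier = cauchy_seqs A N // null_rel A N,
       aadd = (\<lambda>S T. \<Union>s\<in>S. \<Union>t\<in>T. null_rel A N `` {\<lambda>n. aadd A (s n) (t n)}),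
       amult = (\<lambda>S T. \<Union>s\<in>S. \<Union>t\<in>T. null_rel A N `` {\<lambda>n. amult A (s n) (t n)}),
       asmult = (\<lambda>r S. \<Union>s\<in>S. null_rel A N `` {\<lambda>n. asmult A r (s n)}),
       astar = (\<lambda>S. \<Union>s\<in>S. null_rel A N `` {\<lambda>n. astar A (s n)}) \<rparr>"

definition completion_embed ::
    "(complex, 'a, 'm) star_alg_scheme \<Rightarrow> ('a \<Rightarrow> real) \<Rightarrow> 'a \<Rightarrow> (nat \<Rightarrow> 'a) set" where
  "completion_embed A N u = null_rel A N `` {\<lambda>_. u}"

definition reduced_crossed_product ::
    "'x topology \<Rightarrow> ('g::group_add \<Rightarrow> 'x set) \<Rightarrow> ('g \<Rightarrow> 'x \<Rightarrow> 'x) \<Rightarrow>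
     (complex, (nat \<Rightarrow> 'g \<Rightarrow> 'x \<Rightarrow> complex) set) star_alg" where
  "reduced_crossed_product X D \<theta> =
     completion (crossed_product_C0 X D \<theta>) (reduced_norm X D \<theta>)"

definition C0_subalgebra ::
    "'x topology \<Rightarrow> ('g::group_add \<Rightarrow> 'x set) \<Rightarrow> ('g \<Rightarrow> 'x \<Rightarrow> 'x) \<Rightarrow>
     (nat \<Rightarrow> 'g \<Rightarrow> 'x \<Rightarrow> complex) set set" where
  "C0_subalgebra X D \<theta> =
     (\<lambda>f. completion_embed (crossed_product_C0 X D \<theta>) (reduced_norm X D \<theta>) (monomial 0 f)) ` C0 X"

end

theory Submission
  imports Defs
begin

text \<open>
  All implications pass through one notion: a homeomorphism \<open>\<phi>\<close> is an orbit map if near every point it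
  carries each \<open>\<theta>\<^sub>g\<close> to some \<open>\<gamma>\<^sub>h\<close>. Topological freeness makes \<open>h\<close> unique, hence a locally constant
  cocycle, so that two mutually inverse orbit maps yield both a continuous orbit equivalence and an
  isomorphism of the transformation groupoids.

  A groupoid isomorphism transports the Steinberg algebra, and currying identifies the latter with the
  partial skew group ring. It also permutes the basis vectors of the regular representations, so over
  the complex numbers it is isometric on the skew group ring; this ring is dense in the reduced
  crossed product, and the isomorphism extends to the completions.

  Conversely, let \<open>\<Phi>\<close> be a multiplicative bijection that preserves the diagonals. The idempotents of the
  diagonal are the indicators of compact open sets, so Stone duality turns \<open>\<Phi>\<close> into a homeomorphism
  \<open>\<phi>\<close>. For \<open>u = 1\<^sub>\<theta>\<^sub>g\<^sub>(\<^sub>U\<^sub>) \<delta>\<^sub>g\<close> and \<open>V \<subseteq> U\<close> we have \<open>u 1\<^sub>V = 1\<^sub>\<theta>\<^sub>g\<^sub>(\<^sub>V\<^sub>) u\<close>. Comparing the coefficients of \<open>\<delta>\<^sub>h\<close> in the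
  image of this relation gives \<open>\<gamma>\<^sub>h \<phi> = \<phi> \<theta>\<^sub>g\<close> wherever the coefficient of \<open>\<Phi>(u)\<close> does not vanish, and over
  every point of \<open>\<phi>(U)\<close> some coefficient does not vanish because \<open>\<Phi>(u)\<close> has the left inverse
  \<open>\<Phi>(1\<^sub>U \<delta>\<^sub>g\<^sub>-\<^sub>1)\<close> there. In the reduced crossed product the coefficients are uniform limits, and if all of
  them vanish along the orbit of \<open>x\<close> then \<open>\<pi>\<^sub>x(u) e\<^sub>0 = 0\<close>, which excludes such a left inverse.
\<close>

section \<open>Compact open sets and Stone duality\<close>

text \<open>The algebras need not be unital, and elements of the reduced one are classes of Cauchy
  sequences. The reconstruction is therefore carried out from the axioms of
  \<open>coefficient_algebra\<close>, which mention only products, the elements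
  \<open>mono g U\<close> and the open sets on which a coefficient does not vanish. Its two
  instances differ in substance at \<open>supp_nonempty\<close>: for finite sums a nonzero product
  has a nonzero term, whereas in the completion the coefficients along an orbit are entries of an l2
  column, and a norm estimate replaces the finite sum.

  Each standing hypothesis has a definite place. Closed domains are used to extend products by zero;
  in an integral domain 0 and 1 are the only idempotents, so idempotent diagonal elements are
  indicators; freeness enters through \<open>germ_unique\<close>.

  Norm estimates concern finite sections of matrices, so that sums stay finite, and operators on l2
  appear only where the reduced norm is compared with these bounds. Likewise a groupoid isomorphism
  is applied to locally constant coefficients only; the step to continuous ones is left to
  density.\<close>

definition compact_open :: "'x topology \<Rightarrow> 'x set \<Rightarrow> bool" where
  "compact_open X U \<longleftrightarrow> openin X U \<and> compactin X U"

locale stone_space =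
  fixes X :: "'x topology"
  assumes totally_disconnected: "totally_disconnected_space X"
    and locally_compact: "locally_compact_space X"
    and Hausdorff: "Hausdorff_space X"
begin

text \<open>In a locally compact Hausdorff space a compact component is separated by a clopen set
  from any closed set disjoint from it. Total disconnectedness makes \<open>{x}\<close> such a
  component, and local compactness provides an open \<open>V\<close> inside a compact
  \<open>K\<close>. Separating \<open>{x}\<close> from the complement of \<open>U \<inter> V\<close>
  yields a clopen set, which is compact because it lies in \<open>K\<close>.\<close>

lemma compact_open_base:
  assumes "openin X U" "x \<in> U"
  obtains K where "compact_open X K" "x \<in> K" "K \<subseteq> U"
proof -
  have x: "x \<in> topspace X"
    using assms openin_subset by blast
  obtain V K where V: "openin X V" "compactin X K" "x \<in> V" "V \<subseteq> K"
    using locally_compact x unfolding locally_compact_space_def by blast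
  have "connected_component_of_set X x = {x}"
  proof -
    have "connectedin X (connected_component_of_set X x)"
      by (simp add: connectedin_connected_component_of)
    moreover have "x \<in> connected_component_of_set X x"
      using x by (simp add: connected_component_of_refl)
    ultimately show ?thesis
      using totally_disconnected unfolding totally_disconnected_space_def by blast
  qed
  then have "{x} \<in> connected_components_of X"
    using x by (metis connected_component_in_connected_components_of)
  moreover have "closedin X (topspace X - (U \<inter> V))"
    using assms V by blast
  ultimately have "separated_between X {x} (topspace X - (U \<inter> V))"
    using assms V x by (intro separated_between_compact_connected_component[OF locally_compact Hausdorff])
      auto
  then obtain A B where AB: "openin X A" "openin X B" "A \<union> B = topspace X" "disjnt A B" "x \<in> A"
      "topspace X - (U \<inter> V) \<subseteq> B"
    unfolding separated_between_def by blast
  have A: "A = topspace X - B"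
    using AB by (auto simp: disjnt_iff)
  then have sub: "A \<subseteq> U \<inter> V"
    using AB by auto
  have "closedin X A"
    using A AB by blast
  then have "compactin X A"
    using V sub by (meson closed_compactin le_inf_iff subset_trans)
  then show ?thesis
    using that AB sub unfolding compact_open_def by blast
qed

lemma compact_open_closedin: "compact_open X U \<Longrightarrow> closedin X U"
  by (simp add: compact_open_def compactin_imp_closedin Hausdorff)

lemma compact_open_subset: "compact_open X U \<Longrightarrow> U \<subseteq> topspace X"
  by (simp add: compact_open_def openin_subset)

lemma compact_open_Int: "compact_open X U \<Longrightarrow> compact_open X V \<Longrightarrow> compact_open X (U \<inter> V)"
  using compact_open_closedin unfolding compact_open_def
  by (simp add: closed_Int_compactin openin_Int)

lemma compact_open_Diff: "compact_open X U \<Longrightarrow> compact_open X V \<Longrightarrow> compact_open X (U - V)"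
  using compact_open_closedin unfolding compact_open_def
  by (metis Diff_subset closed_compactin closedin_diff compactin_imp_closedin Hausdorff openin_diff)

lemma compact_open_empty: "compact_open X {}"
  by (simp add: compact_open_def)

lemma compact_open_separate:
  assumes "x \<in> topspace X" "y \<in> topspace X" "x \<noteq> y"
  obtains K where "compact_open X K" "x \<in> K" "y \<notin> K"
proof -
  obtain U V where "openin X U" "x \<in> U" "y \<notin> U"
    using Hausdorff assms unfolding Hausdorff_space_def disjnt_iff by metis
  then show ?thesis
    using compact_open_base that by blast
qed

end

text \<open>The point \<open>y\<close> is a common point of all \<open>\<beta> U\<close> with
  \<open>x \<in> U\<close>. These sets are closed and nonempty, finite intersections of them have
  the same form, and one of them is compact, so the finite intersection property applies. The space
  itself need not be compact, hence complements are taken relative to a fixed neighbourhood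
  \<open>U0\<close>.\<close>

lemma stone_point_map:
  assumes "stone_space X" "stone_space Y"
    and bij: "bij_betw \<beta> (Collect (compact_open X)) (Collect (compact_open Y))"
    and int: "\<And>U V. compact_open X U \<Longrightarrow> compact_open X V \<Longrightarrow> \<beta> (U \<inter> V) = \<beta> U \<inter> \<beta> V"
    and x: "x \<in> topspace X"
  shows "\<exists>y \<in> topspace Y. \<forall>U. compact_open X U \<longrightarrow> (x \<in> U \<longleftrightarrow> y \<in> \<beta> U)"
proof -
  interpret X: stone_space X by fact
  interpret Y: stone_space Y by fact
  have co: "compact_open Y (\<beta> U)" if "compact_open X U" for U
    using bij that by (auto dest: bij_betw_apply)
  have surj: "\<exists>U. compact_open X U \<and> \<beta> U = V" if "compact_open Y V" for V
    using bij that unfolding bij_betw_def by (metis (mono_tags, lifting) imageE mem_Collect_eq)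
  have inj: "U = V" if "compact_open X U" "compact_open X V" "\<beta> U = \<beta> V" for U V
    using bij that unfolding bij_betw_def by (meson inj_onD mem_Collect_eq)
  \<comment> \<open>\<open>{}\<close> is the least compact open set, and a bijection that preserves
    intersections preserves least elements.\<close>
  have empty: "\<beta> {} = {}"
    using surj[OF Y.compact_open_empty] int[OF X.compact_open_empty] by (metis inf_bot_left inf_bot_right)
  have disj: "\<beta> (U - V) \<inter> \<beta> V = {}" if "compact_open X U" "compact_open X V" for U V
    using int[of "U - V" V] that X.compact_open_Diff[OF that] empty by (simp add: Diff_Int_distrib2 Int_commute)
  obtain U0 where U0: "compact_open X U0" "x \<in> U0"
    using X.compact_open_base[OF openin_topspace x] by metis
  define \<F> where "\<F> = \<beta> ` {U. compact_open X U \<and> x \<in> U}"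
  have fip: "\<Inter>\<G> \<in> \<F>" if "finite \<G>" "\<G> \<noteq> {}" "\<G> \<subseteq> \<F>" for \<G>
    using that
  proof (induction rule: finite_ne_induct)
    case (insert F \<G>)
    then obtain U V where UV: "compact_open X U" "x \<in> U" "F = \<beta> U" "compact_open X V" "x \<in> V" "\<Inter>\<G> = \<beta> V"
      unfolding \<F>_def by auto
    then have "\<Inter>(insert F \<G>) = \<beta> (U \<inter> V)"
      using int by simp
    then show ?case
      unfolding \<F>_def using X.compact_open_Int UV by blast
  qed simp
  have nonempty: "F \<noteq> {}" if "F \<in> \<F>" for F
    using that inj[OF _ X.compact_open_empty] empty unfolding \<F>_def by auto
  have "topspace Y \<inter> \<beta> U0 \<inter> \<Inter>\<F> \<noteq> {}"
  proof -
    have "\<beta> U0 \<inter> \<Inter>\<F> \<noteq> {}"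
    proof (rule compactin_fip[THEN iffD1, THEN conjunct2, rule_format, of Y])
      show "compactin Y (\<beta> U0)"
        using co U0 compact_open_def by blast
      show "Ball \<F> (closedin Y) \<and> (\<forall>\<G>. finite \<G> \<and> \<G> \<subseteq> \<F> \<longrightarrow> \<beta> U0 \<inter> \<Inter>\<G> \<noteq> {})"
      proof (intro conjI ballI allI impI)
        fix F assume "F \<in> \<F>"
        then show "closedin Y F"
          using co Y.compact_open_closedin unfolding \<F>_def by auto
      next
        fix \<G> assume G: "finite \<G> \<and> \<G> \<subseteq> \<F>"
        have "\<beta> U0 \<in> \<F>"
          using U0 unfolding \<F>_def by blast
        then have "\<Inter>(insert (\<beta> U0) \<G>) \<in> \<F>"
          using G by (intro fip) auto
        then show "\<beta> U0 \<inter> \<Inter>\<G> \<noteq> {}"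
          using nonempty by (metis Inter_insert)
      qed
    qed
    then show ?thesis
      using co[OF U0(1)] Y.compact_open_subset by blast
  qed
  then obtain y where y: "y \<in> topspace Y" "y \<in> \<beta> U0" "\<And>U. compact_open X U \<Longrightarrow> x \<in> U \<Longrightarrow> y \<in> \<beta> U"
    unfolding \<F>_def by auto
  \<comment> \<open>If \<open>x \<notin> U\<close>, then \<open>y\<close> would lie both in
    \<open>\<beta> (U0 - U)\<close> and in \<open>\<beta> U\<close>, which are disjoint.\<close>
  have "x \<in> U" if "compact_open X U" "y \<in> \<beta> U" for U
    using that y(3)[of "U0 - U"] disj[of U0 U] X.compact_open_Diff[OF U0(1), of U] U0 by blast
  then show ?thesis
    using y by blast
qed

text \<open>Both point maps come from \<open>stone_point_map\<close>, applied to
  \<open>\<beta>\<close> and to its inverse. They are continuous because the preimage of a compact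
  open set is again one, namely its image under the inverse bijection or under
  \<open>\<beta>\<close>; they are inverse to each other because compact open sets separate
  points.\<close>

lemma stone_duality:
  assumes "stone_space X" "stone_space Y"
    and bij: "bij_betw \<beta> (Collect (compact_open X)) (Collect (compact_open Y))"
    and int: "\<And>U V. compact_open X U \<Longrightarrow> compact_open X V \<Longrightarrow> \<beta> (U \<inter> V) = \<beta> U \<inter> \<beta> V"
  obtains \<phi> \<psi> where "homeomorphic_maps X Y \<phi> \<psi>"
    "\<And>U x. compact_open X U \<Longrightarrow> x \<in> topspace X \<Longrightarrow> \<phi> x \<in> \<beta> U \<longleftrightarrow> x \<in> U"
    "\<And>U y. compact_open X U \<Longrightarrow> y \<in> topspace Y \<Longrightarrow> \<psi> y \<in> U \<longleftrightarrow> y \<in> \<beta> U"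
proof -
  interpret X: stone_space X by fact
  interpret Y: stone_space Y by fact
  define \<beta>' where "\<beta>' = the_inv_into (Collect (compact_open X)) \<beta>"
  have bij': "bij_betw \<beta>' (Collect (compact_open Y)) (Collect (compact_open X))"
    unfolding \<beta>'_def by (rule bij_betw_the_inv_into[OF bij])
  have inv: "\<beta> (\<beta>' V) = V" "compact_open X (\<beta>' V)" if "compact_open Y V" for V
    using bij bij' that unfolding \<beta>'_def by (auto simp: f_the_inv_into_f_bij_betw dest: bij_betw_apply)
  have inv': "\<beta>' (\<beta> U) = U" "compact_open Y (\<beta> U)" if "compact_open X U" for U
    using bij that unfolding \<beta>'_def by (auto simp: the_inv_into_f_f bij_betw_def)
  have int': "\<beta>' (U \<inter> V) = \<beta>' U \<inter> \<beta>' V" if "compact_open Y U" "compact_open Y V" for U V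
    using that int[of "\<beta>' U" "\<beta>' V"] inv inv' X.compact_open_Int by metis
  obtain \<phi> where \<phi>: "\<And>x. x \<in> topspace X \<Longrightarrow> \<phi> x \<in> topspace Y"
    "\<And>U x. compact_open X U \<Longrightarrow> x \<in> topspace X \<Longrightarrow> \<phi> x \<in> \<beta> U \<longleftrightarrow> x \<in> U"
    using stone_point_map[OF assms] by metis
  obtain \<psi> where \<psi>: "\<And>y. y \<in> topspace Y \<Longrightarrow> \<psi> y \<in> topspace X"
    "\<And>U y. compact_open Y U \<Longrightarrow> y \<in> topspace Y \<Longrightarrow> \<psi> y \<in> \<beta>' U \<longleftrightarrow> y \<in> U"
    using stone_point_map[OF assms(2,1) bij' int'] by metis
  have \<psi>': "\<psi> y \<in> U \<longleftrightarrow> y \<in> \<beta> U" if "compact_open X U" "y \<in> topspace Y" for U y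
    using \<psi>(2)[of "\<beta> U" y] inv' that by auto
  have "continuous_map X Y \<phi>"
    unfolding continuous_map_def
  proof (intro conjI allI impI)
    show "\<phi> \<in> topspace X \<rightarrow> topspace Y"
      using \<phi> by blast
    fix V assume V: "openin Y V"
    show "openin X {x \<in> topspace X. \<phi> x \<in> V}"
    proof (subst openin_subopen, clarify)
      fix x assume x: "x \<in> topspace X" "\<phi> x \<in> V"
      then obtain K where K: "compact_open Y K" "\<phi> x \<in> K" "K \<subseteq> V"
        using Y.compact_open_base[OF V] by metis
      have eq: "\<phi> z \<in> K \<longleftrightarrow> z \<in> \<beta>' K" if "z \<in> topspace X" for z
        using \<phi>(2)[of "\<beta>' K" z] inv K that by auto
      show "\<exists>T. openin X T \<and> x \<in> T \<and> T \<subseteq> {x \<in> topspace X. \<phi> x \<in> V}"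
        using eq K inv(2)[OF K(1)] x X.compact_open_subset
        by (intro exI[of _ "\<beta>' K"]) (auto simp: compact_open_def)
    qed
  qed
  moreover have "continuous_map Y X \<psi>"
    unfolding continuous_map_def
  proof (intro conjI allI impI)
    show "\<psi> \<in> topspace Y \<rightarrow> topspace X"
      using \<psi> by blast
    fix V assume V: "openin X V"
    show "openin Y {x \<in> topspace Y. \<psi> x \<in> V}"
    proof (subst openin_subopen, clarify)
      fix y assume y: "y \<in> topspace Y" "\<psi> y \<in> V"
      then obtain K where K: "compact_open X K" "\<psi> y \<in> K" "K \<subseteq> V"
        using X.compact_open_base[OF V] by metis
      show "\<exists>T. openin Y T \<and> y \<in> T \<and> T \<subseteq> {x \<in> topspace Y. \<psi> x \<in> V}"
        using \<psi>'[OF K(1)] K inv'(2)[OF K(1)] y Y.compact_open_subset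
        by (intro exI[of _ "\<beta> K"]) (auto simp: compact_open_def)
    qed
  qed
  moreover have "\<psi> (\<phi> x) = x" if "x \<in> topspace X" for x
    using X.compact_open_separate[of x "\<psi> (\<phi> x)"] that \<phi> \<psi> \<psi>' by metis
  moreover have "\<phi> (\<psi> y) = y" if "y \<in> topspace Y" for y
    using Y.compact_open_separate[of y "\<phi> (\<psi> y)"] that \<phi> \<psi> \<psi>' inv by metis
  ultimately have "homeomorphic_maps X Y \<phi> \<psi>"
    unfolding homeomorphic_maps_def by blast
  then show ?thesis
    using that \<phi>(2) \<psi>' by blast
qed

section \<open>Partial actions and germs\<close>

context partial_action
begin

lemma dom_subset: "D g \<subseteq> topspace X"
  using open_dom openin_subset by blast

lemma act_in_dom: "x \<in> D (- g) \<Longrightarrow> \<theta> g x \<in> D g"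
  using homeo[of g] dom_subset unfolding homeomorphic_maps_def continuous_map_def
  by (auto simp: topspace_subtopology_subset)

lemma act_neg_in_dom: "x \<in> D g \<Longrightarrow> \<theta> (- g) x \<in> D (- g)"
  using act_in_dom[of x "- g"] by simp

lemma act_neg_act: "x \<in> D (- g) \<Longrightarrow> \<theta> (- g) (\<theta> g x) = x"
  using homeo[of g] dom_subset unfolding homeomorphic_maps_def
  by (auto simp: topspace_subtopology_subset)

lemma act_act_neg: "x \<in> D g \<Longrightarrow> \<theta> g (\<theta> (- g) x) = x"
  using act_neg_act[of x "- g"] by simp

text \<open>Both directions come from \<open>image_dom\<close>, used once for
  \<open>\<theta> (- h)\<close> and once for \<open>\<theta> h\<close>: the two inclusions together
  say that the points of \<open>D (- h)\<close> at which the composite is defined are those in the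
  domain of \<open>\<theta> (g + h)\<close>.\<close>

lemma act_in_dom_iff:
  assumes "x \<in> D (- h)"
  shows "\<theta> h x \<in> D (- g) \<longleftrightarrow> x \<in> D (- (g + h))"
proof
  assume *: "\<theta> h x \<in> D (- g)"
  have "\<theta> (- h) (\<theta> h x) \<in> D (- h + - g)"
    using image_dom[of "- h" "- g"] act_in_dom[OF assms] * by auto
  then show "x \<in> D (- (g + h))"
    using act_neg_act[OF assms] by (simp add: minus_add)
next
  assume "x \<in> D (- (g + h))"
  then have "\<theta> h x \<in> D (h + (- h + - g))"
    using image_dom[of h "- h + - g"] assms by (auto simp: minus_add)
  then show "\<theta> h x \<in> D (- g)"
    by (simp add: add.assoc[symmetric] del: add_uminus_conv_diff)
qed

lemma act_act:
  assumes "x \<in> D (- h)" "x \<in> D (- (g + h))"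
  shows "\<theta> g (\<theta> h x) = \<theta> (g + h) x"
  using act_comp[of x h g] assms by (simp add: minus_add)

lemma act_image:
  assumes "U \<subseteq> D (- g)"
  shows "\<theta> g ` U = {z \<in> D g. \<theta> (- g) z \<in> U}"
proof
  show "\<theta> g ` U \<subseteq> {z \<in> D g. \<theta> (- g) z \<in> U}"
    using assms by (auto intro: act_in_dom simp: act_neg_act subset_iff)
  show "{z \<in> D g. \<theta> (- g) z \<in> U} \<subseteq> \<theta> g ` U"
    using act_act_neg by (metis (mono_tags, lifting) image_eqI mem_Collect_eq subsetI)
qed

lemma act_homeomorphic_map: "homeomorphic_map (subtopology X (D (- g))) (subtopology X (D g)) (\<theta> g)"
  using homeo homeomorphic_map_maps by blast

lemma act_image_openin:
  assumes "openin X U" "U \<subseteq> D (- g)"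
  shows "openin X (\<theta> g ` U)"
proof -
  have "openin (subtopology X (D (- g))) U"
    using assms by (simp add: openin_open_subtopology open_dom)
  then have "openin (subtopology X (D g)) (\<theta> g ` U)"
    using homeomorphic_imp_open_map[OF act_homeomorphic_map] by (simp add: open_map_def)
  then show ?thesis
    by (simp add: openin_open_subtopology open_dom)
qed

lemma act_image_compact_open:
  assumes "compact_open X U" "U \<subseteq> D (- g)"
  shows "compact_open X (\<theta> g ` U)"
proof -
  have "compactin (subtopology X (D (- g))) U"
    using assms by (simp add: compactin_subtopology compact_open_def)
  then have "compactin (subtopology X (D g)) (\<theta> g ` U)"
    using image_compactin homeomorphic_imp_continuous_map[OF act_homeomorphic_map] by metis
  then show ?thesis
    using act_image_openin assms by (simp add: compactin_subtopology compact_open_def)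
qed

lemma act_preimage_openin:
  assumes "openin X U"
  shows "openin X {x \<in> D (- g). \<theta> g x \<in> U}"
proof -
  have "openin (subtopology X (D (- g))) {x \<in> topspace (subtopology X (D (- g))). \<theta> g x \<in> U \<inter> D g}"
    using homeomorphic_imp_continuous_map[OF act_homeomorphic_map[of g]] assms open_dom
    by (intro openin_continuous_map_preimage[where Y = "subtopology X (D g)"])
      (simp_all add: openin_open_subtopology openin_Int)
  moreover have "{x \<in> topspace (subtopology X (D (- g))). \<theta> g x \<in> U \<inter> D g} = {x \<in> D (- g). \<theta> g x \<in> U}"
    using dom_subset act_in_dom by (auto simp: topspace_subtopology)
  ultimately show ?thesis
    by (simp add: openin_open_subtopology open_dom)
qed

text \<open>If \<open>\<theta> g\<close> and \<open>\<theta> h\<close> agree on the open set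
  \<open>P\<close>, then \<open>k = - h + g\<close> fixes every point of \<open>P\<close>. For
  \<open>k \<noteq> 0\<close> the points moved by \<open>k\<close> are dense in its domain, so the
  nonempty open set \<open>P\<close> would contain one.\<close>

lemma germ_unique:
  assumes free: "topologically_free X D \<theta>"
    and P: "openin X P" "x \<in> P"
    and eq: "\<And>z. z \<in> P \<Longrightarrow> z \<in> D (- g) \<and> z \<in> D (- h) \<and> \<theta> g z = \<theta> h z"
  shows "g = h"
proof (rule ccontr)
  assume "g \<noteq> h"
  define k where "k = - h + g"
  have k: "k \<noteq> 0"
    using \<open>g \<noteq> h\<close> unfolding k_def by (metis add.assoc add.right_neutral right_minus add.left_neutral)
  have fixk: "z \<in> D (- k) \<and> \<theta> k z = z" if "z \<in> P" for z
  proof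
    have z: "z \<in> D (- g)" "z \<in> D (- h)" "\<theta> g z = \<theta> h z"
      using eq[OF that] by auto
    then show "z \<in> D (- k)"
      unfolding k_def using act_in_dom_iff[of z g "- h"] act_in_dom[of z h] by simp
    then show "\<theta> k z = z"
      using z act_act[of z g "- h"] act_neg_act[of z h] by (simp add: k_def)
  qed
  have "openin (subtopology X (D (- k))) P"
    using P fixk by (auto simp: openin_open_subtopology open_dom)
  moreover have "subtopology X (D (- k)) closure_of {x \<in> D (- k). \<theta> k x \<noteq> x} = D (- k)"
    using free k unfolding topologically_free_def by blast
  then have "x \<in> subtopology X (D (- k)) closure_of {x \<in> D (- k). \<theta> k x \<noteq> x}"
    using fixk P by blast
  ultimately show False
    using P fixk unfolding in_closure_of by blast
qed

end

section \<open>Continuity over a discrete group: local constancy on slices\<close>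

lemma continuous_map_discrete_iff:
  fixes f :: "'a \<Rightarrow> 'b"
  shows "continuous_map X (discrete_topology UNIV) f \<longleftrightarrow>
     (\<forall>x \<in> topspace X. \<exists>P. openin X P \<and> x \<in> P \<and> (\<forall>z\<in>P. f z = f x))"
proof
  assume f: "continuous_map X (discrete_topology UNIV) f"
  show "\<forall>x \<in> topspace X. \<exists>P. openin X P \<and> x \<in> P \<and> (\<forall>z\<in>P. f z = f x)"
  proof
    fix x assume "x \<in> topspace X"
    then show "\<exists>P. openin X P \<and> x \<in> P \<and> (\<forall>z\<in>P. f z = f x)"
      using openin_continuous_map_preimage[OF f, of "{f x}"]
      by (intro exI[of _ "{z \<in> topspace X. f z \<in> {f x}}"]) simp
  qed
next
  assume r: "\<forall>x \<in> topspace X. \<exists>P. openin X P \<and> x \<in> P \<and> (\<forall>z\<in>P. f z = f x)"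
  show "continuous_map X (discrete_topology UNIV) f"
    unfolding continuous_map_def
  proof (intro conjI allI impI)
    fix U assume "openin (discrete_topology (UNIV :: 'b set)) U"
    show "openin X {x \<in> topspace X. f x \<in> U}"
    proof (subst openin_subopen, clarify)
      fix x assume "x \<in> topspace X" "f x \<in> U"
      then obtain P where P: "openin X P" "x \<in> P" "\<forall>z\<in>P. f z = f x"
        using r by blast
      then have "P \<subseteq> {x \<in> topspace X. f x \<in> U}"
        using \<open>f x \<in> U\<close> openin_subset[OF P(1)] P(3) by (metis (mono_tags, lifting) mem_Collect_eq subsetD subsetI)
      then show "\<exists>T. openin X T \<and> x \<in> T \<and> T \<subseteq> {x \<in> topspace X. f x \<in> U}"
        using P by blast
    qed
  qed simp
qed

abbreviation fibered_topology :: "'x topology \<Rightarrow> ('g \<Rightarrow> 'x set) \<Rightarrow> ('g \<times> 'x) topology" where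
  "fibered_topology X D \<equiv> subtopology (prod_topology (discrete_topology UNIV) X) (SIGMA g:UNIV. D g)"

lemma topspace_fibered_topology:
  assumes "\<And>g. D g \<subseteq> topspace X"
  shows "topspace (fibered_topology X D) = (SIGMA g:UNIV. D g)"
  using assms by (auto simp: topspace_subtopology)

lemma openin_fibered_slice:
  assumes "openin X P" "P \<subseteq> D g"
  shows "openin (fibered_topology X D) ({g} \<times> P)"
proof -
  have "openin (prod_topology (discrete_topology UNIV) X) ({g} \<times> P)"
    using assms by (simp add: openin_prod_Times_iff)
  then have "openin (fibered_topology X D) ((SIGMA g:UNIV. D g) \<inter> ({g} \<times> P))"
    by (rule openin_subtopology_Int2)
  moreover have "(SIGMA g:UNIV. D g) \<inter> ({g} \<times> P) = {g} \<times> P"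
    using assms by auto
  ultimately show ?thesis
    by simp
qed

lemma openin_fibered_fiber:
  assumes "\<And>g. openin X (D g)" "openin (fibered_topology X D) U"
  shows "openin X {x. (g, x) \<in> U}"
proof -
  obtain V where V: "openin (prod_topology (discrete_topology UNIV) X) V" "U = V \<inter> (SIGMA g:UNIV. D g)"
    using assms(2) unfolding openin_subtopology by blast
  have "continuous_map X (prod_topology (discrete_topology UNIV) X) (\<lambda>x. (g, x))"
    by (simp add: continuous_map_pairwise o_def)
  then have "openin X {x \<in> topspace X. (g, x) \<in> V}"
    using V openin_continuous_map_preimage by blast
  moreover have "{x. (g, x) \<in> U} = {x \<in> topspace X. (g, x) \<in> V} \<inter> D g"
    using V openin_subset[OF assms(1), of g] by auto
  ultimately show ?thesis
    using assms(1) by auto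
qed

text \<open>The group is discrete, so the slices \<open>{g} \<times> P\<close> with \<open>P\<close>
  open in \<open>D g\<close> form a base and local constancy is tested on each domain separately.
  The family \<open>D\<close> is arbitrary: it is used with \<open>D (- g)\<close> for
  \<open>action_space\<close> and with \<open>D g\<close> for the groupoid.\<close>

lemma continuous_map_fibered_discrete_iff:
  assumes "\<And>g. openin X (D g)"
  shows "continuous_map (fibered_topology X D) (discrete_topology UNIV) f \<longleftrightarrow>
    (\<forall>g. \<forall>x\<in>D g. \<exists>P. openin X P \<and> x \<in> P \<and> P \<subseteq> D g \<and> (\<forall>z\<in>P. f (g, z) = f (g, x)))"
proof -
  have sub: "\<And>g. D g \<subseteq> topspace X"
    using assms openin_subset by blast
  show ?thesis
    unfolding continuous_map_discrete_iff topspace_fibered_topology[OF sub]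
  proof (intro iffI allI ballI)
    fix g x assume x: "x \<in> D g" and
      "\<forall>q \<in> Sigma UNIV D. \<exists>P. openin (fibered_topology X D) P \<and> q \<in> P \<and> (\<forall>z\<in>P. f z = f q)"
    then obtain P where P: "openin (fibered_topology X D) P" "(g, x) \<in> P" "\<forall>z\<in>P. f z = f (g, x)"
      by (metis SigmaI UNIV_I)
    have "P \<subseteq> Sigma UNIV D"
      using openin_subset[OF P(1)] topspace_fibered_topology[of D, OF sub] by simp
    then show "\<exists>P. openin X P \<and> x \<in> P \<and> P \<subseteq> D g \<and> (\<forall>z\<in>P. f (g, z) = f (g, x))"
      using openin_fibered_fiber[OF assms P(1), of g] P by (intro exI[of _ "{x. (g, x) \<in> P}"]) blast
  next
    fix q assume q: "q \<in> Sigma UNIV D" and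
      r: "\<forall>g. \<forall>x\<in>D g. \<exists>P. openin X P \<and> x \<in> P \<and> P \<subseteq> D g \<and> (\<forall>z\<in>P. f (g, z) = f (g, x))"
    obtain g x where gx: "q = (g, x)" "x \<in> D g"
      using q by auto
    then obtain P where P: "openin X P" "x \<in> P" "P \<subseteq> D g" "\<forall>z\<in>P. f (g, z) = f (g, x)"
      using r by blast
    then show "\<exists>P. openin (fibered_topology X D) P \<and> q \<in> P \<and> (\<forall>z\<in>P. f z = f q)"
      using openin_fibered_slice[of X P D g, OF P(1,3)] unfolding gx(1) by (intro exI[of _ "{g} \<times> P"]) blast
  qed
qed

section \<open>Orbit germs, orbit maps and cocycles\<close>

text \<open>One \<open>h\<close> has to serve a whole neighbourhood of \<open>x\<close>. This builds
  the local constancy of a cocycle into the relation, without choosing a cocycle first; the choice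
  is made only once germs are known to be unique.\<close>

definition orbit_germ ::
    "'x topology \<Rightarrow> ('g::group_add \<Rightarrow> 'x set) \<Rightarrow> ('g \<Rightarrow> 'x \<Rightarrow> 'x) \<Rightarrow>
     ('h::group_add \<Rightarrow> 'y set) \<Rightarrow> ('h \<Rightarrow> 'y \<Rightarrow> 'y) \<Rightarrow> ('x \<Rightarrow> 'y) \<Rightarrow> 'g \<Rightarrow> 'x \<Rightarrow> 'h \<Rightarrow> bool" where
  "orbit_germ X D \<theta> E \<gamma> \<phi> g x h \<longleftrightarrow>
     (\<exists>P. openin X P \<and> x \<in> P \<and> P \<subseteq> D (- g) \<and> (\<forall>z\<in>P. \<phi> z \<in> E (- h) \<and> \<gamma> h (\<phi> z) = \<phi> (\<theta> g z)))"

lemma orbit_germD: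
  "orbit_germ X D \<theta> E \<gamma> \<phi> g x h \<Longrightarrow> x \<in> D (- g) \<and> \<phi> x \<in> E (- h) \<and> \<gamma> h (\<phi> x) = \<phi> (\<theta> g x)"
  unfolding orbit_germ_def by blast

lemma orbit_germ_near:
  assumes "orbit_germ X D \<theta> E \<gamma> \<phi> g x h"
  obtains P where "openin X P" "x \<in> P" "P \<subseteq> D (- g)" "\<And>z. z \<in> P \<Longrightarrow> orbit_germ X D \<theta> E \<gamma> \<phi> g z h"
  using assms unfolding orbit_germ_def by blast

definition orbit_map ::
    "'x topology \<Rightarrow> ('g::group_add \<Rightarrow> 'x set) \<Rightarrow> ('g \<Rightarrow> 'x \<Rightarrow> 'x) \<Rightarrow>
     ('h::group_add \<Rightarrow> 'y set) \<Rightarrow> ('h \<Rightarrow> 'y \<Rightarrow> 'y) \<Rightarrow> ('x \<Rightarrow> 'y) \<Rightarrow> bool" where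
  "orbit_map X D \<theta> E \<gamma> \<phi> \<longleftrightarrow> (\<forall>g. \<forall>x\<in>D (- g). \<exists>h. orbit_germ X D \<theta> E \<gamma> \<phi> g x h)"

locale partial_action_pair =
  X: partial_action X D \<theta> + Y: partial_action Y E \<gamma>
  for X :: "'x topology" and D :: "'g::group_add \<Rightarrow> 'x set" and \<theta> :: "'g \<Rightarrow> 'x \<Rightarrow> 'x"
    and Y :: "'y topology" and E :: "'h::group_add \<Rightarrow> 'y set" and \<gamma> :: "'h \<Rightarrow> 'y \<Rightarrow> 'y"
begin

abbreviation germ where "germ \<equiv> orbit_germ X D \<theta> E \<gamma>"

lemma swap_pair: "partial_action_pair Y E \<gamma> X D \<theta>"
  by unfold_locales

lemma orbit_germ_unique:
  assumes "homeomorphic_map X Y \<phi>" "topologically_free Y E \<gamma>"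
    and h: "germ \<phi> g x h" and h': "germ \<phi> g x h'"
  shows "h = h'"
proof -
  obtain P where P: "openin X P" "x \<in> P" "P \<subseteq> D (- g)"
      "\<forall>z\<in>P. \<phi> z \<in> E (- h) \<and> \<gamma> h (\<phi> z) = \<phi> (\<theta> g z)"
    using h unfolding orbit_germ_def by blast
  obtain Q where Q: "openin X Q" "x \<in> Q" "Q \<subseteq> D (- g)"
      "\<forall>z\<in>Q. \<phi> z \<in> E (- h') \<and> \<gamma> h' (\<phi> z) = \<phi> (\<theta> g z)"
    using h' unfolding orbit_germ_def by blast
  have "openin Y (\<phi> ` (P \<inter> Q))"
    using homeomorphic_imp_open_map[OF assms(1)] P Q by (simp add: open_map_def openin_Int)
  then show ?thesis
    using P Q by (intro Y.germ_unique[OF assms(2), of _ "\<phi> x"]) auto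
qed

lemma orbit_germ_zero:
  assumes "homeomorphic_map X Y \<phi>" "x \<in> topspace X"
  shows "germ \<phi> 0 x 0"
  unfolding orbit_germ_def
proof (intro exI[of _ "topspace X"] conjI ballI)
  fix z assume z: "z \<in> topspace X"
  then have *: "\<phi> z \<in> topspace Y"
    using assms homeomorphic_imp_surjective_map by blast
  show "\<phi> z \<in> E (- 0)" "\<gamma> 0 (\<phi> z) = \<phi> (\<theta> 0 z)"
    using z * by (simp_all add: Y.dom_unit Y.act_unit X.act_unit)
qed (use assms X.dom_unit in auto)

text \<open>This is the cocycle identity in terms of germs: in multiplicative notation,
  \<open>a(g'g, x) = a(g', \<theta>_g(x)) a(g, x)\<close>. Uniqueness of germs later turns it into
  multiplicativity of the map between the groupoids.\<close>

lemma orbit_germ_add: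
  assumes "x \<in> D (- g)" and h: "germ \<phi> g x h" and h': "germ \<phi> g' (\<theta> g x) h'"
  shows "germ \<phi> (g' + g) x (h' + h)"
proof -
  obtain P where P: "openin X P" "x \<in> P" "P \<subseteq> D (- g)"
      "\<forall>z\<in>P. \<phi> z \<in> E (- h) \<and> \<gamma> h (\<phi> z) = \<phi> (\<theta> g z)"
    using h unfolding orbit_germ_def by blast
  obtain Q where Q: "openin X Q" "\<theta> g x \<in> Q" "Q \<subseteq> D (- g')"
      "\<forall>z\<in>Q. \<phi> z \<in> E (- h') \<and> \<gamma> h' (\<phi> z) = \<phi> (\<theta> g' z)"
    using h' unfolding orbit_germ_def by blast
  define W where "W = P \<inter> {z \<in> D (- g). \<theta> g z \<in> Q}"
  show ?thesis
    unfolding orbit_germ_def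
  proof (intro exI[of _ W] conjI ballI)
    show "openin X W"
      unfolding W_def using P Q X.act_preimage_openin by blast
    show "x \<in> W"
      using P Q assms unfolding W_def by auto
    have 1: "z \<in> D (- (g' + g))" if "z \<in> W" for z
      using X.act_in_dom_iff[of z g g'] that Q unfolding W_def by auto
    then show "W \<subseteq> D (- (g' + g))"
      by blast
    fix z assume z: "z \<in> W"
    then have z': "\<phi> z \<in> E (- h)" "\<gamma> h (\<phi> z) = \<phi> (\<theta> g z)" "\<phi> (\<theta> g z) \<in> E (- h')"
        "\<gamma> h' (\<phi> (\<theta> g z)) = \<phi> (\<theta> g' (\<theta> g z))" "z \<in> D (- g)"
      using P Q unfolding W_def by auto
    then show 2: "\<phi> z \<in> E (- (h' + h))"
      using Y.act_in_dom_iff[of "\<phi> z" h h'] by simp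
    show "\<gamma> (h' + h) (\<phi> z) = \<phi> (\<theta> (g' + g) z)"
      using Y.act_act[OF z'(1) 2] X.act_act[OF z'(5) 1[OF z]] z' by simp
  qed
qed

text \<open>Near \<open>x\<close> the two conjugacy relations combine, through
  \<open>\<psi> (\<phi> z) = z\<close>, to \<open>\<theta> g' z = \<theta> g z\<close>, and freeness
  of \<open>\<theta>\<close> gives \<open>g' = g\<close>. Consequently the cocycles of two mutually
  inverse orbit maps undo each other.\<close>

lemma orbit_germ_inverse:
  assumes maps: "homeomorphic_maps X Y \<phi> \<psi>" and "topologically_free X D \<theta>"
    and h: "germ \<phi> g x h" and g': "orbit_germ Y E \<gamma> D \<theta> \<psi> h (\<phi> x) g'"
  shows "g' = g"
proof -
  obtain P where P: "openin X P" "x \<in> P" "P \<subseteq> D (- g)"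
      "\<forall>z\<in>P. \<phi> z \<in> E (- h) \<and> \<gamma> h (\<phi> z) = \<phi> (\<theta> g z)"
    using h unfolding orbit_germ_def by blast
  obtain Q where Q: "openin Y Q" "\<phi> x \<in> Q" "Q \<subseteq> E (- h)"
      "\<forall>y\<in>Q. \<psi> y \<in> D (- g') \<and> \<theta> g' (\<psi> y) = \<psi> (\<gamma> h y)"
    using g' unfolding orbit_germ_def by blast
  have cont: "continuous_map X Y \<phi>" and inv: "\<And>z. z \<in> topspace X \<Longrightarrow> \<psi> (\<phi> z) = z"
    using maps by (auto simp: homeomorphic_maps_def)
  define W where "W = P \<inter> {z \<in> topspace X. \<phi> z \<in> Q}"
  have "openin X W"
    unfolding W_def using P(1) Q(1) openin_continuous_map_preimage[OF cont] by blast
  moreover have "x \<in> W"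
    using P Q openin_subset unfolding W_def by blast
  moreover have "z \<in> D (- g') \<and> z \<in> D (- g) \<and> \<theta> g' z = \<theta> g z" if "z \<in> W" for z
  proof -
    have z: "z \<in> topspace X" "z \<in> D (- g)" "\<phi> z \<in> Q" "z \<in> P"
      using that P unfolding W_def by auto
    have "\<psi> (\<phi> z) \<in> D (- g')" "\<theta> g' (\<psi> (\<phi> z)) = \<psi> (\<gamma> h (\<phi> z))" "\<gamma> h (\<phi> z) = \<phi> (\<theta> g z)"
      using Q(4) P(4) z by auto
    moreover have "\<theta> g z \<in> topspace X"
      using X.act_in_dom[OF z(2)] X.dom_subset by blast
    ultimately show ?thesis
      using inv z by simp
  qed
  ultimately show ?thesis
    using X.germ_unique[OF assms(2)] by blast
qed

text \<open>An arbitrary choice of germs is continuous: the value chosen at \<open>x\<close> is also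
  a germ at all nearby points, and there it is the only one.\<close>

lemma orbit_map_cocycle:
  assumes maps: "homeomorphic_maps X Y \<phi> \<psi>" and "topologically_free Y E \<gamma>"
    and "orbit_map X D \<theta> E \<gamma> \<phi>"
  obtains a where "\<And>g x. x \<in> D (- g) \<Longrightarrow> germ \<phi> g x (a (g, x))"
    "continuous_map (action_space X D) (discrete_topology UNIV) a"
proof -
  have hm: "homeomorphic_map X Y \<phi>"
    using maps homeomorphic_map_maps by blast
  define a where "a = (\<lambda>(g, x). SOME h. germ \<phi> g x h)"
  have a: "germ \<phi> g x (a (g, x))" if "x \<in> D (- g)" for g x
    using assms(3) that unfolding orbit_map_def a_def by (auto intro: someI_ex)
  moreover have "continuous_map (action_space X D) (discrete_topology UNIV) a"
    unfolding action_space_def continuous_map_fibered_discrete_iff[where D = "\<lambda>g. D (- g)", OF X.open_dom]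
  proof (intro allI ballI)
    fix g x assume x: "x \<in> D (- g)"
    obtain P where P: "openin X P" "x \<in> P" "P \<subseteq> D (- g)" "\<And>z. z \<in> P \<Longrightarrow> germ \<phi> g z (a (g, x))"
      using orbit_germ_near[OF a[OF x]] by metis
    have "a (g, z) = a (g, x)" if "z \<in> P" for z
      using orbit_germ_unique[OF hm assms(2) a P(4)] that P(3) by blast
    then show "\<exists>P. openin X P \<and> x \<in> P \<and> P \<subseteq> D (- g) \<and> (\<forall>z\<in>P. a (g, z) = a (g, x))"
      using P by blast
  qed
  ultimately show ?thesis
    by (rule that)
qed

lemma cocycle_orbit_map:
  assumes "continuous_map (action_space X D) (discrete_topology UNIV) a"
    and "\<forall>g. \<forall>x \<in> D (- g). \<phi> x \<in> E (- a (g, x)) \<and> \<phi> (\<theta> g x) = \<gamma> (a (g, x)) (\<phi> x)"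
  shows "orbit_map X D \<theta> E \<gamma> \<phi>"
  unfolding orbit_map_def orbit_germ_def
proof (intro allI ballI)
  fix g x assume x: "x \<in> D (- g)"
  have *: "\<forall>g. \<forall>x\<in>D (- g). \<exists>P. openin X P \<and> x \<in> P \<and> P \<subseteq> D (- g) \<and> (\<forall>z\<in>P. a (g, z) = a (g, x))"
    using assms(1) continuous_map_fibered_discrete_iff[where D = "\<lambda>g. D (- g)" and f = a, OF X.open_dom]
    unfolding action_space_def by simp
  obtain P where P: "openin X P" "x \<in> P" "P \<subseteq> D (- g)" "\<forall>z\<in>P. a (g, z) = a (g, x)"
    using *[rule_format, OF x] by (elim exE conjE) (rule that)
  have "\<forall>z\<in>P. \<phi> z \<in> E (- a (g, x)) \<and> \<gamma> (a (g, x)) (\<phi> z) = \<phi> (\<theta> g z)"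
  proof
    fix z assume that: "z \<in> P"
    show "\<phi> z \<in> E (- a (g, x)) \<and> \<gamma> (a (g, x)) (\<phi> z) = \<phi> (\<theta> g z)"
      using assms(2)[THEN spec, THEN bspec, OF subsetD[OF P(3) that]] bspec[OF P(4) that] by simp
  qed
  with P(1-3) show "\<exists>h P. openin X P \<and> x \<in> P \<and> P \<subseteq> D (- g) \<and> (\<forall>z\<in>P. \<phi> z \<in> E (- h) \<and> \<gamma> h (\<phi> z) = \<phi> (\<theta> g z))"
    by (intro exI conjI) assumption+
qed

lemma orbit_maps_imp_orbit_equivalent:
  assumes "topologically_free X D \<theta>" "topologically_free Y E \<gamma>"
    and "homeomorphic_maps X Y \<phi> \<psi>" "orbit_map X D \<theta> E \<gamma> \<phi>" "orbit_map Y E \<gamma> D \<theta> \<psi>"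
  shows "continuously_orbit_equivalent X D \<theta> Y E \<gamma>"
proof -
  interpret swapped: partial_action_pair Y E \<gamma> X D \<theta>
    by (rule swap_pair)
  obtain a where a: "\<And>g x. x \<in> D (- g) \<Longrightarrow> germ \<phi> g x (a (g, x))"
    "continuous_map (action_space X D) (discrete_topology UNIV) a"
    using orbit_map_cocycle[OF assms(3,2,4)] by metis
  obtain b where b: "\<And>h y. y \<in> E (- h) \<Longrightarrow> swapped.germ \<psi> h y (b (h, y))"
    "continuous_map (action_space Y E) (discrete_topology UNIV) b"
    using swapped.orbit_map_cocycle[of \<psi> \<phi>] assms by (metis homeomorphic_maps_sym)
  show ?thesis
    unfolding continuously_orbit_equivalent_def
  proof (intro exI[of _ \<phi>] exI[of _ \<psi>] exI[of _ a] exI[of _ b] conjI allI ballI)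
    fix g x assume "x \<in> D (- g)"
    from orbit_germD[OF a(1)[OF this]]
    show "\<phi> x \<in> E (- a (g, x))" "\<phi> (\<theta> g x) = \<gamma> (a (g, x)) (\<phi> x)"
      by auto
  next
    fix h y assume "y \<in> E (- h)"
    from orbit_germD[OF b(1)[OF this]]
    show "\<psi> y \<in> D (- b (h, y))" "\<psi> (\<gamma> h y) = \<theta> (b (h, y)) (\<psi> y)"
      by auto
  qed (use a b assms(3) in auto)
qed

lemma orbit_equivalent_imp_orbit_maps:
  assumes "continuously_orbit_equivalent X D \<theta> Y E \<gamma>"
  obtains \<phi> \<psi> where "homeomorphic_maps X Y \<phi> \<psi>" "orbit_map X D \<theta> E \<gamma> \<phi>" "orbit_map Y E \<gamma> D \<theta> \<psi>"
proof -
  interpret swapped: partial_action_pair Y E \<gamma> X D \<theta>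
    by (rule swap_pair)
  obtain \<phi> \<psi> a b where *: "homeomorphic_maps X Y \<phi> \<psi> \<and>
        continuous_map (action_space X D) (discrete_topology UNIV) a \<and>
        continuous_map (action_space Y E) (discrete_topology UNIV) b \<and>
        (\<forall>g. \<forall>x \<in> D (- g). \<phi> x \<in> E (- a (g, x)) \<and> \<phi> (\<theta> g x) = \<gamma> (a (g, x)) (\<phi> x)) \<and>
        (\<forall>h. \<forall>y \<in> E (- h). \<psi> y \<in> D (- b (h, y)) \<and> \<psi> (\<gamma> h y) = \<theta> (b (h, y)) (\<psi> y))"
    using assms unfolding continuously_orbit_equivalent_def by (elim exE) (rule that)
  show ?thesis
  proof (rule that)
    show "homeomorphic_maps X Y \<phi> \<psi>"
      using * by (rule conjunct1)
    from * have "continuous_map (action_space X D) (discrete_topology UNIV) a"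
      by (elim conjE)
    moreover from * have
      "\<forall>g. \<forall>x \<in> D (- g). \<phi> x \<in> E (- a (g, x)) \<and> \<phi> (\<theta> g x) = \<gamma> (a (g, x)) (\<phi> x)"
      by (elim conjE)
    ultimately show "orbit_map X D \<theta> E \<gamma> \<phi>"
      by (rule cocycle_orbit_map)
    from * have "continuous_map (action_space Y E) (discrete_topology UNIV) b"
      by (elim conjE)
    moreover from * have
      "\<forall>h. \<forall>y \<in> E (- h). \<psi> y \<in> D (- b (h, y)) \<and> \<psi> (\<gamma> h y) = \<theta> (b (h, y)) (\<psi> y)"
      by (elim conjE)
    ultimately show "orbit_map Y E \<gamma> D \<theta> \<psi>"
      by (rule swapped.cocycle_orbit_map)
  qed
qed

end

section \<open>Transformation groupoids and orbit equivalence\<close>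

lemma transformation_groupoid_simps [simp]:
  "gtop (transformation_groupoid X D \<theta>) = fibered_topology X D"
  "gunits (transformation_groupoid X D \<theta>) = {0} \<times> topspace X"
  "gsrc (transformation_groupoid X D \<theta>) (t, x) = (0, \<theta> (- t) x)"
  "grng (transformation_groupoid X D \<theta>) (t, x) = (0, x)"
  "gmul (transformation_groupoid X D \<theta>) (s, y) (t, x') = (s + t, y)"
  by (simp_all add: transformation_groupoid_def)

text \<open>The record \<open>groupoid\<close> carries no axioms. These closure properties are what
  is used to invert an isomorphism and to transport a convolution product.\<close>

definition groupoid_closed :: "'a groupoid \<Rightarrow> bool" where
  "groupoid_closed \<G> \<longleftrightarrow> gunits \<G> \<subseteq> topspace (gtop \<G>) \<and>
     (\<forall>c \<in> topspace (gtop \<G>). gsrc \<G> c \<in> topspace (gtop \<G>) \<and> grng \<G> c \<in> topspace (gtop \<G>)) \<and>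
     (\<forall>(c, d) \<in> gcomposable \<G>. gmul \<G> c d \<in> topspace (gtop \<G>))"

lemma groupoid_iso_inverse:
  assumes iso: "groupoid_iso \<G> \<H> \<kappa>" and "groupoid_closed \<G>"
  obtains \<kappa>' where "homeomorphic_maps (gtop \<G>) (gtop \<H>) \<kappa> \<kappa>'" "groupoid_iso \<H> \<G> \<kappa>'"
proof -
  have "homeomorphic_map (gtop \<G>) (gtop \<H>) \<kappa>"
    using iso by (simp add: groupoid_iso_def)
  then obtain \<kappa>' where maps: "homeomorphic_maps (gtop \<G>) (gtop \<H>) \<kappa> \<kappa>'"
    unfolding homeomorphic_map_maps by (elim exE) (rule that)
  then have inv: "\<And>c. c \<in> topspace (gtop \<G>) \<Longrightarrow> \<kappa>' (\<kappa> c) = c \<and> \<kappa> c \<in> topspace (gtop \<H>)"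
    "\<And>c. c \<in> topspace (gtop \<H>) \<Longrightarrow> \<kappa> (\<kappa>' c) = c \<and> \<kappa>' c \<in> topspace (gtop \<G>)"
    unfolding homeomorphic_maps_def continuous_map_def by auto
  have sr: "\<kappa>' (grng \<H> c) = grng \<G> (\<kappa>' c) \<and> \<kappa>' (gsrc \<H> c) = gsrc \<G> (\<kappa>' c)"
    if "c \<in> topspace (gtop \<H>)" for c
    using iso assms(2) inv that unfolding groupoid_iso_def groupoid_closed_def by metis
  have "groupoid_iso \<H> \<G> \<kappa>'"
    unfolding groupoid_iso_def
  proof (intro conjI ballI)
    show "homeomorphic_map (gtop \<H>) (gtop \<G>) \<kappa>'"
      using maps homeomorphic_map_maps homeomorphic_maps_sym by metis
    have "\<kappa>' ` \<kappa> ` gunits \<G> = gunits \<G>"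
      using inv assms(2) unfolding groupoid_closed_def by force
    then show "\<kappa>' ` gunits \<H> = gunits \<G>"
      using iso unfolding groupoid_iso_def by simp
  next
    fix p assume p: "p \<in> gcomposable \<H>"
    obtain c d where cd: "p = (c, d)"
      by fastforce
    then have "c \<in> topspace (gtop \<H>)" "d \<in> topspace (gtop \<H>)" "gsrc \<H> c = grng \<H> d"
      using p unfolding gcomposable_def by auto
    then have 1: "(\<kappa>' c, \<kappa>' d) \<in> gcomposable \<G>" "\<kappa> (\<kappa>' c) = c" "\<kappa> (\<kappa>' d) = d"
      using sr inv unfolding gcomposable_def by (auto, metis)
    then have "gmul \<G> (\<kappa>' c) (\<kappa>' d) \<in> topspace (gtop \<G>)"
        "\<kappa> (gmul \<G> (\<kappa>' c) (\<kappa>' d)) = gmul \<H> c d"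
      using iso assms(2) unfolding groupoid_iso_def groupoid_closed_def by fastforce+
    then have "\<kappa>' (gmul \<H> c d) = gmul \<G> (\<kappa>' c) (\<kappa>' d)"
      using inv by metis
    then show "case p of (c, d) \<Rightarrow> \<kappa>' (gmul \<H> c d) = gmul \<G> (\<kappa>' c) (\<kappa>' d)"
      using cd by simp
  qed (use sr in auto)
  with maps show ?thesis
    by (rule that)
qed

context partial_action
begin

abbreviation groupoid where "groupoid \<equiv> transformation_groupoid X D \<theta>"

lemma topspace_groupoid: "topspace (fibered_topology X D) = Sigma UNIV D"
  by (rule topspace_fibered_topology[OF dom_subset])

lemma topspace_gtop_groupoid: "topspace (gtop groupoid) = Sigma UNIV D"
  by (simp only: transformation_groupoid_simps topspace_groupoid)

lemma groupoid_composable: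
  "((s, y), (t, x)) \<in> gcomposable groupoid \<longleftrightarrow> y \<in> D s \<and> x \<in> D t \<and> \<theta> (- s) y = x"
  unfolding gcomposable_def topspace_gtop_groupoid by auto

lemma groupoid_mult_dom:
  assumes "y \<in> D s" "\<theta> (- s) y \<in> D t"
  shows "y \<in> D (s + t)" "\<theta> (- t) (\<theta> (- s) y) = \<theta> (- (s + t)) y"
  using act_in_dom_iff[of y "- s" "- t"] act_act[of y "- s" "- t"] assms
  by (simp_all add: minus_add del: add_uminus_conv_diff)

lemma groupoid_is_closed: "groupoid_closed groupoid"
  unfolding groupoid_closed_def topspace_gtop_groupoid
proof (intro conjI ballI)
  fix c assume "c \<in> Sigma UNIV D"
  then obtain t x where "c = (t, x)" "x \<in> D t"
    by auto
  then show "gsrc groupoid c \<in> Sigma UNIV D" "grng groupoid c \<in> Sigma UNIV D"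
    using subsetD[OF dom_subset act_neg_in_dom[of x t]] subsetD[OF dom_subset[of t], of x]
    by (simp_all add: dom_unit)
next
  fix p assume "p \<in> gcomposable groupoid"
  then show "case p of (c, d) \<Rightarrow> gmul groupoid c d \<in> Sigma UNIV D"
    using groupoid_mult_dom by (cases p) (auto simp: groupoid_composable)
qed (auto simp: dom_unit)

end

section \<open>From orbit maps to groupoid isomorphisms, and from those to orbit equivalence\<close>

context partial_action_pair
begin

text \<open>An arrow \<open>(t, x)\<close> is recorded by its range \<open>x\<close>, while germs
  live at its source \<open>\<theta> (- t) x\<close>. The relation at the source is rewritten here
  as statements about \<open>\<phi> x\<close>: that \<open>(h, \<phi> x)\<close> is an arrow, and
  what its source is.\<close>

lemma germ_groupoid:
  assumes "x \<in> D t" "germ \<phi> t (\<theta> (- t) x) h"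
  shows "\<phi> x \<in> E h" "\<gamma> (- h) (\<phi> x) = \<phi> (\<theta> (- t) x)"
proof -
  have *: "\<phi> (\<theta> (- t) x) \<in> E (- h)" "\<gamma> h (\<phi> (\<theta> (- t) x)) = \<phi> x"
    using orbit_germD[OF assms(2)] X.act_act_neg[OF assms(1)] by auto
  show "\<phi> x \<in> E h"
    using Y.act_in_dom[OF *(1)] * by simp
  show "\<gamma> (- h) (\<phi> x) = \<phi> (\<theta> (- t) x)"
    using Y.act_neg_act[OF *(1)] * by simp
qed

lemma germ_groupoid_map_continuous:
  assumes maps: "homeomorphic_maps X Y \<phi> \<psi>" and free: "topologically_free Y E \<gamma>"
    and a: "\<And>g x. x \<in> D (- g) \<Longrightarrow> germ \<phi> g x (a g x)"
  shows "continuous_map (fibered_topology X D) (fibered_topology Y E) (\<lambda>(t, x). (a t (\<theta> (- t) x), \<phi> x))"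
proof -
  have hm: "homeomorphic_map X Y \<phi>"
    using maps homeomorphic_map_maps by blast
  have "continuous_map (fibered_topology X D) (discrete_topology UNIV) (\<lambda>p. a (fst p) (\<theta> (- fst p) (snd p)))"
    unfolding continuous_map_fibered_discrete_iff[where D = D, OF X.open_dom]
  proof (intro allI ballI)
    fix g x assume x: "x \<in> D g"
    obtain P where P: "openin X P" "\<theta> (- g) x \<in> P" "P \<subseteq> D (- g)"
        "\<And>z. z \<in> P \<Longrightarrow> germ \<phi> g z (a g (\<theta> (- g) x))"
      using orbit_germ_near[OF a[OF X.act_neg_in_dom[OF x]]] by metis
    have eq: "a g z = a g (\<theta> (- g) x)" if "z \<in> P" for z
      using orbit_germ_unique[OF hm free a P(4)] that P(3) by blast
    show "\<exists>P. openin X P \<and> x \<in> P \<and> P \<subseteq> D g \<and>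
        (\<forall>z\<in>P. a (fst (g, z)) (\<theta> (- fst (g, z)) (snd (g, z))) = a (fst (g, x)) (\<theta> (- fst (g, x)) (snd (g, x))))"
      unfolding fst_conv snd_conv
    proof (intro exI[of _ "{z \<in> D g. \<theta> (- g) z \<in> P}"] conjI ballI)
      fix z assume "z \<in> {z \<in> D g. \<theta> (- g) z \<in> P}"
      then show "a g (\<theta> (- g) z) = a g (\<theta> (- g) x)"
        by (intro eq) simp
    qed (use X.act_preimage_openin[OF P(1), of "- g"] x P(2) in auto)
  qed
  moreover have "continuous_map (fibered_topology X D) Y (\<phi> \<circ> snd)"
    using homeomorphic_imp_continuous_map[OF hm] continuous_map_from_subtopology[OF continuous_map_snd]
    by (rule continuous_map_compose[rotated])
  ultimately have "continuous_map (fibered_topology X D) (prod_topology (discrete_topology UNIV) Y)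
      (\<lambda>(t, x). (a t (\<theta> (- t) x), \<phi> x))"
    unfolding continuous_map_pairwise by (simp add: o_def case_prod_unfold)
  then show ?thesis
    unfolding continuous_map_in_subtopology X.topspace_groupoid
    using germ_groupoid(1)[OF _ a] X.act_neg_in_dom by auto
qed

text \<open>The isomorphism moves the range of an arrow \<open>(t, x)\<close> by
  \<open>\<phi>\<close> and replaces \<open>t\<close> by the germ at the source,
  \<open>a t (\<theta> (- t) x)\<close>. The inverse is built in the same way from
  \<open>\<psi>\<close> and \<open>b\<close>, and \<open>orbit_germ_inverse\<close> shows that the
  group components cancel.\<close>

lemma orbit_maps_imp_groupoid_iso:
  assumes freeX: "topologically_free X D \<theta>" and freeY: "topologically_free Y E \<gamma>"
    and maps: "homeomorphic_maps X Y \<phi> \<psi>" and "orbit_map X D \<theta> E \<gamma> \<phi>" "orbit_map Y E \<gamma> D \<theta> \<psi>"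
  shows "\<exists>\<kappa>. groupoid_iso X.groupoid Y.groupoid \<kappa>"
proof -
  interpret swapped: partial_action_pair Y E \<gamma> X D \<theta>
    by (rule swap_pair)
  have hm: "homeomorphic_map X Y \<phi>"
    using maps homeomorphic_map_maps by blast
  have maps': "homeomorphic_maps Y X \<psi> \<phi>"
    using maps homeomorphic_maps_sym[of X Y \<phi> \<psi>] by blast
  have inv: "\<And>x. x \<in> topspace X \<Longrightarrow> \<psi> (\<phi> x) = x" "\<And>y. y \<in> topspace Y \<Longrightarrow> \<phi> (\<psi> y) = y"
    using maps by (auto simp: homeomorphic_maps_def)
  obtain a where a: "\<And>g x. x \<in> D (- g) \<Longrightarrow> germ \<phi> g x (a g x)"
    using assms(4) unfolding orbit_map_def by metis
  obtain b where b: "\<And>h y. y \<in> E (- h) \<Longrightarrow> swapped.germ \<psi> h y (b h y)"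
    using assms(5) unfolding orbit_map_def by metis
  have a': "germ \<phi> t (\<theta> (- t) x) (a t (\<theta> (- t) x))" if "x \<in> D t" for t x
    using a X.act_neg_in_dom that by blast
  have b': "swapped.germ \<psi> t (\<gamma> (- t) y) (b t (\<gamma> (- t) y))" if "y \<in> E t" for t y
    using b Y.act_neg_in_dom that by blast
  define \<kappa> where "\<kappa> = (\<lambda>(t, x). (a t (\<theta> (- t) x), \<phi> x))"
  define \<kappa>' where "\<kappa>' = (\<lambda>(t, y). (b t (\<gamma> (- t) y), \<psi> y))"
  note a_dom = germ_groupoid[OF _ a'] and b_dom = swapped.germ_groupoid[OF _ b']
  have zero: "\<kappa> (0, x) = (0, \<phi> x)" if "x \<in> topspace X" for x
  proof -
    have "germ \<phi> 0 x (a 0 x)"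
      using that a X.dom_unit by simp
    then have "a 0 x = 0"
      using orbit_germ_unique[OF hm freeY _ orbit_germ_zero[OF hm that]] by blast
    then show ?thesis
      unfolding \<kappa>_def using X.act_unit that by simp
  qed
  have "homeomorphic_maps (fibered_topology X D) (fibered_topology Y E) \<kappa> \<kappa>'"
    unfolding homeomorphic_maps_def X.topspace_groupoid Y.topspace_groupoid
  proof (intro conjI ballI)
    show "continuous_map (fibered_topology X D) (fibered_topology Y E) \<kappa>"
      unfolding \<kappa>_def by (rule germ_groupoid_map_continuous[OF maps freeY a])
    show "continuous_map (fibered_topology Y E) (fibered_topology X D) \<kappa>'"
      unfolding \<kappa>'_def by (rule swapped.germ_groupoid_map_continuous[OF maps' freeX b])
  next
    fix c assume "c \<in> Sigma UNIV D"
    then obtain t x where c: "c = (t, x)" "x \<in> D t"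
      by auto
    let ?h = "a t (\<theta> (- t) x)"
    have "swapped.germ \<psi> ?h (\<phi> (\<theta> (- t) x)) (b ?h (\<phi> (\<theta> (- t) x)))"
      using b orbit_germD[OF a'[OF c(2)]] by blast
    then have "b ?h (\<phi> (\<theta> (- t) x)) = t"
      using orbit_germ_inverse[OF maps freeX a'[OF c(2)]] by blast
    then show "\<kappa>' (\<kappa> c) = c"
      using c a_dom[OF c(2)] inv X.dom_subset unfolding \<kappa>_def \<kappa>'_def by auto
  next
    fix c assume "c \<in> Sigma UNIV E"
    then obtain t y where c: "c = (t, y)" "y \<in> E t"
      by auto
    let ?g = "b t (\<gamma> (- t) y)"
    have "germ \<phi> ?g (\<psi> (\<gamma> (- t) y)) (a ?g (\<psi> (\<gamma> (- t) y)))"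
      using a orbit_germD[OF b'[OF c(2)]] by blast
    then have "a ?g (\<psi> (\<gamma> (- t) y)) = t"
      using swapped.orbit_germ_inverse[OF maps' freeY b'[OF c(2)]] by blast
    then show "\<kappa> (\<kappa>' c) = c"
      using c b_dom[OF c(2)] inv Y.dom_subset unfolding \<kappa>_def \<kappa>'_def by auto
  qed
  then have homeo: "homeomorphic_map (fibered_topology X D) (fibered_topology Y E) \<kappa>"
    using homeomorphic_map_maps by blast
  have "groupoid_iso X.groupoid Y.groupoid \<kappa>"
    unfolding groupoid_iso_def
  proof (intro conjI ballI)
    show "homeomorphic_map (gtop X.groupoid) (gtop Y.groupoid) \<kappa>"
      using homeo by simp
    have "\<kappa> ` ({0} \<times> topspace X) = {0} \<times> \<phi> ` topspace X"
      using zero by force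
    then show "\<kappa> ` gunits X.groupoid = gunits Y.groupoid"
      using homeomorphic_imp_surjective_map[OF hm] by simp
  next
    fix c assume "c \<in> topspace (gtop X.groupoid)"
    then obtain t x where c: "c = (t, x)" "x \<in> D t"
      using X.topspace_gtop_groupoid by auto
    then have "x \<in> topspace X" "\<theta> (- t) x \<in> topspace X"
      using X.act_neg_in_dom X.dom_subset by blast+
    then show "\<kappa> (grng X.groupoid c) = grng Y.groupoid (\<kappa> c)" "\<kappa> (gsrc X.groupoid c) = gsrc Y.groupoid (\<kappa> c)"
      using c zero a_dom[OF c(2)] by (simp_all add: \<kappa>_def)
  next
    fix p assume p: "p \<in> gcomposable X.groupoid"
    obtain s y t x where p_eq: "p = ((s, y), (t, x))"
      by (metis surj_pair)
    then have sy: "y \<in> D s" "x \<in> D t" "\<theta> (- s) y = x"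
      using p X.groupoid_composable by auto
    have w: "\<theta> (- t) x = \<theta> (- (s + t)) y" "y \<in> D (s + t)"
      using X.groupoid_mult_dom sy by auto
    \<comment> \<open>The sum of the germs of both factors is a germ for the product arrow, hence
      equals the chosen one by uniqueness.\<close>
    have "germ \<phi> (s + t) (\<theta> (- t) x) (a s x + a t (\<theta> (- t) x))"
      using orbit_germ_add[OF X.act_neg_in_dom[OF sy(2)] a'[OF sy(2)], of s "a s x"] a'[OF sy(1)]
      by (simp add: X.act_act_neg sy)
    then have "a (s + t) (\<theta> (- (s + t)) y) = a s x + a t (\<theta> (- t) x)"
      using orbit_germ_unique[OF hm freeY a'[OF w(2)]] w(1) by simp
    then show "case p of (c, d) \<Rightarrow> \<kappa> (gmul X.groupoid c d) = gmul Y.groupoid (\<kappa> c) (\<kappa> d)"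
      using p_eq sy by (simp add: \<kappa>_def)
  qed
  then show ?thesis
    by blast
qed

text \<open>Units are the points of the spaces, so an isomorphism restricts to a map
  \<open>\<phi>\<close> of points. Since ranges and sources are preserved, the range of the image of
  \<open>(t, x)\<close> has to be \<open>\<phi> x\<close> and its source
  \<open>\<phi> (\<theta> (- t) x)\<close>.\<close>

lemma groupoid_iso_form:
  assumes iso: "groupoid_iso X.groupoid Y.groupoid \<kappa>"
  defines "\<phi> \<equiv> \<lambda>x. snd (\<kappa> (0, x))"
  shows "continuous_map X Y \<phi>" "x \<in> topspace X \<Longrightarrow> \<kappa> (0, x) = (0, \<phi> x)"
    "x \<in> D t \<Longrightarrow> \<kappa> (t, x) = (fst (\<kappa> (t, x)), \<phi> x)"
    "x \<in> D t \<Longrightarrow> \<phi> x \<in> E (fst (\<kappa> (t, x)))"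
    "x \<in> D t \<Longrightarrow> \<gamma> (- fst (\<kappa> (t, x))) (\<phi> x) = \<phi> (\<theta> (- t) x)"
proof -
  have cont: "continuous_map (fibered_topology X D) (fibered_topology Y E) \<kappa>"
    using iso homeomorphic_imp_continuous_map unfolding groupoid_iso_def by force
  have "continuous_map X (fibered_topology X D) (\<lambda>x. (0, x))"
    by (auto simp: continuous_map_in_subtopology continuous_map_pairwise o_def X.dom_unit)
  then have "continuous_map X (prod_topology (discrete_topology UNIV) Y) (\<kappa> \<circ> (\<lambda>x. (0, x)))"
    using cont continuous_map_compose continuous_map_in_subtopology by blast
  then have "continuous_map X Y (snd \<circ> (\<kappa> \<circ> (\<lambda>x. (0, x))))"
    using continuous_map_compose[OF _ continuous_map_snd] by blast
  then show "continuous_map X Y \<phi>"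
    unfolding \<phi>_def by (simp add: o_def)
  have zero: "\<kappa> (0, x) = (0, \<phi> x)" if "x \<in> topspace X" for x
  proof -
    have "\<kappa> (0, x) \<in> {0} \<times> topspace Y"
      using iso that unfolding groupoid_iso_def by auto
    then show ?thesis
      unfolding \<phi>_def by auto
  qed
  then show "x \<in> topspace X \<Longrightarrow> \<kappa> (0, x) = (0, \<phi> x)" .
  assume x: "x \<in> D t"
  obtain h y where hy: "\<kappa> (t, x) = (h, y)"
    by fastforce
  have t: "(t, x) \<in> topspace (fibered_topology X D)"
    using x by (simp only: X.topspace_groupoid) simp
  have "\<kappa> (t, x) \<in> topspace (fibered_topology Y E)"
    using cont t unfolding continuous_map_def by blast
  then have "y \<in> E h"
    unfolding Y.topspace_groupoid hy by blast
  moreover have "\<kappa> (0, x) = (0, y)" "\<kappa> (0, \<theta> (- t) x) = (0, \<gamma> (- h) y)"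
  proof -
    have "\<forall>c \<in> Sigma UNIV D. \<kappa> (grng X.groupoid c) = grng Y.groupoid (\<kappa> c) \<and>
        \<kappa> (gsrc X.groupoid c) = gsrc Y.groupoid (\<kappa> c)"
      using iso unfolding groupoid_iso_def X.topspace_gtop_groupoid by blast
    from bspec[OF this, of "(t, x)"] show "\<kappa> (0, x) = (0, y)" "\<kappa> (0, \<theta> (- t) x) = (0, \<gamma> (- h) y)"
      using x hy by auto
  qed
  moreover have "x \<in> topspace X" "\<theta> (- t) x \<in> topspace X"
    using x X.act_neg_in_dom X.dom_subset by blast+
  ultimately show "\<kappa> (t, x) = (fst (\<kappa> (t, x)), \<phi> x)" "\<phi> x \<in> E (fst (\<kappa> (t, x)))"
      "\<gamma> (- fst (\<kappa> (t, x))) (\<phi> x) = \<phi> (\<theta> (- t) x)"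
    using zero hy by auto
qed

text \<open>The arrow from \<open>x\<close> to \<open>\<theta> g x\<close> with group element
  \<open>g\<close> is \<open>(g, \<theta> g x)\<close>, as arrows are recorded by their range. The
  cocycle is the group component of its image, which is continuous because \<open>\<kappa>\<close>
  is.\<close>

lemma groupoid_iso_cocycle:
  assumes iso: "groupoid_iso X.groupoid Y.groupoid \<kappa>"
  defines "\<phi> \<equiv> \<lambda>x. snd (\<kappa> (0, x))" and "a \<equiv> \<lambda>(g, x). fst (\<kappa> (g, \<theta> g x))"
  shows "continuous_map (action_space X D) (discrete_topology UNIV) a"
    "\<forall>g. \<forall>x \<in> D (- g). \<phi> x \<in> E (- a (g, x)) \<and> \<phi> (\<theta> g x) = \<gamma> (a (g, x)) (\<phi> x)"
proof -
  have cont: "continuous_map (fibered_topology X D) (fibered_topology Y E) \<kappa>"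
    using iso homeomorphic_imp_continuous_map unfolding groupoid_iso_def by force
  have "continuous_map (fibered_topology X D) (discrete_topology UNIV) (fst \<circ> \<kappa>)"
    using continuous_map_compose[OF _ continuous_map_fst] cont continuous_map_in_subtopology by blast
  then have k: "\<forall>g. \<forall>x\<in>D g. \<exists>P. openin X P \<and> x \<in> P \<and> P \<subseteq> D g \<and> (\<forall>z\<in>P. fst (\<kappa> (g, z)) = fst (\<kappa> (g, x)))"
    using continuous_map_fibered_discrete_iff[where D = D and f = "fst \<circ> \<kappa>", OF X.open_dom] by simp
  show "continuous_map (action_space X D) (discrete_topology UNIV) a"
    unfolding action_space_def continuous_map_fibered_discrete_iff[where D = "\<lambda>g. D (- g)", OF X.open_dom]
  proof (intro allI ballI)
    fix g x assume x: "x \<in> D (- g)"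
    from k[THEN spec, THEN bspec, OF X.act_in_dom[OF x]]
    obtain P where P: "openin X P" "\<theta> g x \<in> P" "P \<subseteq> D g" "\<forall>z\<in>P. fst (\<kappa> (g, z)) = fst (\<kappa> (g, \<theta> g x))"
      by (elim exE conjE) (rule that)
    show "\<exists>P. openin X P \<and> x \<in> P \<and> P \<subseteq> D (- g) \<and> (\<forall>z\<in>P. a (g, z) = a (g, x))"
    proof (intro exI[of _ "{z \<in> D (- g). \<theta> g z \<in> P}"] conjI ballI)
      fix z assume "z \<in> {z \<in> D (- g). \<theta> g z \<in> P}"
      then show "a (g, z) = a (g, x)"
        unfolding a_def prod.case using P(4) by blast
    qed (use X.act_preimage_openin[OF P(1)] x P(2) in auto)
  qed
  show "\<forall>g. \<forall>x \<in> D (- g). \<phi> x \<in> E (- a (g, x)) \<and> \<phi> (\<theta> g x) = \<gamma> (a (g, x)) (\<phi> x)"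
  proof (intro allI ballI)
    fix g x assume x: "x \<in> D (- g)"
    let ?h = "fst (\<kappa> (g, \<theta> g x))"
    have "\<phi> (\<theta> g x) \<in> E ?h" "\<gamma> (- ?h) (\<phi> (\<theta> g x)) = \<phi> x"
      using groupoid_iso_form(4,5)[OF iso X.act_in_dom[OF x]] X.act_neg_act[OF x] unfolding \<phi>_def by auto
    then show "\<phi> x \<in> E (- a (g, x)) \<and> \<phi> (\<theta> g x) = \<gamma> (a (g, x)) (\<phi> x)"
      using Y.act_neg_in_dom Y.act_act_neg unfolding a_def by force
  qed
qed

lemma groupoid_iso_homeo:
  assumes iso: "groupoid_iso X.groupoid Y.groupoid \<kappa>" "groupoid_iso Y.groupoid X.groupoid \<kappa>'"
    and maps: "homeomorphic_maps (gtop X.groupoid) (gtop Y.groupoid) \<kappa> \<kappa>'"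
  shows "homeomorphic_maps X Y (\<lambda>x. snd (\<kappa> (0, x))) (\<lambda>y. snd (\<kappa>' (0, y)))"
proof -
  interpret swapped: partial_action_pair Y E \<gamma> X D \<theta>
    by (rule swap_pair)
  note 1 = groupoid_iso_form(1,2)[OF iso(1)] and 2 = swapped.groupoid_iso_form(1,2)[OF iso(2)]
  have inv: "\<And>c. c \<in> Sigma UNIV D \<Longrightarrow> \<kappa>' (\<kappa> c) = c" "\<And>c. c \<in> Sigma UNIV E \<Longrightarrow> \<kappa> (\<kappa>' c) = c"
    using maps unfolding homeomorphic_maps_def X.topspace_gtop_groupoid Y.topspace_gtop_groupoid by metis+
  show ?thesis
    unfolding homeomorphic_maps_def
  proof (intro conjI ballI)
    fix x assume x: "x \<in> topspace X"
    have "\<kappa>' (\<kappa> (0, x)) = (0, x)"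
      using inv(1)[of "(0, x)"] x X.dom_unit by simp
    then show "snd (\<kappa>' (0, snd (\<kappa> (0, x)))) = x"
      using 1(2)[OF x] by (metis snd_conv)
  next
    fix y assume y: "y \<in> topspace Y"
    have "\<kappa> (\<kappa>' (0, y)) = (0, y)"
      using inv(2)[of "(0, y)"] y Y.dom_unit by simp
    then show "snd (\<kappa> (0, snd (\<kappa>' (0, y)))) = y"
      using 2(2)[OF y] by (metis snd_conv)
  qed (use 1 2 in auto)
qed

text \<open>The cocycles are read off from \<open>\<kappa>\<close> and its inverse rather than
  chosen among germs, so the argument covers all partial actions, as the last clause of the theorem
  demands.\<close>

lemma groupoid_iso_imp_orbit_equivalent:
  assumes iso: "groupoid_iso X.groupoid Y.groupoid \<kappa>"
  shows "continuously_orbit_equivalent X D \<theta> Y E \<gamma>"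
proof -
  interpret swapped: partial_action_pair Y E \<gamma> X D \<theta>
    by (rule swap_pair)
  obtain \<kappa>' where k: "homeomorphic_maps (gtop X.groupoid) (gtop Y.groupoid) \<kappa> \<kappa>'"
      "groupoid_iso Y.groupoid X.groupoid \<kappa>'"
    using groupoid_iso_inverse[OF iso X.groupoid_is_closed] by metis
  show ?thesis
    unfolding continuously_orbit_equivalent_def
    by (intro exI conjI) (rule groupoid_iso_homeo[OF iso k(2,1)] groupoid_iso_cocycle[OF iso]
        swapped.groupoid_iso_cocycle[OF k(2)])+
qed

end

section \<open>Crossed products\<close>

lemma crossed_product_simps [simp]:
  "acarrier (crossed_product C D \<theta>) = {F. finite (fsupp F) \<and> (\<forall>g. F g \<in> C \<and> (\<forall>x. x \<notin> D g \<longrightarrow> F g x = 0))}"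
  "aadd (crossed_product C D \<theta>) = (\<lambda>F F' g x. F g x + F' g x)"
  "amult (crossed_product C D \<theta>) = cp_mult D \<theta>"
  "asmult (crossed_product C D \<theta>) = (\<lambda>r F g x. r * F g x)"
  by (simp_all add: crossed_product_def)

lemma not_in_fsupp: "g \<notin> fsupp F \<Longrightarrow> F g x = 0"
  by (simp add: fsupp_def fun_eq_iff)

lemma in_fsupp: "F g x \<noteq> 0 \<Longrightarrow> g \<in> fsupp F"
  by (auto simp: fsupp_def fun_eq_iff)

lemma fsupp_monomial: "fsupp (monomial g f) \<subseteq> {g}"
  unfolding fsupp_def monomial_def by auto

context partial_action
begin

text \<open>At \<open>x\<close> the twisted product of the coefficients at \<open>g\<close> and
  \<open>h\<close> is \<open>F g x * F' h (\<theta> (- g) x)\<close>; off \<open>D g\<close> both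
  sides are 0. The sum may run over any finite \<open>S\<close> that contains the support, so that
  several products can be compared termwise over one index set.\<close>

lemma cp_mult_apply_on:
  fixes F F' :: "'g \<Rightarrow> 'x \<Rightarrow> 'k::comm_ring_1"
  assumes "finite S" "fsupp F \<subseteq> S" and fin: "finite (fsupp F')"
    and F: "\<And>g x. x \<notin> D g \<Longrightarrow> F g x = 0"
  shows "cp_mult D \<theta> F F' k x = (\<Sum>g\<in>S. F g x * F' (- g + k) (\<theta> (- g) x))"
proof -
  have "(\<Sum>h \<in> {h \<in> fsupp F'. g + h = k}. pull D \<theta> g (\<lambda>y. pull D \<theta> (- g) (F g) y * F' h y) x)
      = F g x * F' (- g + k) (\<theta> (- g) x)" for g
  proof -
    have "pull D \<theta> g (\<lambda>y. pull D \<theta> (- g) (F g) y * F' h y) x = F g x * F' h (\<theta> (- g) x)" for h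
      using F act_neg_in_dom act_act_neg by (auto simp: pull_def)
    moreover have "g + h = k \<longleftrightarrow> h = - g + k" for h
      by (metis add.assoc add.left_neutral left_minus right_minus)
    moreover have "{h \<in> fsupp F'. h = - g + k} = (if - g + k \<in> fsupp F' then {- g + k} else {})"
      by auto
    ultimately show ?thesis
      using not_in_fsupp[of "- g + k" F'] by simp
  qed
  then have "cp_mult D \<theta> F F' k x = (\<Sum>g\<in>fsupp F. F g x * F' (- g + k) (\<theta> (- g) x))"
    by (simp add: cp_mult_def)
  also have "\<dots> = (\<Sum>g\<in>S. F g x * F' (- g + k) (\<theta> (- g) x))"
    using assms by (intro sum.mono_neutral_left) (auto simp: not_in_fsupp)
  finally show ?thesis .
qed

lemma cp_mult_vanishes:
  fixes F F' :: "'g \<Rightarrow> 'x \<Rightarrow> 'k::comm_ring_1"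
  assumes "F \<in> acarrier (crossed_product C D \<theta>)" "F' \<in> acarrier (crossed_product C D \<theta>)" "x \<notin> D k"
  shows "cp_mult D \<theta> F F' k x = 0"
proof -
  have "F g x * F' (- g + k) (\<theta> (- g) x) = 0" for g
  proof (cases "x \<in> D g \<and> \<theta> (- g) x \<in> D (- g + k)")
    case True
    then have "x \<in> D (g + (- g + k))"
      using groupoid_mult_dom by blast
    then show ?thesis
      using assms(3) by (simp add: add.assoc[symmetric])
  qed (use assms in auto)
  moreover have "cp_mult D \<theta> F F' k x = (\<Sum>g\<in>fsupp F. F g x * F' (- g + k) (\<theta> (- g) x))"
    using assms by (intro cp_mult_apply_on) auto
  ultimately show ?thesis
    by simp
qed

lemma cp_mult_finite_fsupp:
  assumes "F \<in> acarrier (crossed_product C D \<theta>)" "F' \<in> acarrier (crossed_product C D \<theta>)"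
  shows "finite (fsupp (cp_mult D \<theta> F F'))"
proof (rule finite_subset)
  show "fsupp (cp_mult D \<theta> F F') \<subseteq> (\<lambda>(g, h). g + h) ` (fsupp F \<times> fsupp F')"
  proof
    fix k assume "k \<in> fsupp (cp_mult D \<theta> F F')"
    then obtain x where "cp_mult D \<theta> F F' k x \<noteq> 0"
      by (auto simp: fsupp_def fun_eq_iff)
    then obtain g where "g \<in> fsupp F"
        "(\<Sum>h \<in> {h \<in> fsupp F'. g + h = k}. pull D \<theta> g (\<lambda>y. pull D \<theta> (- g) (F g) y * F' h y) x) \<noteq> 0"
      unfolding cp_mult_def by (metis (no_types, lifting) sum.neutral)
    then have "{h \<in> fsupp F'. g + h = k} \<noteq> {}"
      by (intro notI) simp
    then obtain h where "h \<in> fsupp F'" "g + h = k"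
      by blast
    then show "k \<in> (\<lambda>(g, h). g + h) ` (fsupp F \<times> fsupp F')"
      using \<open>g \<in> fsupp F\<close> by force
  qed
  show "finite ((\<lambda>(g, h). g + h) ` (fsupp F \<times> fsupp F'))"
    using assms by simp
qed

end

text \<open>Common ground of the locally constant and the continuous coefficients. The last axiom is
  closure under the twisted product; its hypothesis on \<open>f\<close> makes the arbitrary values
  of \<open>\<theta> (- g)\<close> outside \<open>D g\<close> harmless.\<close>

locale coefficient_functions = partial_action X D \<theta>
  for X :: "'x topology" and D :: "'g::group_add \<Rightarrow> 'x set" and \<theta> :: "'g \<Rightarrow> 'x \<Rightarrow> 'x" +
  fixes C :: "('x \<Rightarrow> 'k::comm_ring_1) set"
  assumes zero_coeff: "(\<lambda>_. 0) \<in> C"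
    and add_coeff: "f \<in> C \<Longrightarrow> f' \<in> C \<Longrightarrow> (\<lambda>x. f x + f' x) \<in> C"
    and smult_coeff: "f \<in> C \<Longrightarrow> (\<lambda>x. r * f x) \<in> C"
    and mult_coeff: "f \<in> C \<Longrightarrow> f' \<in> C \<Longrightarrow> (\<And>x. x \<notin> D g \<Longrightarrow> f x = 0) \<Longrightarrow> (\<lambda>x. f x * f' (\<theta> (- g) x)) \<in> C"
begin

abbreviation A where "A \<equiv> crossed_product C D \<theta>"

lemma sum_coeff: "finite S \<Longrightarrow> (\<And>i. i \<in> S \<Longrightarrow> f i \<in> C) \<Longrightarrow> (\<lambda>x. \<Sum>i\<in>S. f i x) \<in> C"
  by (induction S rule: finite_induct) (auto intro: zero_coeff add_coeff)

lemma add_closed: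
  assumes "F \<in> acarrier A" "F' \<in> acarrier A"
  shows "aadd A F F' \<in> acarrier A"
proof -
  have "fsupp (\<lambda>g x. F g x + F' g x) \<subseteq> fsupp F \<union> fsupp F'"
    by (auto simp: fsupp_def)
  from finite_subset[OF this] show ?thesis
    using assms by (simp add: add_coeff)
qed

lemma smult_closed:
  assumes "F \<in> acarrier A"
  shows "asmult A r F \<in> acarrier A"
proof -
  have "fsupp (\<lambda>g x. r * F g x) \<subseteq> fsupp F"
    by (auto simp: fsupp_def)
  from finite_subset[OF this] show ?thesis
    using assms by (simp add: smult_coeff)
qed

lemma mult_closed:
  assumes "F \<in> acarrier A" "F' \<in> acarrier A"
  shows "cp_mult D \<theta> F F' \<in> acarrier A"
proof -
  have "cp_mult D \<theta> F F' k \<in> C" for k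
  proof -
    have "cp_mult D \<theta> F F' k = (\<lambda>x. \<Sum>g\<in>fsupp F. F g x * F' (- g + k) (\<theta> (- g) x))"
      using assms by (intro ext cp_mult_apply_on) auto
    then show ?thesis
      using assms by (auto intro!: sum_coeff mult_coeff)
  qed
  then show ?thesis
    using cp_mult_finite_fsupp[OF assms] cp_mult_vanishes[OF assms] by simp
qed

lemma monomial_closed:
  assumes "f \<in> C" "\<And>x. x \<notin> D g \<Longrightarrow> f x = 0"
  shows "monomial g f \<in> acarrier A"
proof -
  have "finite (fsupp (monomial g f))"
    by (rule finite_subset[OF fsupp_monomial]) simp
  then show ?thesis
    using assms zero_coeff by (simp add: monomial_def)
qed

end

section \<open>Locally constant functions with compact support\<close>

lemma Lc_iff:
  "f \<in> Lc X \<longleftrightarrow> (\<forall>x. x \<notin> topspace X \<longrightarrow> f x = 0) \<and> continuous_map X (discrete_topology UNIV) f \<and>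
     compactin X {x \<in> topspace X. f x \<noteq> 0}"
  unfolding Lc_def continuous_map_discrete_iff by blast

lemma Lc_near: "f \<in> Lc X \<Longrightarrow> x \<in> topspace X \<Longrightarrow> \<exists>P. openin X P \<and> x \<in> P \<and> (\<forall>z\<in>P. f z = f x)"
  unfolding Lc_def by (elim CollectE conjE bspec)

text \<open>The set where a locally constant function is nonzero is closed, so it is compact as soon
  as it lies inside the compact one of \<open>f\<close>.\<close>

lemma Lc_dominated:
  assumes f: "f \<in> Lc X" and "continuous_map X (discrete_topology UNIV) h"
    and le: "\<And>x. h x \<noteq> 0 \<Longrightarrow> f x \<noteq> 0"
  shows "h \<in> Lc X"
proof -
  have "closedin X {x \<in> topspace X. h x \<in> - {0}}"
    by (rule closedin_continuous_map_preimage[OF assms(2)]) auto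
  then have "compactin X {x \<in> topspace X. h x \<noteq> 0}"
    using f le unfolding Lc_iff by (auto intro: closed_compactin[of X "{x \<in> topspace X. f x \<noteq> 0}"])
  then show ?thesis
    using assms unfolding Lc_iff by blast
qed

lemma Lc_add:
  assumes f: "f \<in> Lc X" "f' \<in> Lc X"
  shows "(\<lambda>x. f x + f' x :: 'r::comm_ring_1) \<in> Lc X"
proof -
  have "continuous_map X (prod_topology (discrete_topology UNIV) (discrete_topology UNIV)) (\<lambda>x. (f x, f' x))"
    using assms by (simp add: Lc_iff continuous_map_pairwise o_def)
  moreover have "continuous_map (prod_topology (discrete_topology UNIV) (discrete_topology UNIV))
      (discrete_topology UNIV) (\<lambda>(a, b). a + b :: 'r)"
    by (simp add: prod_topology_discrete_topology[symmetric])
  ultimately have c: "continuous_map X (discrete_topology UNIV) (\<lambda>x. f x + f' x)"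
    by (drule_tac continuous_map_compose) (auto simp: o_def)
  have "closedin X {x \<in> topspace X. f x + f' x \<in> - {0}}"
    by (rule closedin_continuous_map_preimage[OF c]) auto
  moreover have "compactin X ({x \<in> topspace X. f x \<noteq> 0} \<union> {x \<in> topspace X. f' x \<noteq> 0})"
    using f by (intro compactin_Un) (auto simp: Lc_iff)
  ultimately have "compactin X {x \<in> topspace X. f x + f' x \<noteq> 0}"
    by (rule_tac closed_compactin) auto
  then show ?thesis
    using c f unfolding Lc_iff by auto
qed

lemma indicator_in_Lc:
  assumes "stone_space X" "compact_open X U"
  shows "(\<lambda>x. if x \<in> U then 1 else 0 :: 'r::zero_neq_one) \<in> Lc X"
proof -
  have sub: "U \<subseteq> topspace X" and "openin X (topspace X - U)" and "openin X U"
    using assms stone_space.compact_open_closedin stone_space.compact_open_subset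
    by (auto simp: compact_open_def closedin_def)
  then have "\<exists>P. openin X P \<and> x \<in> P \<and> (\<forall>z\<in>P. (if z \<in> U then 1 else 0 :: 'r) = (if x \<in> U then 1 else 0))"
    if "x \<in> topspace X" for x
    using that by (cases "x \<in> U") (auto intro: exI[of _ U] exI[of _ "topspace X - U"])
  moreover have "{x \<in> topspace X. (if x \<in> U then 1 else 0 :: 'r) \<noteq> 0} = U"
    using sub by auto
  ultimately show ?thesis
    using assms sub unfolding Lc_def compact_open_def by auto
qed

context partial_action
begin

text \<open>The twisted product needs an argument: inside the open set \<open>D g\<close> it is
  locally constant as a composite, and outside \<open>D g\<close> the complement is an open
  neighbourhood on which it vanishes, because \<open>D g\<close> is closed.\<close>

lemma Lc_coefficient_functions:
  assumes clopen: "\<And>g. closedin X (D g)"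
  shows "coefficient_functions X D \<theta> (Lc X :: ('x \<Rightarrow> 'r::comm_ring_1) set)"
proof
  show "(\<lambda>_. 0) \<in> (Lc X :: ('x \<Rightarrow> 'r) set)"
    by (simp add: Lc_iff)
next
  fix f f' :: "'x \<Rightarrow> 'r" assume "f \<in> Lc X" "f' \<in> Lc X"
  then show "(\<lambda>x. f x + f' x) \<in> Lc X"
    by (rule Lc_add)
next
  fix f :: "'x \<Rightarrow> 'r" and r assume f: "f \<in> Lc X"
  then have "continuous_map X (discrete_topology UNIV) ((*) r \<circ> f)"
    by (intro continuous_map_compose[where X' = "discrete_topology UNIV"]) (auto simp: Lc_iff)
  then show "(\<lambda>x. r * f x) \<in> Lc X"
    by (intro Lc_dominated[OF f]) (auto simp: o_def)
next
  fix f f' :: "'x \<Rightarrow> 'r" and g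
  assume f: "f \<in> Lc X" and f': "f' \<in> Lc X" and van: "\<And>x. x \<notin> D g \<Longrightarrow> f x = 0"
  have "continuous_map X (discrete_topology UNIV) (\<lambda>x. f x * f' (\<theta> (- g) x))"
    unfolding continuous_map_discrete_iff
  proof
    fix x assume x: "x \<in> topspace X"
    show "\<exists>P. openin X P \<and> x \<in> P \<and> (\<forall>z\<in>P. f z * f' (\<theta> (- g) z) = f x * f' (\<theta> (- g) x))"
    proof (cases "x \<in> D g")
      case True
      obtain P where P: "openin X P" "x \<in> P" "\<forall>z\<in>P. f z = f x"
        using Lc_near[OF f x] by (elim exE conjE) (rule that)
      have "\<theta> (- g) x \<in> topspace X"
        using act_neg_in_dom[OF True] dom_subset by blast
      from Lc_near[OF f' this] obtain Q where Q: "openin X Q" "\<theta> (- g) x \<in> Q" "\<forall>z\<in>Q. f' z = f' (\<theta> (- g) x)"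
        by (elim exE conjE) (rule that)
      have "f z * f' (\<theta> (- g) z) = f x * f' (\<theta> (- g) x)" if "z \<in> P \<inter> {z \<in> D g. \<theta> (- g) z \<in> Q}" for z
        using that P(3) Q(3) by (metis (no_types, lifting) IntE mem_Collect_eq)
      moreover have "openin X (P \<inter> {z \<in> D g. \<theta> (- g) z \<in> Q})"
        using act_preimage_openin[OF Q(1), of "- g"] P by auto
      ultimately show ?thesis
        using P Q True by (intro exI[of _ "P \<inter> {z \<in> D g. \<theta> (- g) z \<in> Q}"]) blast
    next
      case False
      then show ?thesis
        using x van clopen[of g] by (intro exI[of _ "topspace X - D g"]) (auto simp: closedin_def)
    qed
  qed
  then show "(\<lambda>x. f x * f' (\<theta> (- g) x)) \<in> Lc X"
    by (rule Lc_dominated[OF f]) auto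
qed

end

section \<open>Steinberg algebras\<close>

lemma alg_iso_compose:
  assumes "alg_iso A B \<Phi>" "alg_iso B C \<Psi>"
  shows "alg_iso A C (\<Psi> \<circ> \<Phi>)"
proof -
  have "\<Phi> u \<in> acarrier B" if "u \<in> acarrier A" for u
    using assms(1) that unfolding alg_iso_def by (blast intro: bij_betw_apply)
  then show ?thesis
    using assms bij_betw_trans[of \<Phi> "acarrier A" "acarrier B" \<Psi> "acarrier C"]
    unfolding alg_iso_def by simp
qed

text \<open>The record \<open>alg\<close> carries no axioms; the inverse of an isomorphism respects
  the operations once their results are known to stay in the carrier.\<close>

definition alg_closed :: "('k, 'a, 'm) alg_scheme \<Rightarrow> bool" where
  "alg_closed A \<longleftrightarrow> (\<forall>u \<in> acarrier A. \<forall>v \<in> acarrier A. aadd A u v \<in> acarrier A \<and> amult A u v \<in> acarrier A) \<and>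
     (\<forall>r. \<forall>u \<in> acarrier A. asmult A r u \<in> acarrier A)"

lemma alg_iso_inverse:
  assumes iso: "alg_iso A B \<Phi>" and "alg_closed A"
  shows "alg_iso B A (the_inv_into (acarrier A) \<Phi>)"
proof -
  let ?\<Psi> = "the_inv_into (acarrier A) \<Phi>"
  have bij: "bij_betw \<Phi> (acarrier A) (acarrier B)"
    using iso by (simp add: alg_iso_def)
  have inv: "?\<Psi> (\<Phi> u) = u" if "u \<in> acarrier A" for u
    using bij that by (simp add: bij_betw_def the_inv_into_f_f)
  have surj: "\<exists>u \<in> acarrier A. v = \<Phi> u" if "v \<in> acarrier B" for v
    using bij that by (auto simp: bij_betw_def)
  show ?thesis
    unfolding alg_iso_def
  proof (intro conjI ballI allI)
    show "bij_betw ?\<Psi> (acarrier B) (acarrier A)"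
      by (rule bij_betw_the_inv_into[OF bij])
  next
    fix u v assume "u \<in> acarrier B" "v \<in> acarrier B"
    then obtain u' v' where uv: "u' \<in> acarrier A" "v' \<in> acarrier A" "u = \<Phi> u'" "v = \<Phi> v'"
      using surj by meson
    then have "aadd B u v = \<Phi> (aadd A u' v')" "amult B u v = \<Phi> (amult A u' v')"
        "aadd A u' v' \<in> acarrier A" "amult A u' v' \<in> acarrier A"
      using iso assms(2) unfolding alg_iso_def alg_closed_def by auto
    then show "?\<Psi> (aadd B u v) = aadd A (?\<Psi> u) (?\<Psi> v)" "?\<Psi> (amult B u v) = amult A (?\<Psi> u) (?\<Psi> v)"
      using uv inv by simp_all
  next
    fix r u assume "u \<in> acarrier B"
    then obtain u' where u: "u' \<in> acarrier A" "u = \<Phi> u'"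
      using surj by meson
    then have "asmult B r u = \<Phi> (asmult A r u')" "asmult A r u' \<in> acarrier A"
      using iso assms(2) unfolding alg_iso_def alg_closed_def by auto
    then show "?\<Psi> (asmult B r u) = asmult A r (?\<Psi> u)"
      using u inv by simp
  qed
qed

section \<open>Transport of functions along homeomorphisms and of convolutions along groupoid
  isomorphisms\<close>

definition transport_fun :: "'y topology \<Rightarrow> ('y \<Rightarrow> 'x) \<Rightarrow> ('x \<Rightarrow> 'k::zero) \<Rightarrow> 'y \<Rightarrow> 'k" where
  "transport_fun Y \<psi> f = (\<lambda>y. if y \<in> topspace Y then f (\<psi> y) else 0)"

lemma transport_fun_inverse:
  assumes "homeomorphic_maps X Y \<phi> \<psi>" "\<And>x. x \<notin> topspace X \<Longrightarrow> f x = 0"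
  shows "transport_fun X \<phi> (transport_fun Y \<psi> f) = f"
  using assms unfolding homeomorphic_maps_def continuous_map_def transport_fun_def fun_eq_iff by auto

lemma transport_fun_continuous:
  assumes "homeomorphic_maps X Y \<phi> \<psi>" "continuous_map X Z f"
  shows "continuous_map Y Z (transport_fun Y \<psi> f)"
proof -
  have "continuous_map Y Z (f \<circ> \<psi>)"
    using assms continuous_map_compose unfolding homeomorphic_maps_def by blast
  then show ?thesis
    by (rule continuous_map_eq) (simp add: transport_fun_def)
qed

text \<open>One statement for two compactness conditions: \<open>P\<close> is taken as being nonzero
  for \<open>Lc\<close>, and as having modulus at least \<open>\<epsilon>\<close> for
  \<open>C0\<close>.\<close>

lemma transport_fun_level:
  assumes "homeomorphic_maps X Y \<phi> \<psi>" "compactin X {x \<in> topspace X. P (f x)}"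
  shows "compactin Y {y \<in> topspace Y. P (transport_fun Y \<psi> f y)}"
proof -
  have "\<phi> ` {x \<in> topspace X. P (f x)} = {y \<in> topspace Y. P (transport_fun Y \<psi> f y)}"
  proof (intro equalityI subsetI)
    fix y assume "y \<in> {y \<in> topspace Y. P (transport_fun Y \<psi> f y)}"
    then have "\<psi> y \<in> {x \<in> topspace X. P (f x)}" "\<phi> (\<psi> y) = y"
      using assms(1) unfolding homeomorphic_maps_def continuous_map_def transport_fun_def by auto
    then show "y \<in> \<phi> ` {x \<in> topspace X. P (f x)}"
      by (metis imageI)
  qed (use assms(1) in \<open>auto simp: homeomorphic_maps_def continuous_map_def transport_fun_def\<close>)
  then show ?thesis
    using assms image_compactin unfolding homeomorphic_maps_def by metis
qed

lemma transport_fun_Lc: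
  assumes "homeomorphic_maps X Y \<phi> \<psi>" "f \<in> Lc X"
  shows "transport_fun Y \<psi> f \<in> Lc Y"
  using assms transport_fun_continuous[OF assms(1), of "discrete_topology UNIV" f]
    transport_fun_level[OF assms(1), of "\<lambda>a. a \<noteq> 0" f]
  unfolding Lc_iff by (auto simp: transport_fun_def)

lemma groupoid_iso_composable:
  assumes iso: "groupoid_iso \<G> \<H> \<kappa>" and cd: "(c, d) \<in> gcomposable \<G>"
  shows "(\<kappa> c, \<kappa> d) \<in> gcomposable \<H>" "gmul \<H> (\<kappa> c) (\<kappa> d) = \<kappa> (gmul \<G> c d)"
proof -
  have top: "c \<in> topspace (gtop \<G>)" "d \<in> topspace (gtop \<G>)" "gsrc \<G> c = grng \<G> d"
    using cd by (simp_all add: gcomposable_def)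
  have "\<kappa> c \<in> topspace (gtop \<H>)" "\<kappa> d \<in> topspace (gtop \<H>)"
    using iso top homeomorphic_imp_surjective_map unfolding groupoid_iso_def by blast+
  moreover have "gsrc \<H> (\<kappa> c) = grng \<H> (\<kappa> d)"
    using iso top unfolding groupoid_iso_def by metis
  ultimately show "(\<kappa> c, \<kappa> d) \<in> gcomposable \<H>"
    by (simp add: gcomposable_def)
  have "\<forall>p \<in> gcomposable \<G>. case p of (c, d) \<Rightarrow> \<kappa> (gmul \<G> c d) = gmul \<H> (\<kappa> c) (\<kappa> d)"
    using iso unfolding groupoid_iso_def by blast
  from bspec[OF this cd] show "gmul \<H> (\<kappa> c) (\<kappa> d) = \<kappa> (gmul \<G> c d)"
    by simp
qed

text \<open>An isomorphism matches the factorizations of \<open>\<kappa>' b\<close> with those of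
  \<open>b\<close>, nonzero terms with nonzero terms, so one sum is a reindexing of the other. If
  \<open>b\<close> is not in the groupoid, closure under products leaves no factorizations and both
  sides are 0.\<close>

lemma transport_fun_convolution:
  assumes iso: "groupoid_iso \<G> \<H> \<kappa>" "groupoid_iso \<H> \<G> \<kappa>'"
    and closed: "groupoid_closed \<H>"
    and maps: "homeomorphic_maps (gtop \<G>) (gtop \<H>) \<kappa> \<kappa>'"
  shows "transport_fun (gtop \<H>) \<kappa>' (convolution \<G> f f') =
    convolution \<H> (transport_fun (gtop \<H>) \<kappa>' f) (transport_fun (gtop \<H>) \<kappa>' f')"
proof
  fix b
  let ?T = "transport_fun (gtop \<H>) \<kappa>'"
  have inv: "\<And>c. c \<in> topspace (gtop \<G>) \<Longrightarrow> \<kappa>' (\<kappa> c) = c \<and> \<kappa> c \<in> topspace (gtop \<H>)"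
    "\<And>c. c \<in> topspace (gtop \<H>) \<Longrightarrow> \<kappa> (\<kappa>' c) = c \<and> \<kappa>' c \<in> topspace (gtop \<G>)"
    using maps unfolding homeomorphic_maps_def continuous_map_def by auto
  have comp: "(\<kappa> c, \<kappa> d) \<in> gcomposable \<H> \<and> gmul \<H> (\<kappa> c) (\<kappa> d) = \<kappa> (gmul \<G> c d)"
    if "(c, d) \<in> gcomposable \<G>" for c d
    using groupoid_iso_composable[OF iso(1) that] by simp
  have comp': "(\<kappa>' c, \<kappa>' d) \<in> gcomposable \<G> \<and> gmul \<G> (\<kappa>' c) (\<kappa>' d) = \<kappa>' (gmul \<H> c d)"
    if "(c, d) \<in> gcomposable \<H>" for c d
    using groupoid_iso_composable[OF iso(2) that] by simp
  have mem: "c \<in> topspace (gtop \<G>) \<and> d \<in> topspace (gtop \<G>)" if "(c, d) \<in> gcomposable \<G>" for c d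
    using that by (simp add: gcomposable_def)
  have mem': "c \<in> topspace (gtop \<H>) \<and> d \<in> topspace (gtop \<H>) \<and> gmul \<H> c d \<in> topspace (gtop \<H>)"
    if "(c, d) \<in> gcomposable \<H>" for c d
    using that closed unfolding groupoid_closed_def gcomposable_def by auto
  show "?T (convolution \<G> f f') b = convolution \<H> (?T f) (?T f') b"
  proof (cases "b \<in> topspace (gtop \<H>)")
    case True
    have "(\<Sum>(c, d) \<in> {(c, d) \<in> gcomposable \<G>. gmul \<G> c d = \<kappa>' b \<and> f c \<noteq> 0 \<and> f' d \<noteq> 0}. f c * f' d) =
        (\<Sum>(c, d) \<in> {(c, d) \<in> gcomposable \<H>. gmul \<H> c d = b \<and> ?T f c \<noteq> 0 \<and> ?T f' d \<noteq> 0}. ?T f c * ?T f' d)"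
      by (rule sum.reindex_bij_witness[of _ "map_prod \<kappa>' \<kappa>'" "map_prod \<kappa> \<kappa>"])
        (auto dest: comp comp' mem mem' simp: inv transport_fun_def True)
    then show ?thesis
      using True by (simp add: transport_fun_def[of _ _ "convolution \<G> f f'"] convolution_def)
  next
    case False
    then have "{(c, d) \<in> gcomposable \<H>. gmul \<H> c d = b \<and> ?T f c \<noteq> 0 \<and> ?T f' d \<noteq> 0} = {}"
      using mem' by auto
    then have "convolution \<H> (?T f) (?T f') b = 0"
      unfolding convolution_def by (simp only: sum.empty)
    then show ?thesis
      using False by (simp add: transport_fun_def[of _ _ "convolution \<G> f f'"])
  qed
qed

lemma steinberg_algebra_simps [simp]:
  "acarrier (steinberg_algebra \<G>) = Lc (gtop \<G>)"
  "aadd (steinberg_algebra \<G>) = (\<lambda>f f' c. f c + f' c)"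
  "amult (steinberg_algebra \<G>) = convolution \<G>"
  "asmult (steinberg_algebra \<G>) = (\<lambda>r f c. r * f c)"
  by (simp_all add: steinberg_algebra_def)

lemma groupoid_iso_steinberg:
  assumes iso: "groupoid_iso \<G> \<H> \<kappa>" "groupoid_iso \<H> \<G> \<kappa>'"
    and closed: "groupoid_closed \<G>" "groupoid_closed \<H>"
    and maps: "homeomorphic_maps (gtop \<G>) (gtop \<H>) \<kappa> \<kappa>'"
  shows "alg_iso (steinberg_algebra \<G> :: ('r::comm_ring_1, _) alg) (steinberg_algebra \<H>) (transport_fun (gtop \<H>) \<kappa>')" (is ?iso)
    and "transport_fun (gtop \<H>) \<kappa>' ` (steinberg_diagonal \<G> :: (_ \<Rightarrow> 'r) set) = steinberg_diagonal \<H>" (is ?diag)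
proof -
  have maps': "homeomorphic_maps (gtop \<H>) (gtop \<G>) \<kappa>' \<kappa>"
    using maps homeomorphic_maps_sym by blast
  have inv: "transport_fun (gtop \<G>) \<kappa> (transport_fun (gtop \<H>) \<kappa>' f) = f" if "f \<in> Lc (gtop \<G>)" for f :: "_ \<Rightarrow> 'r"
    using that by (intro transport_fun_inverse[OF maps]) (auto simp: Lc_def)
  have inv': "transport_fun (gtop \<H>) \<kappa>' (transport_fun (gtop \<G>) \<kappa> f) = f" if "f \<in> Lc (gtop \<H>)" for f :: "_ \<Rightarrow> 'r"
    using that by (intro transport_fun_inverse[OF maps']) (auto simp: Lc_def)
  show ?iso
    unfolding alg_iso_def steinberg_algebra_simps
  proof (intro conjI ballI allI)
    show "bij_betw (transport_fun (gtop \<H>) \<kappa>') (Lc (gtop \<G>) :: (_ \<Rightarrow> 'r) set) (Lc (gtop \<H>))"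
      by (rule bij_betw_byWitness[where f' = "transport_fun (gtop \<G>) \<kappa>"])
        (use inv inv' transport_fun_Lc[OF maps] transport_fun_Lc[OF maps'] in auto)
  qed (auto simp: transport_fun_convolution[OF iso closed(2) maps], auto simp: transport_fun_def fun_eq_iff)
  \<comment> \<open>The groupoids are quantified afresh, so that the claim serves both
    \<open>\<kappa>\<close> and \<open>\<kappa>'\<close>.\<close>
  have units: "transport_fun (gtop \<H>) \<kappa>' f \<in> steinberg_diagonal \<H>"
    if "f \<in> steinberg_diagonal \<G>" "groupoid_iso \<G> \<H> \<kappa>" "homeomorphic_maps (gtop \<G>) (gtop \<H>) \<kappa> \<kappa>'" for \<G> \<H> \<kappa> \<kappa>' and f :: "_ \<Rightarrow> 'e::comm_ring_1"
    unfolding steinberg_diagonal_def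
  proof (intro CollectI conjI subsetI)
    show "transport_fun (gtop \<H>) \<kappa>' f \<in> Lc (gtop \<H>)"
      using that by (auto intro: transport_fun_Lc simp: steinberg_diagonal_def)
    fix c assume "c \<in> {c. transport_fun (gtop \<H>) \<kappa>' f c \<noteq> 0}"
    then have c: "c \<in> topspace (gtop \<H>)" "f (\<kappa>' c) \<noteq> 0"
      by (auto simp: transport_fun_def split: if_splits)
    then have "\<kappa>' c \<in> gunits \<G>" "\<kappa> (\<kappa>' c) = c"
      using that unfolding steinberg_diagonal_def homeomorphic_maps_def by auto
    then show "c \<in> gunits \<H>"
      using that(2) unfolding groupoid_iso_def by (metis imageI)
  qed
  show ?diag
  proof (intro equalityI subsetI)
    fix f :: "_ \<Rightarrow> 'r" assume f: "f \<in> steinberg_diagonal \<H>"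
    then have "f = transport_fun (gtop \<H>) \<kappa>' (transport_fun (gtop \<G>) \<kappa> f)"
      using inv'[of f] by (simp add: steinberg_diagonal_def)
    then show "f \<in> transport_fun (gtop \<H>) \<kappa>' ` steinberg_diagonal \<G>"
      using units[OF f iso(2) maps'] by blast
  qed (use units[OF _ iso(1) maps] in auto)
qed

lemma fibered_slice_compactin:
  assumes "compactin X K" "K \<subseteq> D g"
  shows "compactin (fibered_topology X D) ({g} \<times> K)"
proof -
  have "continuous_map (subtopology X (D g)) (fibered_topology X D) (\<lambda>x. (g, x))"
    by (auto simp: continuous_map_in_subtopology continuous_map_pairwise o_def)
  moreover have "compactin (subtopology X (D g)) K"
    using assms by (simp add: compactin_subtopology)
  ultimately have "compactin (fibered_topology X D) ((\<lambda>x. (g, x)) ` K)"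
    by (rule image_compactin[rotated])
  moreover have "(\<lambda>x. (g, x)) ` K = {g} \<times> K"
    by auto
  ultimately show ?thesis
    by simp
qed

section \<open>Currying: the partial skew group ring as a Steinberg algebra\<close>

context partial_action
begin

text \<open>Compactness of the support holds because it is a finite union of slices, one compact
  slice for each group element in \<open>fsupp F\<close>.\<close>

lemma uncurry_in_Lc:
  fixes F :: "'g \<Rightarrow> 'x \<Rightarrow> 'r::comm_ring_1"
  assumes F: "F \<in> acarrier (crossed_product (Lc X) D \<theta>)"
  shows "case_prod F \<in> Lc (fibered_topology X D)"
  unfolding Lc_iff continuous_map_fibered_discrete_iff[where D = D, OF open_dom]
proof (intro conjI allI ballI impI)
  fix c assume "c \<notin> topspace (fibered_topology X D)"
  then show "case_prod F c = 0"
    using F unfolding topspace_groupoid by (cases c) auto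
next
  fix g x assume x: "x \<in> D g"
  then obtain P where "openin X P" "x \<in> P" "\<forall>z\<in>P. F g z = F g x"
    using F dom_subset by (simp add: Lc_def) blast
  then show "\<exists>P. openin X P \<and> x \<in> P \<and> P \<subseteq> D g \<and> (\<forall>z\<in>P. case_prod F (g, z) = case_prod F (g, x))"
    unfolding prod.case using x open_dom by (intro exI[of _ "P \<inter> D g"]) blast
next
  have "compactin (fibered_topology X D) (\<Union>g\<in>fsupp F. {g} \<times> {x \<in> topspace X. F g x \<noteq> 0})"
  proof (rule compactin_Union)
    show "finite ((\<lambda>g. {g} \<times> {x \<in> topspace X. F g x \<noteq> 0}) ` fsupp F)"
      using F by simp
    fix S assume "S \<in> (\<lambda>g. {g} \<times> {x \<in> topspace X. F g x \<noteq> 0}) ` fsupp F"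
    then obtain g where g: "S = {g} \<times> {x \<in> topspace X. F g x \<noteq> 0}"
      by blast
    have "compactin X {x \<in> topspace X. F g x \<noteq> 0}" "{x \<in> topspace X. F g x \<noteq> 0} \<subseteq> D g"
      using F by (auto simp: Lc_iff)
    then show "compactin (fibered_topology X D) S"
      unfolding g by (rule fibered_slice_compactin)
  qed
  moreover have "(\<Union>g\<in>fsupp F. {g} \<times> {x \<in> topspace X. F g x \<noteq> 0}) =
      {c \<in> topspace (fibered_topology X D). case_prod F c \<noteq> 0}"
    unfolding topspace_groupoid
  proof (intro equalityI subsetI)
    fix c assume "c \<in> {c \<in> Sigma UNIV D. case_prod F c \<noteq> 0}"
    then obtain g x where c: "c = (g, x)" "x \<in> D g" "F g x \<noteq> 0"
      by auto
    then have "g \<in> fsupp F" "x \<in> topspace X"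
      using in_fsupp[of F g x] subsetD[OF dom_subset[of g], of x] by simp_all
    then show "c \<in> (\<Union>g\<in>fsupp F. {g} \<times> {x \<in> topspace X. F g x \<noteq> 0})"
      using c by blast
  next
    fix c assume "c \<in> (\<Union>g\<in>fsupp F. {g} \<times> {x \<in> topspace X. F g x \<noteq> 0})"
    then show "c \<in> {c \<in> Sigma UNIV D. case_prod F c \<noteq> 0}"
      using F by auto
  qed
  ultimately show "compactin (fibered_topology X D) {c \<in> topspace (fibered_topology X D). case_prod F c \<noteq> 0}"
    by simp
qed

text \<open>The compact support projects to a compact, hence finite, subset of the discrete group;
  this bounds \<open>fsupp\<close>. The support of a single coefficient is the projection of a
  closed part of that compact set. Outside \<open>D g\<close> local constancy uses that
  \<open>D g\<close> is closed.\<close>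

lemma curry_in_crossed_product:
  fixes f :: "'g \<times> 'x \<Rightarrow> 'r::comm_ring_1"
  assumes f: "f \<in> Lc (fibered_topology X D)" and clopen: "\<And>g. closedin X (D g)"
  shows "curry f \<in> acarrier (crossed_product (Lc X) D \<theta>)"
proof -
  define K where "K = {c \<in> topspace (fibered_topology X D). f c \<noteq> 0}"
  have K: "compactin (fibered_topology X D) K"
    using f unfolding Lc_iff K_def by blast
  have van: "f (g, x) = 0" if "x \<notin> D g" for g x
    using f that topspace_groupoid unfolding Lc_def by auto
  have K_eq: "K = {(g, x). f (g, x) \<noteq> 0}"
    unfolding K_def topspace_groupoid using van by auto
  have fst: "continuous_map (fibered_topology X D) (discrete_topology UNIV) fst"
    using continuous_map_fst by (rule continuous_map_from_subtopology)
  have snd: "continuous_map (fibered_topology X D) X snd"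
    using continuous_map_snd by (rule continuous_map_from_subtopology)
  have "finite (fst ` K)"
    using image_compactin[OF K fst] compactin_discrete_topology by blast
  moreover have "fsupp (curry f) \<subseteq> fst ` K"
  proof
    fix g assume "g \<in> fsupp (curry f)"
    then obtain x where "f (g, x) \<noteq> 0"
      by (auto simp: fsupp_def fun_eq_iff)
    then show "g \<in> fst ` K"
      unfolding K_eq by force
  qed
  ultimately have "finite (fsupp (curry f))"
    by (rule finite_subset[rotated])
  moreover have "curry f g \<in> Lc X" for g
    unfolding Lc_iff
  proof (intro conjI allI impI)
    fix x assume "x \<notin> topspace X"
    then show "curry f g x = 0"
      using van dom_subset by auto
  next
    show "continuous_map X (discrete_topology UNIV) (curry f g)"
      unfolding continuous_map_discrete_iff
    proof
      fix x assume x: "x \<in> topspace X"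
      show "\<exists>P. openin X P \<and> x \<in> P \<and> (\<forall>z\<in>P. curry f g z = curry f g x)"
      proof (cases "x \<in> D g")
        case True
        then show ?thesis
          using f unfolding Lc_iff continuous_map_fibered_discrete_iff[where D = D, OF open_dom] curry_def
          by blast
      next
        case False
        then show ?thesis
          using x van clopen[of g] by (intro exI[of _ "topspace X - D g"]) (auto simp: closedin_def)
      qed
    qed
  next
    have "closedin (fibered_topology X D) {c \<in> topspace (fibered_topology X D). fst c \<in> {g}}"
      by (rule closedin_continuous_map_preimage[OF fst]) auto
    from closed_Int_compactin[OF this K] have "compactin X (snd ` ({c \<in> topspace (fibered_topology X D). fst c \<in> {g}} \<inter> K))"
      by (rule image_compactin[OF _ snd])
    moreover have "snd ` ({c \<in> topspace (fibered_topology X D). fst c \<in> {g}} \<inter> K) = {x \<in> topspace X. curry f g x \<noteq> 0}"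
    proof (intro equalityI subsetI)
      fix x assume "x \<in> {x \<in> topspace X. curry f g x \<noteq> 0}"
      then have "(g, x) \<in> {c \<in> topspace (fibered_topology X D). fst c \<in> {g}} \<inter> K"
        unfolding K_eq topspace_groupoid using van by force
      then show "x \<in> snd ` ({c \<in> topspace (fibered_topology X D). fst c \<in> {g}} \<inter> K)"
        by force
    next
      fix x assume "x \<in> snd ` ({c \<in> topspace (fibered_topology X D). fst c \<in> {g}} \<inter> K)"
      then show "x \<in> {x \<in> topspace X. curry f g x \<noteq> 0}"
        unfolding K_eq topspace_groupoid using subsetD[OF dom_subset] by auto
    qed
    ultimately show "compactin X {x \<in> topspace X. curry f g x \<noteq> 0}"
      by simp
  qed
  ultimately show ?thesis
    using van by simp
qed

text \<open>A factorization of the arrow \<open>(k, x)\<close> is determined by the group element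
  \<open>g\<close> of its first factor: it is \<open>((g, x), (- g + k, \<theta> (- g) x))\<close>.
  The sum over factorizations is thus the sum over \<open>g\<close> from
  \<open>cp_mult_apply_on\<close>.\<close>

lemma uncurry_cp_mult:
  fixes F F' :: "'g \<Rightarrow> 'x \<Rightarrow> 'r::comm_ring_1"
  assumes F: "F \<in> acarrier (crossed_product C D \<theta>)" and F': "F' \<in> acarrier (crossed_product C D \<theta>)"
  shows "case_prod (cp_mult D \<theta> F F') = convolution groupoid (case_prod F) (case_prod F')"
proof
  fix c :: "'g \<times> 'x"
  obtain k x where c: "c = (k, x)"
    by fastforce
  let ?S = "{g. F g x \<noteq> 0 \<and> F' (- g + k) (\<theta> (- g) x) \<noteq> 0}"
  have "(\<Sum>(c, d) \<in> {(c, d) \<in> gcomposable groupoid. gmul groupoid c d = (k, x) \<and> case_prod F c \<noteq> 0 \<and> case_prod F' d \<noteq> 0}.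
      case_prod F c * case_prod F' d) = (\<Sum>g\<in>?S. F g x * F' (- g + k) (\<theta> (- g) x))"
  proof (rule sum.reindex_bij_witness[of _ "\<lambda>g. ((g, x), (- g + k, \<theta> (- g) x))" "\<lambda>(c, d). fst c"])
    fix p assume p: "p \<in> {(c, d) \<in> gcomposable groupoid. gmul groupoid c d = (k, x) \<and> case_prod F c \<noteq> 0 \<and> case_prod F' d \<noteq> 0}"
    obtain g y h z where p_eq: "p = ((g, y), (h, z))"
      by (metis surj_pair)
    then have "g + h = k" "y = x" "z = \<theta> (- g) x" "F g y \<noteq> 0" "F' h z \<noteq> 0"
      using p groupoid_composable by auto
    moreover from this have "h = - g + k"
      by (auto simp: add.assoc[symmetric])
    ultimately show "(case p of (c, d) \<Rightarrow> fst c) \<in> ?S" "((case p of (c, d) \<Rightarrow> fst c, x), (- (case p of (c, d) \<Rightarrow> fst c) + k, \<theta> (- (case p of (c, d) \<Rightarrow> fst c)) x)) = p"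
      "F (case p of (c, d) \<Rightarrow> fst c) x * F' (- (case p of (c, d) \<Rightarrow> fst c) + k) (\<theta> (- (case p of (c, d) \<Rightarrow> fst c)) x) =
         (case p of (c, d) \<Rightarrow> case_prod F c * case_prod F' d)"
      using p_eq by auto
  next
    fix g assume g: "g \<in> ?S"
    then have "x \<in> D g" "\<theta> (- g) x \<in> D (- g + k)"
      using F F' by auto
    then show "((g, x), (- g + k, \<theta> (- g) x)) \<in>
        {(c, d) \<in> gcomposable groupoid. gmul groupoid c d = (k, x) \<and> case_prod F c \<noteq> 0 \<and> case_prod F' d \<noteq> 0}"
      using g groupoid_composable by (simp add: add.assoc[symmetric])
  qed simp
  also have "\<dots> = (\<Sum>g\<in>fsupp F. F g x * F' (- g + k) (\<theta> (- g) x))"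
    using F by (intro sum.mono_neutral_left) (auto intro: in_fsupp)
  also have "\<dots> = cp_mult D \<theta> F F' k x"
    using F F' by (intro cp_mult_apply_on[symmetric]) auto
  finally show "case_prod (cp_mult D \<theta> F F') c = convolution groupoid (case_prod F) (case_prod F') c"
    by (simp add: c convolution_def)
qed

lemma uncurry_iso:
  assumes clopen: "\<And>g. closedin X (D g)"
  shows "alg_iso (partial_skew_group_ring X D \<theta>) (steinberg_algebra groupoid :: ('r::comm_ring_1, _) alg) case_prod"
  unfolding alg_iso_def partial_skew_group_ring_def
proof (intro conjI ballI allI)
  show "bij_betw case_prod (acarrier (crossed_product (Lc X) D \<theta>)) (acarrier (steinberg_algebra groupoid :: ('r, _) alg))"
    by (rule bij_betw_byWitness[where f' = curry])
      (use uncurry_in_Lc curry_in_crossed_product[OF _ clopen] in \<open>auto simp del: crossed_product_simps\<close>)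
next
  fix u v :: "'g \<Rightarrow> 'x \<Rightarrow> 'r"
  assume "u \<in> acarrier (crossed_product (Lc X) D \<theta>)" "v \<in> acarrier (crossed_product (Lc X) D \<theta>)"
  then show "case_prod (amult (crossed_product (Lc X) D \<theta>) u v) =
      amult (steinberg_algebra groupoid) (case_prod u) (case_prod v)"
    unfolding crossed_product_simps(3) steinberg_algebra_simps by (rule uncurry_cp_mult)
qed (auto simp: fun_eq_iff)

lemma uncurry_diagonal:
  "case_prod ` (monomial 0 ` Lc X) = (steinberg_diagonal groupoid :: ('g \<times> 'x \<Rightarrow> 'r::comm_ring_1) set)"
proof (intro equalityI subsetI)
  fix u :: "'g \<times> 'x \<Rightarrow> 'r" assume "u \<in> case_prod ` (monomial 0 ` Lc X)"
  then obtain f where f: "f \<in> Lc X" "u = case_prod (monomial 0 f)"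
    by blast
  have "finite (fsupp (monomial (0::'g) f))"
    by (rule finite_subset[OF fsupp_monomial]) simp
  then have "monomial 0 f \<in> acarrier (crossed_product (Lc X) D \<theta>)"
    using f by (simp add: monomial_def dom_unit Lc_iff)
  then have "u \<in> Lc (gtop groupoid)"
    using f uncurry_in_Lc by simp
  moreover have "c \<in> gunits groupoid" if "u c \<noteq> 0" for c
    using that f by (cases c) (auto simp: monomial_def Lc_def split: if_splits)
  ultimately show "u \<in> steinberg_diagonal groupoid"
    unfolding steinberg_diagonal_def by blast
next
  fix u :: "'g \<times> 'x \<Rightarrow> 'r" assume u: "u \<in> steinberg_diagonal groupoid"
  have van: "u (g, x) = 0" if "g \<noteq> 0 \<or> x \<notin> topspace X" for g x
    using u that unfolding steinberg_diagonal_def by auto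
  have "u \<in> Lc (fibered_topology X D)"
    using u unfolding steinberg_diagonal_def by simp
  have "(\<lambda>x. u (0, x)) \<in> Lc X"
    unfolding Lc_iff
  proof (intro conjI allI impI)
    show "continuous_map X (discrete_topology UNIV) (\<lambda>x. u (0, x))"
    proof -
      have "continuous_map X (fibered_topology X D) (\<lambda>x. (0, x))"
        by (auto simp: continuous_map_in_subtopology continuous_map_pairwise o_def dom_unit)
      then have "continuous_map X (discrete_topology UNIV) (u \<circ> (\<lambda>x. (0, x)))"
        using \<open>u \<in> Lc (fibered_topology X D)\<close> unfolding Lc_iff by (blast intro: continuous_map_compose)
      then show ?thesis
        by (simp add: o_def)
    qed
    have "compactin X (snd ` {c \<in> topspace (fibered_topology X D). u c \<noteq> 0})"
      using \<open>u \<in> Lc (fibered_topology X D)\<close> continuous_map_from_subtopology[OF continuous_map_snd]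
      unfolding Lc_iff by (blast intro: image_compactin)
    moreover have "snd ` {c \<in> topspace (fibered_topology X D). u c \<noteq> 0} = {x \<in> topspace X. u (0, x) \<noteq> 0}"
      unfolding topspace_groupoid
    proof (intro equalityI subsetI)
      fix x assume "x \<in> {x \<in> topspace X. u (0, x) \<noteq> 0}"
      then have "(0, x) \<in> {c \<in> Sigma UNIV D. u c \<noteq> 0}"
        by (simp add: dom_unit)
      then show "x \<in> snd ` {c \<in> Sigma UNIV D. u c \<noteq> 0}"
        by force
    qed (use van in force)
    ultimately show "compactin X {x \<in> topspace X. u (0, x) \<noteq> 0}"
      by simp
  qed (use van in blast)
  moreover have "u = case_prod (monomial 0 (\<lambda>x. u (0, x)))"
    using van by (auto simp: fun_eq_iff monomial_def)
  ultimately show "u \<in> case_prod ` (monomial 0 ` Lc X)"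
    by blast
qed

lemma skew_group_ring_closed:
  assumes clopen: "\<And>g. closedin X (D g)"
  shows "alg_closed (partial_skew_group_ring X D \<theta> :: ('r::comm_ring_1, _) alg)"
proof -
  interpret coefficient_functions X D \<theta> "Lc X :: ('x \<Rightarrow> 'r) set"
    by (rule Lc_coefficient_functions[OF clopen])
  show ?thesis
    unfolding alg_closed_def partial_skew_group_ring_def
    using add_closed smult_closed mult_closed by (simp del: crossed_product_simps(1,2,4))
qed

end

section \<open>Reconstructing the orbit structure from an algebra with a diagonal\<close>

text \<open>\<open>mono g U\<close> plays the role of \<open>1\<^sub>U \<delta>\<^sub>g\<close>, and \<open>supp u h\<close> that of the set of points at which the
  coefficient of \<open>\<delta>\<^sub>h\<close> in \<open>u\<close> does not vanish.\<close>

locale coefficient_algebra = stone_space X + partial_action X D \<theta>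
  for X :: "'x topology" and D :: "'g::group_add \<Rightarrow> 'x set" and \<theta> :: "'g \<Rightarrow> 'x \<Rightarrow> 'x" +
  fixes A :: "'a set" and mul :: "'a \<Rightarrow> 'a \<Rightarrow> 'a" and Diag :: "'a set"
    and mono :: "'g \<Rightarrow> 'x set \<Rightarrow> 'a" and supp :: "'a \<Rightarrow> 'g \<Rightarrow> 'x set"
  assumes mul_in: "u \<in> A \<Longrightarrow> v \<in> A \<Longrightarrow> mul u v \<in> A"
    and mono_in: "compact_open X U \<Longrightarrow> U \<subseteq> D g \<Longrightarrow> mono g U \<in> A"
    and Diag_subset: "Diag \<subseteq> A"
    and mono_Diag: "compact_open X U \<Longrightarrow> mono 0 U \<in> Diag"
    and Diag_idempotent: "u \<in> Diag \<Longrightarrow> mul u u = u \<Longrightarrow> \<exists>U. compact_open X U \<and> u = mono 0 U"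
    and mul_mono: "compact_open X U \<Longrightarrow> U \<subseteq> D g \<Longrightarrow> compact_open X V \<Longrightarrow> V \<subseteq> D h \<Longrightarrow>
      mul (mono g U) (mono h V) = mono (g + h) (U \<inter> {x \<in> D g. \<theta> (- g) x \<in> V})"
    and supp_mono: "compact_open X U \<Longrightarrow> supp (mono 0 U) 0 = U"
    and supp_open: "u \<in> A \<Longrightarrow> openin X (supp u h)"
    and supp_right: "u \<in> A \<Longrightarrow> compact_open X V \<Longrightarrow> supp (mul u (mono 0 V)) h = supp u h \<inter> {x. \<theta> (- h) x \<in> V}"
    and supp_left: "u \<in> A \<Longrightarrow> compact_open X V \<Longrightarrow> supp (mul (mono 0 V) u) h = V \<inter> supp u h"
    and supp_nonempty: "u \<in> A \<Longrightarrow> u' \<in> A \<Longrightarrow> compact_open X W \<Longrightarrow> mul u' u = mono 0 W \<Longrightarrow> x \<in> W \<Longrightarrow>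
      \<exists>h. x \<in> D (- h) \<and> \<theta> h x \<in> supp u h"
begin

lemma mul_mono_zero:
  assumes "compact_open X U" "compact_open X V"
  shows "mul (mono 0 U) (mono 0 V) = mono 0 (U \<inter> V)"
proof -
  have "U \<inter> {x \<in> D 0. \<theta> (- 0) x \<in> V} = U \<inter> V"
    using compact_open_subset[OF assms(1)] act_unit dom_unit by auto
  then show ?thesis
    using mul_mono[of U 0 V 0] assms compact_open_subset dom_unit by simp
qed

lemma mono_inj: "compact_open X U \<Longrightarrow> compact_open X V \<Longrightarrow> mono 0 U = mono 0 V \<Longrightarrow> U = V"
  using supp_mono by metis

lemma mono_conjugate:
  assumes U: "compact_open X U" "U \<subseteq> D (- g)" and V: "compact_open X V" "V \<subseteq> \<theta> g ` U"
  shows "mul (mono (- g) U) (mono g (\<theta> g ` U)) = mono 0 U"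
    and "mul (mono g (\<theta> g ` U)) (mono 0 (\<theta> (- g) ` V)) = mul (mono 0 V) (mono g (\<theta> g ` U))"
proof -
  note U' = act_image[OF U(2)] act_image_compact_open[OF U]
  have gU: "\<theta> g ` U \<subseteq> D g"
    unfolding U'(1) by blast
  then have Vg: "V \<subseteq> D g"
    using V by blast
  have V': "compact_open X (\<theta> (- g) ` V)" "\<theta> (- g) ` V \<subseteq> D (- g)"
    using act_image_compact_open[of V "- g"] act_image[of V "- g"] V Vg by auto
  have "U \<inter> {x \<in> D (- g). \<theta> (- (- g)) x \<in> \<theta> g ` U} = U"
    using U by auto
  then show "mul (mono (- g) U) (mono g (\<theta> g ` U)) = mono 0 U"
    using mul_mono[OF U U'(2) gU] by simp
  have "\<theta> g ` U \<inter> {x \<in> D g. \<theta> (- g) x \<in> \<theta> (- g) ` V} = V"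
  proof (intro equalityI subsetI)
    fix x assume x: "x \<in> \<theta> g ` U \<inter> {x \<in> D g. \<theta> (- g) x \<in> \<theta> (- g) ` V}"
    then obtain v where "v \<in> V" "\<theta> (- g) x = \<theta> (- g) v"
      by auto
    then show "x \<in> V"
      using x act_act_neg Vg by (metis (no_types, lifting) IntD2 mem_Collect_eq subsetD)
  qed (use V Vg in auto)
  moreover have "V \<inter> {x \<in> D 0. \<theta> (- 0) x \<in> \<theta> g ` U} = V"
  proof -
    have "\<theta> (- 0) v = v" "v \<in> D 0" if "v \<in> V" for v
      using that compact_open_subset[OF V(1)] act_unit dom_unit by auto
    then show ?thesis
      using V(2) by auto
  qed
  moreover have "V \<subseteq> D 0" "\<theta> (- g) ` V \<subseteq> D 0"
    using compact_open_subset[OF V(1)] compact_open_subset[OF V'(1)] unfolding dom_unit .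
  ultimately show "mul (mono g (\<theta> g ` U)) (mono 0 (\<theta> (- g) ` V)) = mul (mono 0 V) (mono g (\<theta> g ` U))"
    using mul_mono[OF U'(2) gU V'(1), of 0] mul_mono[OF V(1) _ U'(2) gU, of 0] by simp
qed

end

section \<open>Orbit maps from multiplicative maps\<close>

text \<open>Formulated for one multiplicative map and the action of that map on indicators, so that
  it can be applied to an isomorphism and to its inverse alike.\<close>

lemma multiplicative_map_orbit_map:
  assumes "coefficient_algebra X D \<theta> A mulA DiagA monoA suppA"
    and "coefficient_algebra Y E \<gamma> B mulB DiagB monoB suppB"
    and \<Phi>: "\<And>u. u \<in> A \<Longrightarrow> \<Phi> u \<in> B" "\<And>u v. u \<in> A \<Longrightarrow> v \<in> A \<Longrightarrow> \<Phi> (mulA u v) = mulB (\<Phi> u) (\<Phi> v)"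
    and \<beta>: "\<And>U. compact_open X U \<Longrightarrow> compact_open Y (\<beta> U) \<and> \<Phi> (monoA 0 U) = monoB 0 (\<beta> U)"
    and maps: "homeomorphic_maps X Y \<phi> \<psi>"
    and \<phi>: "\<And>U x. compact_open X U \<Longrightarrow> x \<in> topspace X \<Longrightarrow> \<phi> x \<in> \<beta> U \<longleftrightarrow> x \<in> U"
  shows "orbit_map X D \<theta> E \<gamma> \<phi>"
  unfolding orbit_map_def
proof (intro allI ballI)
  interpret A: coefficient_algebra X D \<theta> A mulA DiagA monoA suppA by fact
  interpret B: coefficient_algebra Y E \<gamma> B mulB DiagB monoB suppB by fact
  fix g x assume x: "x \<in> D (- g)"
  obtain U where U: "compact_open X U" "x \<in> U" "U \<subseteq> D (- g)"
    using A.compact_open_base[OF A.open_dom x] by metis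
  \<comment> \<open>\<open>U\<close> is a neighbourhood of the source point \<open>x\<close>,
    whereas coefficients of \<open>\<delta>_g\<close> live on \<open>D g\<close>; hence the
    indicator of the translate of \<open>U\<close>.\<close>
  define u where "u = monoA g (\<theta> g ` U)"
  have gU: "compact_open X (\<theta> g ` U)" "\<theta> g ` U \<subseteq> D g"
    using A.act_image_compact_open[OF U(1,3)] A.act_image[OF U(3)] by blast+
  have u: "u \<in> A" "monoA (- g) U \<in> A"
    unfolding u_def using A.mono_in U gU by auto
  have diag: "monoA 0 V \<in> A" if "compact_open X V" for V
    using A.mono_Diag A.Diag_subset that by blast
  have cont: "continuous_map X Y \<phi>" and inv: "\<And>y. y \<in> topspace Y \<Longrightarrow> \<phi> (\<psi> y) = y \<and> \<psi> y \<in> topspace X"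
    using maps unfolding homeomorphic_maps_def continuous_map_def by auto
  have "mulB (\<Phi> (monoA (- g) U)) (\<Phi> u) = monoB 0 (\<beta> U)"
    using A.mono_conjugate(1)[OF U(1,3) A.compact_open_empty] \<Phi>(2)[OF u(2,1)] \<beta>[OF U(1)] by (simp add: u_def)
  moreover have "\<phi> x \<in> \<beta> U"
    using \<phi>[OF U(1)] U(2) A.compact_open_subset[OF U(1)] by blast
  ultimately obtain h where h: "\<phi> x \<in> E (- h)" "\<gamma> h (\<phi> x) \<in> suppB (\<Phi> u) h"
    using B.supp_nonempty[OF \<Phi>(1)[OF u(1)] \<Phi>(1)[OF u(2)]] \<beta>[OF U(1)] by metis
  \<comment> \<open>\<open>Q\<close> collects the points that \<open>\<gamma> h\<close> carries to
    where the coefficient at \<open>h\<close> does not vanish. It is open, so its pullback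
    \<open>P\<close> is a neighbourhood of \<open>x\<close> on which the same \<open>h\<close>
    works.\<close>
  define Q where "Q = {y \<in> E (- h). \<gamma> h y \<in> suppB (\<Phi> u) h}"
  define P where "P = U \<inter> {z \<in> topspace X. \<phi> z \<in> Q}"
  have "openin Y Q"
    unfolding Q_def using B.act_preimage_openin[OF B.supp_open[OF \<Phi>(1)[OF u(1)]]] .
  then have "openin X P"
    unfolding P_def using U(1) openin_continuous_map_preimage[OF cont] unfolding compact_open_def by blast
  moreover have "x \<in> P"
    unfolding P_def Q_def using U h A.compact_open_subset[OF U(1)] by blast
  moreover have "P \<subseteq> D (- g)"
    unfolding P_def using U by blast
  moreover have "\<phi> z \<in> E (- h) \<and> \<gamma> h (\<phi> z) = \<phi> (\<theta> g z)" if "z \<in> P" for z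
  proof
    have z: "z \<in> U" "z \<in> topspace X" "\<phi> z \<in> E (- h)" "\<gamma> h (\<phi> z) \<in> suppB (\<Phi> u) h"
      using that unfolding P_def Q_def by auto
    show "\<phi> z \<in> E (- h)"
      by fact
    let ?y = "\<gamma> h (\<phi> z)"
    have y: "?y \<in> topspace Y"
      using B.act_in_dom[OF z(3)] B.dom_subset by blast
    have gz: "\<theta> g z \<in> topspace X" "\<theta> g z \<in> \<theta> g ` U"
      using z gU A.dom_subset by blast+
    show "?y = \<phi> (\<theta> g z)"
    proof (rule ccontr)
      \<comment> \<open>Choose a compact open \<open>V\<close> around \<open>\<theta> g z\<close>
        that misses \<open>\<psi> ?y\<close>, and cut it down to the range of \<open>u\<close>. The
        point \<open>z\<close> lies in the translate of \<open>V'\<close> by \<open>- g\<close>, so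
        one side of the intertwining relation does not vanish at \<open>?y\<close>; the other side
        then forces \<open>?y \<in> \<beta> V'\<close>, against the choice of
        \<open>V\<close>.\<close>
      assume "?y \<noteq> \<phi> (\<theta> g z)"
      then have "\<theta> g z \<noteq> \<psi> ?y"
        using inv[OF y] by auto
      then obtain V where V: "compact_open X V" "\<theta> g z \<in> V" "\<psi> ?y \<notin> V"
        using A.compact_open_separate[OF gz(1)] inv[OF y] by metis
      define V' where "V' = V \<inter> \<theta> g ` U"
      have V': "compact_open X V'" "V' \<subseteq> \<theta> g ` U" "V' \<subseteq> D g"
        unfolding V'_def using A.compact_open_Int V gU by auto
      have W: "compact_open X (\<theta> (- g) ` V')"
        using A.act_image_compact_open[OF V'(1), of "- g"] V'(3) by simp
      have "mulB (\<Phi> u) (monoB 0 (\<beta> (\<theta> (- g) ` V'))) = mulB (monoB 0 (\<beta> V')) (\<Phi> u)"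
        using A.mono_conjugate(2)[OF U(1,3) V'(1,2)] \<Phi>(2)[OF u(1) diag[OF W]] \<Phi>(2)[OF diag[OF V'(1)] u(1)]
          \<beta>[OF W] \<beta>[OF V'(1)] unfolding u_def by simp
      \<comment> \<open>Comparison of the coefficients at \<open>h\<close>: an indicator on the
        right restricts by the source \<open>\<gamma> (- h) y\<close>, an indicator on the left by
        \<open>y\<close> itself.\<close>
      then have eq: "suppB (\<Phi> u) h \<inter> {y. \<gamma> (- h) y \<in> \<beta> (\<theta> (- g) ` V')} = \<beta> V' \<inter> suppB (\<Phi> u) h"
        using B.supp_right[OF \<Phi>(1)[OF u(1)]] B.supp_left[OF \<Phi>(1)[OF u(1)]] \<beta>[OF W] \<beta>[OF V'(1)] by metis
      have "z = \<theta> (- g) (\<theta> g z)"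
        using A.act_neg_act U z by auto
      then have "z \<in> \<theta> (- g) ` V'"
        using V gz unfolding V'_def by blast
      then have "\<phi> z \<in> \<beta> (\<theta> (- g) ` V')"
        using \<phi>[OF W z(2)] by simp
      then have "?y \<in> suppB (\<Phi> u) h \<inter> {y. \<gamma> (- h) y \<in> \<beta> (\<theta> (- g) ` V')}"
        using z(4) B.act_neg_act[OF z(3)] by simp
      then have "?y \<in> \<beta> V'"
        unfolding eq by (rule IntD1)
      then have "\<psi> ?y \<in> V'"
        using \<phi>[OF V'(1), of "\<psi> ?y"] inv[OF y] by simp
      then show False
        using V(3) unfolding V'_def by blast
    qed
  qed
  ultimately show "\<exists>h. orbit_germ X D \<theta> E \<gamma> \<phi> g x h"
    unfolding orbit_germ_def by (intro exI[of _ h] exI[of _ P] conjI ballI) blast+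
qed

text \<open>Sets are recovered from products alone: compact open sets are the idempotents of the
  diagonal, and intersections are their products. The resulting bijection of compact open sets is
  what \<open>stone_duality\<close> takes as input.\<close>

lemma diagonal_iso_orbit_maps:
  assumes A: "coefficient_algebra X D \<theta> A mulA DiagA monoA suppA"
    and B: "coefficient_algebra Y E \<gamma> B mulB DiagB monoB suppB"
    and bij: "bij_betw \<Phi> A B" and mult: "\<And>u v. u \<in> A \<Longrightarrow> v \<in> A \<Longrightarrow> \<Phi> (mulA u v) = mulB (\<Phi> u) (\<Phi> v)"
    and diag: "\<Phi> ` DiagA = DiagB"
  obtains \<phi> \<psi> where "homeomorphic_maps X Y \<phi> \<psi>" "orbit_map X D \<theta> E \<gamma> \<phi>" "orbit_map Y E \<gamma> D \<theta> \<psi>"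
proof -
  interpret A: coefficient_algebra X D \<theta> A mulA DiagA monoA suppA by fact
  interpret B: coefficient_algebra Y E \<gamma> B mulB DiagB monoB suppB by fact
  define \<Psi> where "\<Psi> = the_inv_into A \<Phi>"
  have \<Phi>_in: "\<Phi> u \<in> B" "\<Psi> (\<Phi> u) = u" if "u \<in> A" for u
    using bij that unfolding \<Psi>_def by (auto simp: bij_betw_def the_inv_into_f_f)
  have \<Psi>_in: "\<Psi> v \<in> A" "\<Phi> (\<Psi> v) = v" if "v \<in> B" for v
    using bij that bij_betw_apply[OF bij_betw_the_inv_into[OF bij]] f_the_inv_into_f_bij_betw
    unfolding \<Psi>_def by metis+
  have mult': "\<Psi> (mulB u v) = mulA (\<Psi> u) (\<Psi> v)" if "u \<in> B" "v \<in> B" for u v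
    using mult[OF \<Psi>_in(1) \<Psi>_in(1), OF that] \<Psi>_in that A.mul_in \<Phi>_in by metis
  have diag': "\<Psi> v \<in> DiagA" if v: "v \<in> DiagB" for v
  proof -
    obtain u where "u \<in> DiagA" "v = \<Phi> u"
      using diag v by blast
    then show ?thesis
      using \<Phi>_in A.Diag_subset by auto
  qed
  have "\<exists>V. compact_open Y V \<and> \<Phi> (monoA 0 U) = monoB 0 V" if U: "compact_open X U" for U
  proof -
    have 1: "monoA 0 U \<in> A" "\<Phi> (monoA 0 U) \<in> DiagB"
      using A.mono_Diag[OF U] A.Diag_subset diag by auto
    have "mulB (\<Phi> (monoA 0 U)) (\<Phi> (monoA 0 U)) = \<Phi> (monoA 0 U)"
      using mult[OF 1(1) 1(1)] A.mul_mono_zero[OF U U] by simp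
    then show ?thesis
      using B.Diag_idempotent[OF 1(2)] by blast
  qed
  then obtain \<beta> where \<beta>: "\<And>U. compact_open X U \<Longrightarrow> compact_open Y (\<beta> U) \<and> \<Phi> (monoA 0 U) = monoB 0 (\<beta> U)"
    by metis
  have "\<exists>V. compact_open X V \<and> \<Psi> (monoB 0 U) = monoA 0 V" if U: "compact_open Y U" for U
  proof -
    have 1: "monoB 0 U \<in> B" "\<Psi> (monoB 0 U) \<in> DiagA"
      using B.mono_Diag[OF U] B.Diag_subset diag' by auto
    have "mulA (\<Psi> (monoB 0 U)) (\<Psi> (monoB 0 U)) = \<Psi> (monoB 0 U)"
      using mult'[OF 1(1) 1(1)] B.mul_mono_zero[OF U U] by simp
    then show ?thesis
      using A.Diag_idempotent[OF 1(2)] by blast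
  qed
  then obtain \<beta>' where \<beta>': "\<And>U. compact_open Y U \<Longrightarrow> compact_open X (\<beta>' U) \<and> \<Psi> (monoB 0 U) = monoA 0 (\<beta>' U)"
    by metis
  have inv: "\<beta>' (\<beta> U) = U" if U: "compact_open X U" for U
  proof -
    have "monoA 0 U \<in> A"
      using A.mono_Diag[OF U] A.Diag_subset by blast
    then have "monoA 0 (\<beta>' (\<beta> U)) = monoA 0 U"
      using \<beta>[OF U] \<beta>'[of "\<beta> U"] \<Phi>_in by metis
    then show ?thesis
      using A.mono_inj \<beta> \<beta>' U by blast
  qed
  have inv': "\<beta> (\<beta>' U) = U" if U: "compact_open Y U" for U
  proof -
    have "monoB 0 U \<in> B"
      using B.mono_Diag[OF U] B.Diag_subset by blast
    then have "monoB 0 (\<beta> (\<beta>' U)) = monoB 0 U"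
      using \<beta>'[OF U] \<beta>[of "\<beta>' U"] \<Psi>_in by metis
    then show ?thesis
      using B.mono_inj \<beta> \<beta>' U by blast
  qed
  have bij_\<beta>: "bij_betw \<beta> (Collect (compact_open X)) (Collect (compact_open Y))"
    by (rule bij_betw_byWitness[where f' = \<beta>']) (use \<beta> \<beta>' inv inv' in auto)
  have int_\<beta>: "\<beta> (U \<inter> V) = \<beta> U \<inter> \<beta> V" if UV: "compact_open X U" "compact_open X V" for U V
  proof -
    have "monoA 0 U \<in> A" "monoA 0 V \<in> A"
      using A.mono_Diag UV A.Diag_subset by blast+
    from mult[OF this] have "monoB 0 (\<beta> (U \<inter> V)) = monoB 0 (\<beta> U \<inter> \<beta> V)"
      using A.mul_mono_zero[OF UV] \<beta> UV A.compact_open_Int[OF UV] B.mul_mono_zero by metis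
    then show ?thesis
      by (rule B.mono_inj[rotated 2])
        (use \<beta>[OF UV(1)] \<beta>[OF UV(2)] \<beta>[OF A.compact_open_Int[OF UV]] B.compact_open_Int in auto)
  qed
  obtain \<phi> \<psi> where maps: "homeomorphic_maps X Y \<phi> \<psi>"
    and \<phi>: "\<And>U x. compact_open X U \<Longrightarrow> x \<in> topspace X \<Longrightarrow> \<phi> x \<in> \<beta> U \<longleftrightarrow> x \<in> U"
    and \<psi>: "\<And>U y. compact_open X U \<Longrightarrow> y \<in> topspace Y \<Longrightarrow> \<psi> y \<in> U \<longleftrightarrow> y \<in> \<beta> U"
    by (rule stone_duality[OF A.stone_space_axioms B.stone_space_axioms bij_\<beta> int_\<beta>]) (assumption | rule that)+
  have \<psi>': "\<psi> y \<in> \<beta>' U \<longleftrightarrow> y \<in> U" if "compact_open Y U" "y \<in> topspace Y" for U y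
    using \<psi>[of "\<beta>' U" y] \<beta>' inv' that by simp
  show ?thesis
  proof (rule that[OF maps])
    show "orbit_map X D \<theta> E \<gamma> \<phi>"
      by (rule multiplicative_map_orbit_map[OF A B \<Phi>_in(1) mult \<beta> maps \<phi>])
    show "orbit_map Y E \<gamma> D \<theta> \<psi>"
      by (rule multiplicative_map_orbit_map[OF B A \<Psi>_in(1) mult' \<beta>' maps[unfolded homeomorphic_maps_sym[of X]] \<psi>'])
  qed
qed

section \<open>The partial skew group ring as a coefficient algebra\<close>

context partial_action
begin

lemma cp_mult_monomial_left:
  assumes "\<And>x. x \<notin> D g \<Longrightarrow> f x = 0" "finite (fsupp F)"
  shows "cp_mult D \<theta> (monomial g f) F k x = f x * F (- g + k) (\<theta> (- g) x)"
proof -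
  have "cp_mult D \<theta> (monomial g f) F k x = (\<Sum>i\<in>{g}. monomial g f i x * F (- i + k) (\<theta> (- i) x))"
    by (rule cp_mult_apply_on[OF _ fsupp_monomial assms(2)]) (auto simp: monomial_def assms(1))
  then show ?thesis
    by (simp add: monomial_def)
qed

lemma cp_mult_monomial_zero_right:
  assumes "\<And>g x. x \<notin> D g \<Longrightarrow> F g x = 0" "finite (fsupp F)"
  shows "cp_mult D \<theta> F (monomial 0 f) k x = F k x * f (\<theta> (- k) x)"
proof -
  have [simp]: "- g + k = 0 \<longleftrightarrow> g = k" for g
    by (metis add.right_neutral left_minus minus_add_cancel neg_equal_iff_equal minus_unique)
  have "cp_mult D \<theta> F (monomial 0 f) k x = (\<Sum>g\<in>insert k (fsupp F). F g x * monomial 0 f (- g + k) (\<theta> (- g) x))"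
    using assms finite_subset[OF fsupp_monomial] by (intro cp_mult_apply_on) auto
  also have "\<dots> = (\<Sum>g\<in>insert k (fsupp F). if g = k then F k x * f (\<theta> (- k) x) else 0)"
    by (intro sum.cong) (auto simp: monomial_def)
  also have "\<dots> = F k x * f (\<theta> (- k) x)"
    using assms by simp
  finally show ?thesis .
qed

definition indicator_monomial :: "'g \<Rightarrow> 'x set \<Rightarrow> 'g \<Rightarrow> 'x \<Rightarrow> 'k::zero_neq_one" where
  "indicator_monomial g U = monomial g (\<lambda>x. if x \<in> U then 1 else 0)"

lemma cp_mult_indicator:
  assumes "U \<subseteq> D g"
  shows "cp_mult D \<theta> (indicator_monomial g U) (indicator_monomial h V) =
    (indicator_monomial (g + h) (U \<inter> {x \<in> D g. \<theta> (- g) x \<in> V}) :: 'g \<Rightarrow> 'x \<Rightarrow> 'k::comm_ring_1)"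
proof (intro ext)
  fix k x
  have "- g + k = h \<longleftrightarrow> k = g + h"
    by (metis add.assoc add.left_neutral left_minus right_minus)
  moreover have "finite (fsupp (indicator_monomial h V :: 'g \<Rightarrow> 'x \<Rightarrow> 'k))"
    unfolding indicator_monomial_def by (rule finite_subset[OF fsupp_monomial]) simp
  ultimately show "cp_mult D \<theta> (indicator_monomial g U) (indicator_monomial h V) k x =
      (indicator_monomial (g + h) (U \<inter> {x \<in> D g. \<theta> (- g) x \<in> V}) k x :: 'k)"
    unfolding indicator_monomial_def[of g]
    using assms by (subst cp_mult_monomial_left) (auto simp: indicator_monomial_def monomial_def)
qed

lemma skew_coefficient_algebra:
  assumes "stone_space X" and clopen: "\<And>g. closedin X (D g)"
  shows "coefficient_algebra X D \<theta> (acarrier (crossed_product (Lc X :: ('x \<Rightarrow> 'r::idom) set) D \<theta>))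
    (cp_mult D \<theta>) (monomial 0 ` Lc X) indicator_monomial (\<lambda>u h. {x \<in> D h. u h x \<noteq> 0})"
proof -
  interpret stone_space X by fact
  interpret coefficient_functions X D \<theta> "Lc X :: ('x \<Rightarrow> 'r) set"
    by (rule Lc_coefficient_functions[OF clopen])
  have fin: "finite (fsupp (monomial g f))" for g :: 'g and f :: "'x \<Rightarrow> 'r"
    by (rule finite_subset[OF fsupp_monomial]) simp
  have mono_in: "indicator_monomial g U \<in> acarrier A" if "compact_open X U" "U \<subseteq> D g" for g U
    unfolding indicator_monomial_def using that indicator_in_Lc[OF assms(1)]
    by (intro monomial_closed) auto
  show ?thesis
  proof
    fix u v :: "'g \<Rightarrow> 'x \<Rightarrow> 'r" assume "u \<in> acarrier A" "v \<in> acarrier A"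
    then show "cp_mult D \<theta> u v \<in> acarrier A"
      by (rule mult_closed)
  next
    show "monomial 0 ` Lc X \<subseteq> acarrier A"
      using monomial_closed[of _ 0] by (auto simp: Lc_def dom_unit simp del: crossed_product_simps)
  next
    fix U assume "compact_open X U"
    then show "indicator_monomial 0 U \<in> monomial 0 ` (Lc X :: ('x \<Rightarrow> 'r) set)"
      unfolding indicator_monomial_def using indicator_in_Lc[OF assms(1)] by blast
  next
    fix u :: "'g \<Rightarrow> 'x \<Rightarrow> 'r"
    assume "u \<in> monomial 0 ` Lc X" and idem: "cp_mult D \<theta> u u = u"
    then obtain f where f: "f \<in> Lc X" "u = monomial 0 f"
      by blast
    have van: "f x = 0" if "x \<notin> topspace X" for x
      using f that by (simp add: Lc_def)
    \<comment> \<open>Pointwise \<open>f x * f x = f x\<close>, and an integral domain has no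
      idempotents besides 0 and 1.\<close>
    have val: "f x = 0 \<or> f x = 1" for x
    proof (cases "x \<in> topspace X")
      case True
      have "f x * f x = f x"
        using fun_cong[OF fun_cong[OF idem], of 0 x] True van act_unit
        unfolding f(2) by (subst (asm) cp_mult_monomial_left[OF _ fin]) (auto simp: monomial_def dom_unit)
      then show ?thesis
        by (simp add: mult_cancel_right1)
    qed (simp add: van)
    define U where "U = {x \<in> topspace X. f x \<noteq> 0}"
    have "openin X {x \<in> topspace X. f x \<in> - {0}}"
      using f by (intro openin_continuous_map_preimage[of _ "discrete_topology UNIV"]) (auto simp: Lc_iff)
    then have "compact_open X U"
      using f unfolding compact_open_def U_def Lc_iff by auto
    moreover have "f = (\<lambda>x. if x \<in> U then 1 else 0)"
    proof
      fix x show "f x = (if x \<in> U then 1 else 0)"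
        using val[of x] van[of x] unfolding U_def by auto
    qed
    ultimately show "\<exists>U. compact_open X U \<and> u = indicator_monomial 0 U"
      unfolding indicator_monomial_def f(2) by blast
  next
    fix U V g h assume "U \<subseteq> D g"
    then show "cp_mult D \<theta> (indicator_monomial g U) (indicator_monomial h V) =
        (indicator_monomial (g + h) (U \<inter> {x \<in> D g. \<theta> (- g) x \<in> V}) :: 'g \<Rightarrow> 'x \<Rightarrow> 'r)"
      by (rule cp_mult_indicator)
  next
    fix U assume "compact_open X U"
    then show "{x \<in> D 0. (indicator_monomial 0 U :: 'g \<Rightarrow> 'x \<Rightarrow> 'r) 0 x \<noteq> 0} = U"
      using compact_open_subset by (auto simp: indicator_monomial_def monomial_def dom_unit)
  next
    fix u :: "'g \<Rightarrow> 'x \<Rightarrow> 'r" and h assume u: "u \<in> acarrier A"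
    then have "openin X {x \<in> topspace X. u h x \<in> - {0}}"
      by (intro openin_continuous_map_preimage[of _ "discrete_topology UNIV"]) (auto simp: Lc_iff)
    then have "openin X (D h \<inter> {x \<in> topspace X. u h x \<in> - {0}})"
      by (rule openin_Int[OF open_dom])
    then show "openin X {x \<in> D h. u h x \<noteq> 0}"
      by (rule back_subst[of "openin X"]) (use dom_subset in auto)
  next
    fix u :: "'g \<Rightarrow> 'x \<Rightarrow> 'r" and h V assume u: "u \<in> acarrier A"
    then have "cp_mult D \<theta> u (indicator_monomial 0 V) h x = u h x * (if \<theta> (- h) x \<in> V then 1 else 0)" for x
      unfolding indicator_monomial_def by (intro cp_mult_monomial_zero_right) auto
    then show "{x \<in> D h. cp_mult D \<theta> u (indicator_monomial 0 V) h x \<noteq> 0} =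
        {x \<in> D h. u h x \<noteq> 0} \<inter> {x. \<theta> (- h) x \<in> V}"
      by auto
  next
    fix u :: "'g \<Rightarrow> 'x \<Rightarrow> 'r" and h V assume u: "u \<in> acarrier A" and V: "compact_open X V"
    then have "cp_mult D \<theta> (indicator_monomial 0 V) u h x = (if x \<in> V then 1 else 0) * u (- 0 + h) (\<theta> (- 0) x)" for x
      unfolding indicator_monomial_def using compact_open_subset[OF V]
      by (intro cp_mult_monomial_left) (auto simp: dom_unit)
    then show "{x \<in> D h. cp_mult D \<theta> (indicator_monomial 0 V) u h x \<noteq> 0} = V \<inter> {x \<in> D h. u h x \<noteq> 0}"
      using dom_subset act_unit by (auto simp: subset_iff)
  next
    fix u u' :: "'g \<Rightarrow> 'x \<Rightarrow> 'r" and W x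
    assume u: "u \<in> acarrier A" "u' \<in> acarrier A" and "cp_mult D \<theta> u' u = indicator_monomial 0 W" "x \<in> W"
    then have "cp_mult D \<theta> u' u 0 x \<noteq> 0"
      by (simp add: indicator_monomial_def monomial_def)
    moreover have "cp_mult D \<theta> u' u 0 x = (\<Sum>g\<in>fsupp u'. u' g x * u (- g + 0) (\<theta> (- g) x))"
      using u by (intro cp_mult_apply_on) auto
    \<comment> \<open>A nonvanishing finite sum has a nonvanishing term; the group element sought is
      \<open>- g\<close>.\<close>
    ultimately obtain g where "u' g x * u (- g + 0) (\<theta> (- g) x) \<noteq> 0"
      by (metis (no_types, lifting) sum.neutral)
    then have g: "u' g x \<noteq> 0" "u (- g) (\<theta> (- g) x) \<noteq> 0"
      by auto
    then have "x \<in> D (- (- g))" "\<theta> (- g) x \<in> D (- g)"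
      using u by auto
    then show "\<exists>h. x \<in> D (- h) \<and> \<theta> h x \<in> {x \<in> D h. u h x \<noteq> 0}"
      using g by blast
  qed (use mono_in in auto)
qed

end

section \<open>Bounded matrices and the reduced norm\<close>

text \<open>An operator bound for a possibly infinite matrix, expressed through all finite sections
  of its bilinear form. In this form sums, adjoints, products and relabellings need only finite
  sums; \<open>operator_norm_mat_bounded\<close> links it to the operator norm.\<close>

definition mat_bounded :: "'i set \<Rightarrow> ('i \<Rightarrow> 'i \<Rightarrow> complex) \<Rightarrow> real \<Rightarrow> bool" where
  "mat_bounded I M C \<longleftrightarrow> (\<forall>K L \<xi> \<eta>. finite K \<longrightarrow> finite L \<longrightarrow> K \<subseteq> I \<longrightarrow> L \<subseteq> I \<longrightarrow>
     cmod (\<Sum>k\<in>K. \<Sum>l\<in>L. M k l * \<xi> l * \<eta> k) \<le> C * L2_set (\<lambda>l. cmod (\<xi> l)) L * L2_set (\<lambda>k. cmod (\<eta> k)) K)"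

lemma mat_boundedD:
  assumes "mat_bounded I M C" "finite K" "finite L" "K \<subseteq> I" "L \<subseteq> I"
  shows "cmod (\<Sum>k\<in>K. \<Sum>l\<in>L. M k l * \<xi> l * \<eta> k) \<le> C * L2_set (\<lambda>l. cmod (\<xi> l)) L * L2_set (\<lambda>k. cmod (\<eta> k)) K"
  using assms unfolding mat_bounded_def by blast

lemma L2_set_cmod_square: "(L2_set (\<lambda>k. cmod (v k)) K)\<^sup>2 = (\<Sum>k\<in>K. (cmod (v k))\<^sup>2)"
  by (simp add: L2_set_def sum_nonneg)

text \<open>The form is tested against the conjugate of the image vector, which produces the square
  of its norm; one factor is then cancelled.\<close>

lemma mat_bounded_vector:
  assumes "mat_bounded I M C" "finite K" "finite L" "K \<subseteq> I" "L \<subseteq> I" "0 \<le> C"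
  shows "L2_set (\<lambda>k. cmod (\<Sum>l\<in>L. M k l * \<xi> l)) K \<le> C * L2_set (\<lambda>l. cmod (\<xi> l)) L"
proof -
  define v where "v = (\<lambda>k. \<Sum>l\<in>L. M k l * \<xi> l)"
  let ?s = "L2_set (\<lambda>k. cmod (v k)) K"
  have "(\<Sum>k\<in>K. \<Sum>l\<in>L. M k l * \<xi> l * cnj (v k)) = (\<Sum>k\<in>K. v k * cnj (v k))"
    by (simp add: v_def sum_distrib_right)
  also have "\<dots> = of_real (?s\<^sup>2)"
    unfolding L2_set_cmod_square of_real_sum complex_norm_square ..
  finally have "cmod (of_real (?s\<^sup>2)) \<le> C * L2_set (\<lambda>l. cmod (\<xi> l)) L * L2_set (\<lambda>k. cmod (cnj (v k))) K"
    using mat_boundedD[OF assms(1-5), of \<xi> "\<lambda>k. cnj (v k)"] by simp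
  then have "?s * ?s \<le> (C * L2_set (\<lambda>l. cmod (\<xi> l)) L) * ?s"
    by (simp add: power2_eq_square norm_mult)
  then have "?s \<le> C * L2_set (\<lambda>l. cmod (\<xi> l)) L"
    using assms(6) by (cases "?s = 0") (auto simp: L2_set_nonneg mult_le_cancel_right order_less_le)
  then show ?thesis
    unfolding v_def .
qed

text \<open>This is the Cauchy-Schwarz inequality. With \<open>mat_bounded_vector\<close>, the
  bilinear and the vector form of a bound become interchangeable for nonnegative constants.\<close>

lemma mat_boundedI_vector:
  assumes "\<And>K L \<xi>. finite K \<Longrightarrow> finite L \<Longrightarrow> K \<subseteq> I \<Longrightarrow> L \<subseteq> I \<Longrightarrow>
    L2_set (\<lambda>k. cmod (\<Sum>l\<in>L. M k l * \<xi> l)) K \<le> C * L2_set (\<lambda>l. cmod (\<xi> l)) L"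
  shows "mat_bounded I M C"
  unfolding mat_bounded_def
proof (intro allI impI)
  fix K L :: "'a set" and \<xi> \<eta> :: "'a \<Rightarrow> complex"
  assume fin: "finite K" "finite L" "K \<subseteq> I" "L \<subseteq> I"
  define v where "v = (\<lambda>k. \<Sum>l\<in>L. M k l * \<xi> l)"
  have "cmod (\<Sum>k\<in>K. \<Sum>l\<in>L. M k l * \<xi> l * \<eta> k) = cmod (\<Sum>k\<in>K. v k * \<eta> k)"
    by (simp add: v_def sum_distrib_right)
  also have "\<dots> \<le> (\<Sum>k\<in>K. \<bar>cmod (v k)\<bar> * \<bar>cmod (\<eta> k)\<bar>)"
    by (rule order_trans[OF norm_sum]) (simp add: norm_mult)
  also have "\<dots> \<le> L2_set (\<lambda>k. cmod (v k)) K * L2_set (\<lambda>k. cmod (\<eta> k)) K"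
    by (rule L2_set_mult_ineq)
  also have "\<dots> \<le> C * L2_set (\<lambda>l. cmod (\<xi> l)) L * L2_set (\<lambda>k. cmod (\<eta> k)) K"
    unfolding v_def by (rule mult_right_mono[OF assms[OF fin] L2_set_nonneg])
  finally show "cmod (\<Sum>k\<in>K. \<Sum>l\<in>L. M k l * \<xi> l * \<eta> k) \<le> C * L2_set (\<lambda>l. cmod (\<xi> l)) L * L2_set (\<lambda>k. cmod (\<eta> k)) K" .
qed

lemma mat_bounded_mono:
  assumes "mat_bounded I M C" "C \<le> C'"
  shows "mat_bounded I M C'"
  unfolding mat_bounded_def
proof (intro allI impI)
  fix K L :: "'a set" and \<xi> \<eta> :: "'a \<Rightarrow> complex"
  assume fin: "finite K" "finite L" "K \<subseteq> I" "L \<subseteq> I"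
  show "cmod (\<Sum>k\<in>K. \<Sum>l\<in>L. M k l * \<xi> l * \<eta> k) \<le> C' * L2_set (\<lambda>l. cmod (\<xi> l)) L * L2_set (\<lambda>k. cmod (\<eta> k)) K"
    by (rule order_trans[OF mat_boundedD[OF assms(1) fin]])
      (intro mult_right_mono assms(2) L2_set_nonneg)
qed

lemma mat_bounded_add:
  assumes "mat_bounded I M C" "mat_bounded I M' C'"
  shows "mat_bounded I (\<lambda>k l. M k l + M' k l) (C + C')"
  unfolding mat_bounded_def
proof (intro allI impI)
  fix K L :: "'a set" and \<xi> \<eta> :: "'a \<Rightarrow> complex"
  assume fin: "finite K" "finite L" "K \<subseteq> I" "L \<subseteq> I"
  have "cmod (\<Sum>k\<in>K. \<Sum>l\<in>L. (M k l + M' k l) * \<xi> l * \<eta> k) \<le>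
      cmod (\<Sum>k\<in>K. \<Sum>l\<in>L. M k l * \<xi> l * \<eta> k) + cmod (\<Sum>k\<in>K. \<Sum>l\<in>L. M' k l * \<xi> l * \<eta> k)"
    by (simp add: distrib_right sum.distrib norm_triangle_ineq)
  also have "\<dots> \<le> (C + C') * L2_set (\<lambda>l. cmod (\<xi> l)) L * L2_set (\<lambda>k. cmod (\<eta> k)) K"
    using mat_boundedD[OF assms(1) fin, of \<xi> \<eta>] mat_boundedD[OF assms(2) fin, of \<xi> \<eta>]
    by (simp add: distrib_right)
  finally show "cmod (\<Sum>k\<in>K. \<Sum>l\<in>L. (M k l + M' k l) * \<xi> l * \<eta> k) \<le>
      (C + C') * L2_set (\<lambda>l. cmod (\<xi> l)) L * L2_set (\<lambda>k. cmod (\<eta> k)) K" .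
qed

lemma mat_bounded_smult:
  assumes "mat_bounded I M C"
  shows "mat_bounded I (\<lambda>k l. r * M k l) (cmod r * C)"
  unfolding mat_bounded_def
proof (intro allI impI)
  fix K L :: "'a set" and \<xi> \<eta> :: "'a \<Rightarrow> complex"
  assume fin: "finite K" "finite L" "K \<subseteq> I" "L \<subseteq> I"
  have "cmod (\<Sum>k\<in>K. \<Sum>l\<in>L. r * M k l * \<xi> l * \<eta> k) = cmod r * cmod (\<Sum>k\<in>K. \<Sum>l\<in>L. M k l * \<xi> l * \<eta> k)"
    by (simp add: sum_distrib_left mult.assoc flip: norm_mult)
  also have "\<dots> \<le> cmod r * (C * L2_set (\<lambda>l. cmod (\<xi> l)) L * L2_set (\<lambda>k. cmod (\<eta> k)) K)"
    by (rule mult_left_mono[OF mat_boundedD[OF assms fin] norm_ge_zero])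
  finally show "cmod (\<Sum>k\<in>K. \<Sum>l\<in>L. r * M k l * \<xi> l * \<eta> k) \<le>
      cmod r * C * L2_set (\<lambda>l. cmod (\<xi> l)) L * L2_set (\<lambda>k. cmod (\<eta> k)) K"
    by (simp add: mult.assoc)
qed

lemma mat_bounded_adjoint:
  assumes "mat_bounded I M C"
  shows "mat_bounded I (\<lambda>k l. cnj (M l k)) C"
  unfolding mat_bounded_def
proof (intro allI impI)
  fix K L :: "'a set" and \<xi> \<eta> :: "'a \<Rightarrow> complex"
  assume fin: "finite K" "finite L" "K \<subseteq> I" "L \<subseteq> I"
  have "(\<Sum>k\<in>K. \<Sum>l\<in>L. cnj (M l k) * \<xi> l * \<eta> k) = cnj (\<Sum>l\<in>L. \<Sum>k\<in>K. M l k * cnj (\<eta> k) * cnj (\<xi> l))"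
    by (subst sum.swap) (simp add: mult_ac)
  then have "cmod (\<Sum>k\<in>K. \<Sum>l\<in>L. cnj (M l k) * \<xi> l * \<eta> k) = cmod (\<Sum>l\<in>L. \<Sum>k\<in>K. M l k * cnj (\<eta> k) * cnj (\<xi> l))"
    by (simp only: complex_mod_cnj)
  also have "\<dots> \<le> C * L2_set (\<lambda>k. cmod (cnj (\<eta> k))) K * L2_set (\<lambda>l. cmod (cnj (\<xi> l))) L"
    using fin by (intro mat_boundedD[OF assms]) auto
  finally show "cmod (\<Sum>k\<in>K. \<Sum>l\<in>L. cnj (M l k) * \<xi> l * \<eta> k) \<le>
      C * L2_set (\<lambda>l. cmod (\<xi> l)) L * L2_set (\<lambda>k. cmod (\<eta> k)) K"
    by (simp add: mult_ac)
qed

text \<open>The inner index set \<open>J\<close> may depend on the finite section but has to serve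
  all its rows and columns at once. For elements with finitely many coefficients such a
  \<open>J\<close> exists, so the product involves no infinite sum.\<close>

lemma mat_bounded_mult:
  assumes M: "mat_bounded I M C" and M': "mat_bounded I M' C'" and C: "0 \<le> C" "0 \<le> C'"
    and P: "\<And>K L. finite K \<Longrightarrow> finite L \<Longrightarrow> K \<subseteq> I \<Longrightarrow> L \<subseteq> I \<Longrightarrow>
      \<exists>J. finite J \<and> J \<subseteq> I \<and> (\<forall>k\<in>K. \<forall>l\<in>L. P k l = (\<Sum>j\<in>J. M k j * M' j l))"
  shows "mat_bounded I P (C * C')"
proof (rule mat_boundedI_vector)
  fix K L :: "'a set" and \<xi> :: "'a \<Rightarrow> complex"
  assume fin: "finite K" "finite L" "K \<subseteq> I" "L \<subseteq> I"
  then obtain J where J: "finite J" "J \<subseteq> I" "\<And>k l. k \<in> K \<Longrightarrow> l \<in> L \<Longrightarrow> P k l = (\<Sum>j\<in>J. M k j * M' j l)"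
    using P by metis
  have "(\<Sum>l\<in>L. P k l * \<xi> l) = (\<Sum>j\<in>J. M k j * (\<Sum>l\<in>L. M' j l * \<xi> l))" if "k \<in> K" for k
    using J(3)[OF that] by (simp add: sum_distrib_left sum_distrib_right mult.assoc sum.swap[of _ J L])
  then have "L2_set (\<lambda>k. cmod (\<Sum>l\<in>L. P k l * \<xi> l)) K = L2_set (\<lambda>k. cmod (\<Sum>j\<in>J. M k j * (\<Sum>l\<in>L. M' j l * \<xi> l))) K"
    by (intro L2_set_cong) auto
  also have "\<dots> \<le> C * L2_set (\<lambda>j. cmod (\<Sum>l\<in>L. M' j l * \<xi> l)) J"
    by (rule mat_bounded_vector[OF M fin(1) J(1) fin(3) J(2) C(1)])
  also have "\<dots> \<le> C * (C' * L2_set (\<lambda>l. cmod (\<xi> l)) L)"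
    by (rule mult_left_mono[OF mat_bounded_vector[OF M' J(1) fin(2) J(2) fin(4) C(2)] C(1)])
  finally show "L2_set (\<lambda>k. cmod (\<Sum>l\<in>L. P k l * \<xi> l)) K \<le> C * C' * L2_set (\<lambda>l. cmod (\<xi> l)) L"
    by (simp add: mult.assoc)
qed

lemma mat_bounded_entry:
  assumes "mat_bounded I M C" "k \<in> I" "l \<in> I"
  shows "cmod (M k l) \<le> C"
  using mat_boundedD[OF assms(1), of "{k}" "{l}" "\<lambda>_. 1" "\<lambda>_. 1"] assms by simp

lemma mat_bounded_column:
  assumes "mat_bounded I M C" "finite K" "K \<subseteq> I" "l \<in> I" "0 \<le> C"
  shows "L2_set (\<lambda>k. cmod (M k l)) K \<le> C"
  using mat_bounded_vector[OF assms(1,2), of "{l}" "\<lambda>_. 1"] assms by simp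

lemma mat_bounded_row:
  assumes "mat_bounded I M C" "finite L" "L \<subseteq> I" "k \<in> I" "0 \<le> C"
  shows "L2_set (\<lambda>l. cmod (M k l)) L \<le> C"
  using mat_bounded_column[OF mat_bounded_adjoint[OF assms(1)] assms(2-5)] by simp

text \<open>Each row has at most one nonzero entry and, since \<open>p\<close> is injective on
  \<open>I\<close>, so has each column; hence the norm is controlled by the largest entry. This is
  the shape of the matrix of a monomial.\<close>

lemma mat_bounded_partial_permutation:
  assumes inj: "inj_on p I" and le: "\<And>k. k \<in> I \<Longrightarrow> cmod (a k) \<le> c" and "0 \<le> c"
  shows "mat_bounded I (\<lambda>k l. if l = p k then a k else 0) c"
proof (rule mat_boundedI_vector)
  fix K L :: "'a set" and \<xi> :: "'a \<Rightarrow> complex"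
  assume fin: "finite K" "finite L" "K \<subseteq> I" "L \<subseteq> I"
  let ?v = "\<lambda>k. \<Sum>l\<in>L. (if l = p k then a k else 0) * \<xi> l"
  have v: "?v k = (if p k \<in> L then a k * \<xi> (p k) else 0)" for k
  proof -
    have "?v k = (\<Sum>l\<in>L. if l = p k then a k * \<xi> (p k) else 0)"
      by (intro sum.cong) auto
    then show ?thesis
      using fin(2) by simp
  qed
  have "(\<Sum>k\<in>K. (cmod (?v k))\<^sup>2) = (\<Sum>k\<in>{k\<in>K. p k \<in> L}. (cmod (a k * \<xi> (p k)))\<^sup>2)"
    unfolding v using fin(1) by (subst sum.inter_filter) (auto intro: sum.cong)
  also have "\<dots> \<le> (\<Sum>k\<in>{k\<in>K. p k \<in> L}. c\<^sup>2 * (cmod (\<xi> (p k)))\<^sup>2)"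
    using le fin(3) assms(3) by (intro sum_mono) (auto simp: norm_mult power_mult_distrib intro!: mult_right_mono power_mono)
  also have "\<dots> = c\<^sup>2 * (\<Sum>l\<in>p ` {k\<in>K. p k \<in> L}. (cmod (\<xi> l))\<^sup>2)"
    using inj_on_subset[OF inj, of "{k\<in>K. p k \<in> L}"] fin(3) by (subst sum.reindex) (auto simp: sum_distrib_left)
  also have "\<dots> \<le> c\<^sup>2 * (\<Sum>l\<in>L. (cmod (\<xi> l))\<^sup>2)"
    using fin(2) by (intro mult_left_mono sum_mono2) auto
  finally have "sqrt (\<Sum>k\<in>K. (cmod (?v k))\<^sup>2) \<le> sqrt (c\<^sup>2 * (\<Sum>l\<in>L. (cmod (\<xi> l))\<^sup>2))"
    by simp
  then show "L2_set (\<lambda>k. cmod (?v k)) K \<le> c * L2_set (\<lambda>l. cmod (\<xi> l)) L"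
    using assms(3) by (simp add: L2_set_def real_sqrt_mult)
qed

lemma mat_bounded_zero: "mat_bounded I (\<lambda>k l. 0) 0"
  by (simp add: mat_bounded_def)

lemma mat_bounded_sum:
  assumes "finite S" "\<And>i. i \<in> S \<Longrightarrow> mat_bounded I (M i) (C i)"
  shows "mat_bounded I (\<lambda>k l. \<Sum>i\<in>S. M i k l) (\<Sum>i\<in>S. C i)"
  using assms by (induction S rule: finite_induct) (auto intro: mat_bounded_add simp: mat_bounded_zero)

lemma mat_bounded_reindex:
  assumes \<sigma>: "bij_betw \<sigma> I I'" and eq: "\<And>k l. k \<in> I \<Longrightarrow> l \<in> I \<Longrightarrow> M' (\<sigma> k) (\<sigma> l) = M k l"
    and M': "mat_bounded I' M' C"
  shows "mat_bounded I M C"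
  unfolding mat_bounded_def
proof (intro allI impI)
  fix K L :: "'a set" and \<xi> \<eta> :: "'a \<Rightarrow> complex"
  assume fin: "finite K" "finite L" "K \<subseteq> I" "L \<subseteq> I"
  define \<tau> where "\<tau> = the_inv_into I \<sigma>"
  have inj: "inj_on \<sigma> K" "inj_on \<sigma> L"
    using \<sigma> fin inj_on_subset unfolding bij_betw_def by blast+
  have \<tau>: "\<tau> (\<sigma> k) = k" if "k \<in> I" for k
    using \<sigma> that unfolding \<tau>_def bij_betw_def by (simp add: the_inv_into_f_f)
  have "(\<Sum>k\<in>\<sigma> ` K. \<Sum>l\<in>\<sigma> ` L. M' k l * \<xi> (\<tau> l) * \<eta> (\<tau> k)) = (\<Sum>k\<in>K. \<Sum>l\<in>L. M' (\<sigma> k) (\<sigma> l) * \<xi> (\<tau> (\<sigma> l)) * \<eta> (\<tau> (\<sigma> k)))"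
    by (simp add: sum.reindex inj)
  also have "\<dots> = (\<Sum>k\<in>K. \<Sum>l\<in>L. M k l * \<xi> l * \<eta> k)"
    using fin by (intro sum.cong refl) (simp add: eq \<tau> subset_iff)
  finally have sum: "(\<Sum>k\<in>\<sigma> ` K. \<Sum>l\<in>\<sigma> ` L. M' k l * \<xi> (\<tau> l) * \<eta> (\<tau> k)) = (\<Sum>k\<in>K. \<Sum>l\<in>L. M k l * \<xi> l * \<eta> k)" .
  have norm: "L2_set (\<lambda>l. cmod (\<zeta> (\<tau> l))) (\<sigma> ` J) = L2_set (\<lambda>l. cmod (\<zeta> l)) J" if "J \<subseteq> I" for \<zeta> J
    unfolding L2_set_def using that inj_on_subset[of \<sigma> I J] \<sigma>
    by (subst sum.reindex) (auto simp: bij_betw_def subset_iff \<tau> intro!: sum.cong arg_cong[where f = sqrt])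
  have "cmod (\<Sum>k\<in>\<sigma> ` K. \<Sum>l\<in>\<sigma> ` L. M' k l * \<xi> (\<tau> l) * \<eta> (\<tau> k)) \<le>
      C * L2_set (\<lambda>l. cmod (\<xi> (\<tau> l))) (\<sigma> ` L) * L2_set (\<lambda>k. cmod (\<eta> (\<tau> k))) (\<sigma> ` K)"
    using fin \<sigma> by (intro mat_boundedD[OF M']) (auto simp: bij_betw_def)
  then show "cmod (\<Sum>k\<in>K. \<Sum>l\<in>L. M k l * \<xi> l * \<eta> k) \<le> C * L2_set (\<lambda>l. cmod (\<xi> l)) L * L2_set (\<lambda>k. cmod (\<eta> k)) K"
    unfolding sum norm[OF fin(3)] norm[OF fin(4)] .
qed

text \<open>The matrix of \<open>\<pi>\<^sub>x(F)\<close> on \<open>\<ell>\<^sup>2(G\<^sub>x)\<close>.\<close>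

definition reg_matrix :: "('g::group_add \<Rightarrow> 'x \<Rightarrow> 'x) \<Rightarrow> 'x \<Rightarrow> ('g \<Rightarrow> 'x \<Rightarrow> complex) \<Rightarrow> 'g \<Rightarrow> 'g \<Rightarrow> complex" where
  "reg_matrix \<theta> x F k l = F (k - l) (\<theta> k x)"

text \<open>The substitution \<open>l = - g + k\<close> turns the sum over group elements into a row
  of the matrix. \<open>L\<close> may be any finite set that catches the entries of
  \<open>\<xi>\<close> seen by row \<open>k\<close>; this covers finitely supported vectors and,
  with \<open>L\<close> adapted to finitely many rows, arbitrary ones.\<close>

lemma reg_rep_matrix:
  assumes fin: "finite (fsupp F)" and k: "k \<in> orbit_index D x" and L: "finite L" "L \<subseteq> orbit_index D x"
    and supp: "\<And>l. l \<in> orbit_index D x \<Longrightarrow> \<xi> l \<noteq> 0 \<Longrightarrow> k - l \<in> fsupp F \<Longrightarrow> l \<in> L"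
  shows "reg_rep D \<theta> x F \<xi> k = (\<Sum>l\<in>L. reg_matrix \<theta> x F k l * \<xi> l)"
proof -
  have [simp]: "k - (- g + k) = g" for g
    by (simp add: diff_conv_add_uminus minus_add del: add_uminus_conv_diff)
  have [simp]: "- (k - l) + k = l" for l
    by (simp add: minus_diff_eq)
  have "reg_rep D \<theta> x F \<xi> k = (\<Sum>g \<in> {g \<in> fsupp F. - g + k \<in> orbit_index D x}. F g (\<theta> k x) * \<xi> (- g + k))"
    using k by (simp add: reg_rep_def)
  also have "\<dots> = (\<Sum>g \<in> {g \<in> fsupp F. - g + k \<in> L}. F g (\<theta> k x) * \<xi> (- g + k))"
    using fin L supp by (intro sum.mono_neutral_right) force+
  also have "\<dots> = (\<Sum>l \<in> {l\<in>L. k - l \<in> fsupp F}. reg_matrix \<theta> x F k l * \<xi> l)"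
    by (rule sum.reindex_bij_witness[of _ "\<lambda>l. k - l" "\<lambda>g. - g + k"]) (auto simp: reg_matrix_def)
  also have "\<dots> = (\<Sum>l\<in>L. reg_matrix \<theta> x F k l * \<xi> l)"
    using L by (intro sum.mono_neutral_left) (auto simp: reg_matrix_def not_in_fsupp)
  finally show ?thesis .
qed

section \<open>Square-summable vectors, operator norm and reduced norm\<close>

lemma l2_finite_bound:
  assumes "\<xi> \<in> l2 I" "finite L" "L \<subseteq> I"
  shows "L2_set (\<lambda>l. cmod (\<xi> l)) L \<le> l2_norm I \<xi>"
  unfolding L2_set_def l2_norm_def using assms
  by (intro real_sqrt_le_mono finite_sum_le_infsum) (auto simp: l2_def)

lemma l2_norm_le:
  assumes "\<And>i. i \<notin> I \<Longrightarrow> \<xi> i = 0" "\<And>L. finite L \<Longrightarrow> L \<subseteq> I \<Longrightarrow> L2_set (\<lambda>l. cmod (\<xi> l)) L \<le> c" "0 \<le> c"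
  shows "\<xi> \<in> l2 I" "l2_norm I \<xi> \<le> c"
proof -
  have le: "(\<Sum>l\<in>L. (cmod (\<xi> l))\<^sup>2) \<le> c\<^sup>2" if "finite L" "L \<subseteq> I" for L
    unfolding L2_set_cmod_square[symmetric] by (rule power_mono[OF assms(2)[OF that] L2_set_nonneg])
  have "(\<lambda>i. (cmod (\<xi> i))\<^sup>2) summable_on I"
    by (rule nonneg_bdd_above_summable_on) (auto intro!: bdd_aboveI2[where M = "c\<^sup>2"] le)
  then show "\<xi> \<in> l2 I"
    using assms(1) by (simp add: l2_def)
  have "(\<Sum>\<^sub>\<infinity>i\<in>I. (cmod (\<xi> i))\<^sup>2) \<le> c\<^sup>2"
    by (rule infsum_le_finite_sums) (use le \<open>\<xi> \<in> l2 I\<close> in \<open>auto simp: l2_def\<close>)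
  then show "l2_norm I \<xi> \<le> c"
    unfolding l2_norm_def using assms(3) real_sqrt_le_mono real_sqrt_abs by fastforce
qed

lemma reg_rep_l2:
  assumes fin: "finite (fsupp F)" and M: "mat_bounded (orbit_index D x) (reg_matrix \<theta> x F) C" and "0 \<le> C"
    and \<xi>: "\<xi> \<in> l2 (orbit_index D x)"
  shows "reg_rep D \<theta> x F \<xi> \<in> l2 (orbit_index D x)"
    and "l2_norm (orbit_index D x) (reg_rep D \<theta> x F \<xi>) \<le> C * l2_norm (orbit_index D x) \<xi>"
proof -
  let ?I = "orbit_index D x"
  have le: "L2_set (\<lambda>k. cmod (reg_rep D \<theta> x F \<xi> k)) K \<le> C * l2_norm ?I \<xi>" if K: "finite K" "K \<subseteq> ?I" for K
  proof -
    \<comment> \<open>Finitely many rows see only finitely many entries of \<open>\<xi>\<close>,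
      those at \<open>- g + k\<close> with \<open>g\<close> in the support.\<close>
    define L where "L = {l \<in> (\<lambda>(g, k). - g + k) ` (fsupp F \<times> K). l \<in> ?I}"
    have L: "finite L" "L \<subseteq> ?I"
      unfolding L_def using fin K by auto
    have "reg_rep D \<theta> x F \<xi> k = (\<Sum>l\<in>L. reg_matrix \<theta> x F k l * \<xi> l)" if "k \<in> K" for k
    proof (rule reg_rep_matrix[OF fin _ L])
      fix l assume l: "l \<in> ?I" "k - l \<in> fsupp F"
      have "l = - (k - l) + k"
        by (simp add: minus_diff_eq)
      then show "l \<in> L"
        unfolding L_def using l that by (auto intro!: image_eqI[of _ _ "(k - l, k)"])
    qed (use that K in auto)
    then have "L2_set (\<lambda>k. cmod (reg_rep D \<theta> x F \<xi> k)) K = L2_set (\<lambda>k. cmod (\<Sum>l\<in>L. reg_matrix \<theta> x F k l * \<xi> l)) K"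
      by (intro L2_set_cong) auto
    also have "\<dots> \<le> C * L2_set (\<lambda>l. cmod (\<xi> l)) L"
      by (rule mat_bounded_vector[OF M K(1) L(1) K(2) L(2) assms(3)])
    also have "\<dots> \<le> C * l2_norm ?I \<xi>"
      by (rule mult_left_mono[OF l2_finite_bound[OF \<xi> L] assms(3)])
    finally show ?thesis .
  qed
  have "0 \<le> C * l2_norm ?I \<xi>"
    using le[of "{}"] by simp
  then show "reg_rep D \<theta> x F \<xi> \<in> l2 ?I" "l2_norm ?I (reg_rep D \<theta> x F \<xi>) \<le> C * l2_norm ?I \<xi>"
    using l2_norm_le[OF _ le] by (auto simp: reg_rep_def)
qed

text \<open>The bound \<open>C\<close> guarantees that the supremum in \<open>operator_norm\<close>
  is over a bounded set. The two conclusions together say that the operator norm is the least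
  nonnegative bound for the matrix.\<close>

lemma operator_norm_mat_bounded:
  assumes fin: "finite (fsupp F)" and M: "mat_bounded (orbit_index D x) (reg_matrix \<theta> x F) C" and C: "0 \<le> C"
  shows "operator_norm (orbit_index D x) (reg_rep D \<theta> x F) \<le> C"
    and "mat_bounded (orbit_index D x) (reg_matrix \<theta> x F) (operator_norm (orbit_index D x) (reg_rep D \<theta> x F))"
proof -
  let ?I = "orbit_index D x" and ?T = "reg_rep D \<theta> x F"
  let ?ball = "{\<xi> \<in> l2 ?I. l2_norm ?I \<xi> \<le> 1}"
  have le: "l2_norm ?I (?T \<xi>) \<le> C" if "\<xi> \<in> ?ball" for \<xi>
  proof -
    have "l2_norm ?I (?T \<xi>) \<le> C * l2_norm ?I \<xi>"
      using reg_rep_l2(2)[OF fin M C] that by blast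
    also have "\<dots> \<le> C * 1"
      using that C by (intro mult_left_mono) auto
    finally show ?thesis
      by simp
  qed
  have "(\<lambda>_. 0) \<in> ?ball"
    by (simp add: l2_def l2_norm_def)
  then have "?ball \<noteq> {}"
    by blast
  then show "operator_norm ?I ?T \<le> C"
    unfolding operator_norm_def by (rule cSUP_least) (rule le)
  have op: "l2_norm ?I (?T \<xi>) \<le> operator_norm ?I ?T" if "\<xi> \<in> ?ball" for \<xi>
    unfolding operator_norm_def using that le by (intro cSUP_upper bdd_aboveI2) auto
  show "mat_bounded ?I (reg_matrix \<theta> x F) (operator_norm ?I ?T)"
  proof (rule mat_boundedI_vector)
    fix K L :: "'a set" and \<xi> :: "'a \<Rightarrow> complex"
    assume KL: "finite K" "finite L" "K \<subseteq> ?I" "L \<subseteq> ?I"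
    let ?s = "L2_set (\<lambda>l. cmod (\<xi> l)) L"
    show "L2_set (\<lambda>k. cmod (\<Sum>l\<in>L. reg_matrix \<theta> x F k l * \<xi> l)) K \<le> operator_norm ?I ?T * ?s"
    proof (cases "?s = 0")
      case True
      then have "\<xi> l = 0" if "l \<in> L" for l
        using that KL(2) L2_set_eq_0_iff by fastforce
      then show ?thesis
        using True by (simp add: L2_set_def)
    next
      case False
      then have s: "0 < ?s"
        by (simp add: L2_set_nonneg order_less_le)
      \<comment> \<open>The finite section of \<open>\<xi>\<close>, normalised and extended by 0,
        lies in the unit ball over which the supremum is taken.\<close>
      define \<zeta> where "\<zeta> = (\<lambda>l. if l \<in> L then \<xi> l / of_real ?s else 0)"
      have norm: "L2_set (\<lambda>l. cmod (\<zeta> l)) J \<le> 1" if J: "finite J" "J \<subseteq> ?I" for J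
      proof -
        have "(\<Sum>l\<in>J. (cmod (\<zeta> l))\<^sup>2) \<le> (\<Sum>l\<in>J \<union> L. (cmod (\<zeta> l))\<^sup>2)"
          using J KL by (intro sum_mono2) auto
        also have "\<dots> = (\<Sum>l\<in>L. (cmod (\<zeta> l))\<^sup>2)"
          using J KL by (intro sum.mono_neutral_right) (auto simp: \<zeta>_def)
        also have "\<dots> = (\<Sum>l\<in>L. (cmod (\<xi> l))\<^sup>2 / ?s\<^sup>2)"
          using s by (intro sum.cong) (auto simp: \<zeta>_def norm_divide power_divide)
        also have "\<dots> = ?s\<^sup>2 / ?s\<^sup>2"
          unfolding L2_set_cmod_square sum_divide_distrib ..
        also have "\<dots> = 1"
          using s by simp
        finally show ?thesis
          by (simp add: L2_set_def)
      qed
      have van: "\<zeta> i = 0" if "i \<notin> ?I" for i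
        using that KL(4) by (auto simp: \<zeta>_def)
      have \<zeta>: "\<zeta> \<in> l2 ?I" "l2_norm ?I \<zeta> \<le> 1"
        by (rule l2_norm_le[OF van norm zero_le_one]; assumption)+
      have T\<zeta>: "?T \<zeta> k = (\<Sum>l\<in>L. reg_matrix \<theta> x F k l * \<xi> l) / of_real ?s" if "k \<in> K" for k
      proof -
        have "?T \<zeta> k = (\<Sum>l\<in>L. reg_matrix \<theta> x F k l * \<zeta> l)"
          using that KL by (intro reg_rep_matrix[OF fin]) (auto simp: \<zeta>_def split: if_splits)
        also have "\<dots> = (\<Sum>l\<in>L. reg_matrix \<theta> x F k l * \<xi> l / of_real ?s)"
          by (intro sum.cong) (auto simp: \<zeta>_def)
        finally show ?thesis
          by (simp flip: sum_divide_distrib)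
      qed
      have "L2_set (\<lambda>k. cmod (\<Sum>l\<in>L. reg_matrix \<theta> x F k l * \<xi> l)) K = L2_set (\<lambda>k. ?s * cmod (?T \<zeta> k)) K"
        using s by (intro L2_set_cong refl) (simp add: T\<zeta> norm_divide)
      also have "\<dots> = ?s * L2_set (\<lambda>k. cmod (?T \<zeta> k)) K"
        using s by (simp add: L2_set_right_distrib)
      also have "\<dots> \<le> ?s * l2_norm ?I (?T \<zeta>)"
        using s KL by (intro mult_left_mono l2_finite_bound reg_rep_l2(1)[OF fin M C \<zeta>(1)]) auto
      also have "\<dots> \<le> ?s * operator_norm ?I ?T"
        using op[of \<zeta>] \<zeta> s by (intro mult_left_mono) auto
      finally show ?thesis
        by (simp add: mult.commute)
    qed
  qed
qed

lemma reduced_norm_mat_bounded: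
  assumes fin: "finite (fsupp F)"
    and M: "\<And>x. x \<in> topspace X \<Longrightarrow> mat_bounded (orbit_index D x) (reg_matrix \<theta> x F) C" and C: "0 \<le> C"
  shows "reduced_norm X D \<theta> F \<le> C" "0 \<le> reduced_norm X D \<theta> F"
    and "x \<in> topspace X \<Longrightarrow> mat_bounded (orbit_index D x) (reg_matrix \<theta> x F) (reduced_norm X D \<theta> F)"
proof -
  let ?S = "insert 0 ((\<lambda>x. operator_norm (orbit_index D x) (reg_rep D \<theta> x F)) ` topspace X)"
  have le: "y \<le> C" if "y \<in> ?S" for y
    using that C operator_norm_mat_bounded(1)[OF fin M C] by auto
  then have bdd: "bdd_above ?S"
    by (rule bdd_aboveI)
  show "reduced_norm X D \<theta> F \<le> C"
    unfolding reduced_norm_def by (rule cSup_least) (use le in auto)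
  show "0 \<le> reduced_norm X D \<theta> F"
    unfolding reduced_norm_def by (rule cSup_upper[OF _ bdd]) simp
  assume x: "x \<in> topspace X"
  have "operator_norm (orbit_index D x) (reg_rep D \<theta> x F) \<le> reduced_norm X D \<theta> F"
    unfolding reduced_norm_def by (rule cSup_upper[OF _ bdd]) (use x in simp)
  with operator_norm_mat_bounded(2)[OF fin M[OF x] C]
  show "mat_bounded (orbit_index D x) (reg_matrix \<theta> x F) (reduced_norm X D \<theta> F)"
    by (rule mat_bounded_mono)
qed

section \<open>Completions and extension of isometric isomorphisms\<close>

text \<open>The records carry no algebra laws, so the estimates are assumed for distances, in the
  form in which Cauchy sequences use them. The two terms of \<open>dist_mult\<close> reflect
  \<open>u u' - v v' = (u - v) u' + v (u' - v')\<close>.\<close>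

locale normed_star_algebra =
  fixes A :: "(complex, 'a, 'm) star_alg_scheme" and N :: "'a \<Rightarrow> real"
  assumes add_in: "u \<in> acarrier A \<Longrightarrow> v \<in> acarrier A \<Longrightarrow> aadd A u v \<in> acarrier A"
    and mult_in: "u \<in> acarrier A \<Longrightarrow> v \<in> acarrier A \<Longrightarrow> amult A u v \<in> acarrier A"
    and smult_in: "u \<in> acarrier A \<Longrightarrow> asmult A r u \<in> acarrier A"
    and star_in: "u \<in> acarrier A \<Longrightarrow> astar A u \<in> acarrier A"
    and dist_self: "u \<in> acarrier A \<Longrightarrow> adist A N u u = 0"
    and dist_sym: "u \<in> acarrier A \<Longrightarrow> v \<in> acarrier A \<Longrightarrow> adist A N u v = adist A N v u"
    and dist_triangle: "u \<in> acarrier A \<Longrightarrow> v \<in> acarrier A \<Longrightarrow> w \<in> acarrier A \<Longrightarrow>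
      adist A N u w \<le> adist A N u v + adist A N v w"
    and dist_add: "u \<in> acarrier A \<Longrightarrow> v \<in> acarrier A \<Longrightarrow> u' \<in> acarrier A \<Longrightarrow> v' \<in> acarrier A \<Longrightarrow>
      adist A N (aadd A u u') (aadd A v v') \<le> adist A N u v + adist A N u' v'"
    and dist_smult: "u \<in> acarrier A \<Longrightarrow> v \<in> acarrier A \<Longrightarrow>
      adist A N (asmult A r u) (asmult A r v) \<le> cmod r * adist A N u v"
    and dist_mult: "u \<in> acarrier A \<Longrightarrow> v \<in> acarrier A \<Longrightarrow> u' \<in> acarrier A \<Longrightarrow> v' \<in> acarrier A \<Longrightarrow>
      adist A N (amult A u u') (amult A v v') \<le> adist A N u v * N u' + N v * adist A N u' v'"
    and dist_star: "u \<in> acarrier A \<Longrightarrow> v \<in> acarrier A \<Longrightarrow> adist A N (astar A u) (astar A v) \<le> adist A N u v"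
    and norm_dist: "u \<in> acarrier A \<Longrightarrow> v \<in> acarrier A \<Longrightarrow> N u \<le> N v + adist A N u v"
    and norm_nonneg: "u \<in> acarrier A \<Longrightarrow> 0 \<le> N u"
begin

abbreviation d where "d \<equiv> adist A N"
abbreviation Cau where "Cau \<equiv> cauchy_seqs A N"

lemma dist_nonneg: "u \<in> acarrier A \<Longrightarrow> v \<in> acarrier A \<Longrightarrow> 0 \<le> d u v"
  using dist_triangle[of u v u] dist_sym[of u v] dist_self[of u] by simp

lemma CauD: "s \<in> Cau \<Longrightarrow> s n \<in> acarrier A"
  by (simp add: cauchy_seqs_def)

lemma CauE:
  assumes "s \<in> Cau" "0 < \<epsilon>"
  obtains M where "\<And>m n. m \<ge> M \<Longrightarrow> n \<ge> M \<Longrightarrow> d (s m) (s n) < \<epsilon>"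
proof -
  have "\<exists>M. \<forall>m\<ge>M. \<forall>n\<ge>M. d (s m) (s n) < \<epsilon>"
    using assms by (simp add: cauchy_seqs_def)
  then show ?thesis
    using that by blast
qed

lemma Cau_bounded:
  assumes "s \<in> Cau"
  obtains B where "\<And>n. N (s n) \<le> B" "0 \<le> B"
proof -
  obtain M where M: "\<And>m n. m \<ge> M \<Longrightarrow> n \<ge> M \<Longrightarrow> d (s m) (s n) < 1"
    using CauE[OF assms zero_less_one] by metis
  have le: "N (s n) \<le> Max ((\<lambda>n. N (s n)) ` {..M}) + 1" for n
  proof (cases "n \<le> M")
    case True
    then have "N (s n) \<le> Max ((\<lambda>n. N (s n)) ` {..M})"
      by (intro Max_ge) auto
    then show ?thesis
      by simp
  next
    case False
    have "N (s n) \<le> N (s M) + d (s n) (s M)"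
      by (rule norm_dist[OF CauD[OF assms] CauD[OF assms]])
    moreover have "N (s M) \<le> Max ((\<lambda>n. N (s n)) ` {..M})"
      by (intro Max_ge) auto
    moreover have "d (s n) (s M) < 1"
      using M[of n M] False by simp
    ultimately show ?thesis
      by linarith
  qed
  from le norm_nonneg[OF CauD[OF assms]] have "0 \<le> Max ((\<lambda>n. N (s n)) ` {..M}) + 1"
    by (rule order_trans[rotated])
  then show ?thesis
    using that le by blast
qed

lemma CauI:
  assumes "\<And>n. s n \<in> acarrier A"
    and "\<And>\<epsilon>. 0 < \<epsilon> \<Longrightarrow> \<exists>M. \<forall>m\<ge>M. \<forall>n\<ge>M. d (s m) (s n) < \<epsilon>"
  shows "s \<in> Cau"
  using assms by (simp add: cauchy_seqs_def)

lemma Cau_const: "u \<in> acarrier A \<Longrightarrow> (\<lambda>_. u) \<in> Cau"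
  by (rule CauI) (auto simp: dist_self)

lemma Cau_near:
  assumes s: "s \<in> Cau" and t: "\<And>n. t n \<in> acarrier A" and lim: "(\<lambda>n. d (s n) (t n)) \<longlonglongrightarrow> 0"
  shows "t \<in> Cau"
proof (rule CauI[OF t])
  fix \<epsilon> :: real assume e: "0 < \<epsilon>"
  then have "0 < \<epsilon> / 3"
    by simp
  then obtain M where M: "\<And>m n. m \<ge> M \<Longrightarrow> n \<ge> M \<Longrightarrow> d (s m) (s n) < \<epsilon> / 3"
    using CauE[OF s] by metis
  have "\<forall>\<^sub>F n in sequentially. d (s n) (t n) < \<epsilon> / 3"
    by (rule order_tendstoD(2)[OF lim]) (use e in simp)
  then obtain M' where M': "\<And>n. n \<ge> M' \<Longrightarrow> d (s n) (t n) < \<epsilon> / 3"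
    by (auto simp: eventually_sequentially)
  have "d (t m) (t n) < \<epsilon>" if "m \<ge> max M M'" "n \<ge> max M M'" for m n
  proof -
    have "d (t m) (t n) \<le> d (t m) (s m) + d (s m) (t n)"
      by (intro dist_triangle t CauD[OF s])
    also have "d (s m) (t n) \<le> d (s m) (s n) + d (s n) (t n)"
      by (intro dist_triangle t CauD[OF s])
    finally show ?thesis
      using M[of m n] M'[of m] M'[of n] that dist_sym[OF t CauD[OF s], of m m] by simp
  qed
  then show "\<exists>M. \<forall>m\<ge>M. \<forall>n\<ge>M. d (t m) (t n) < \<epsilon>"
    by blast
qed

lemma null_rel_equiv: "equiv Cau (null_rel A N)"
proof (rule equivI)
  show "null_rel A N \<subseteq> Cau \<times> Cau"
    by (auto simp: null_rel_def)
  show "refl_on Cau (null_rel A N)"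
    by (rule refl_onI) (auto simp: null_rel_def dist_self CauD)
  show "sym (null_rel A N)"
  proof (rule symI)
    fix s t assume st: "(s, t) \<in> null_rel A N"
    then have "(\<lambda>n. d (t n) (s n)) = (\<lambda>n. d (s n) (t n))"
      by (intro ext dist_sym) (auto simp: null_rel_def CauD)
    then show "(t, s) \<in> null_rel A N"
      using st by (simp add: null_rel_def)
  qed
  show "trans (null_rel A N)"
  proof (rule transI)
    fix s t w assume st: "(s, t) \<in> null_rel A N" "(t, w) \<in> null_rel A N"
    then have c: "s \<in> Cau" "t \<in> Cau" "w \<in> Cau"
      by (auto simp: null_rel_def)
    have "(\<lambda>n. d (s n) (t n) + d (t n) (w n)) \<longlonglongrightarrow> 0"
      using st by (intro tendsto_add_zero) (auto simp: null_rel_def)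
    then have "(\<lambda>n. d (s n) (w n)) \<longlonglongrightarrow> 0"
    proof (rule tendsto_sandwich[rotated 3])
      show "\<forall>\<^sub>F n in sequentially. 0 \<le> d (s n) (w n)"
        by (intro always_eventually allI dist_nonneg CauD c)
      show "\<forall>\<^sub>F n in sequentially. d (s n) (w n) \<le> d (s n) (t n) + d (t n) (w n)"
        by (intro always_eventually allI dist_triangle CauD c)
    qed simp
    then show "(s, w) \<in> null_rel A N"
      using c by (simp add: null_rel_def)
  qed
qed

abbreviation cls where "cls s \<equiv> null_rel A N `` {s}"

lemma cls_eq_iff: "s \<in> Cau \<Longrightarrow> t \<in> Cau \<Longrightarrow> cls s = cls t \<longleftrightarrow> (\<lambda>n. d (s n) (t n)) \<longlonglongrightarrow> 0"
  using eq_equiv_class_iff[OF null_rel_equiv] by (auto simp: null_rel_def)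

lemma cls_mem: "s \<in> Cau \<Longrightarrow> t \<in> cls s \<longleftrightarrow> t \<in> Cau \<and> (\<lambda>n. d (s n) (t n)) \<longlonglongrightarrow> 0"
  by (auto simp: null_rel_def)

lemma cls_in: "s \<in> Cau \<Longrightarrow> cls s \<in> acarrier (completion A N)"
  by (simp add: completion_def quotientI)

lemma completion_cases:
  assumes "S \<in> acarrier (completion A N)"
  obtains s where "s \<in> Cau" "S = cls s"
  using assms by (auto simp: completion_def elim: quotientE)

text \<open>The weights \<open>p\<close> and \<open>q\<close> are constants for addition, scalar multiplication and the involution, and
  norms for the product. A unary operation is a binary one that ignores its second argument.\<close>

lemma Cau_binary:
  assumes op: "\<And>u v. u \<in> acarrier A \<Longrightarrow> v \<in> acarrier A \<Longrightarrow> f u v \<in> acarrier A"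
    and le: "\<And>u v u' v'. u \<in> acarrier A \<Longrightarrow> v \<in> acarrier A \<Longrightarrow> u' \<in> acarrier A \<Longrightarrow> v' \<in> acarrier A \<Longrightarrow>
      d (f u u') (f v v') \<le> d u v * p u' + q v * d u' v'"
    and p: "\<And>t. t \<in> Cau \<Longrightarrow> \<exists>B. \<forall>n. p (t n) \<le> B" and q: "\<And>s. s \<in> Cau \<Longrightarrow> \<exists>B. \<forall>n. q (s n) \<le> B"
    and s: "s \<in> Cau" and t: "t \<in> Cau"
  shows "(\<lambda>n. f (s n) (t n)) \<in> Cau"
    and "s' \<in> cls s \<Longrightarrow> t' \<in> cls t \<Longrightarrow> cls (\<lambda>n. f (s' n) (t' n)) = cls (\<lambda>n. f (s n) (t n))"
proof -
  have cau: "(\<lambda>n. f (s n) (t n)) \<in> Cau" if s: "s \<in> Cau" and t: "t \<in> Cau" for s t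
  proof (rule CauI)
    fix \<epsilon> :: real assume e: "0 < \<epsilon>"
    obtain P where P: "\<forall>n. p (t n) \<le> P"
      using p[OF t] by (elim exE) (rule that)
    obtain Q where Q: "\<forall>n. q (s n) \<le> Q"
      using q[OF s] by (elim exE) (rule that)
    \<comment> \<open>The maximum with 1 makes \<open>B\<close> positive, so that it can be divided
      by.\<close>
    define B where "B = max 1 (max P Q)"
    have B: "0 < B" "\<And>n. p (t n) \<le> B" "\<And>n. q (s n) \<le> B"
      unfolding B_def using P[rule_format] Q[rule_format] by (simp_all add: le_max_iff_disj)
    then have e': "0 < \<epsilon> / (2 * B)"
      using e by simp
    obtain M where M: "\<And>m n. m \<ge> M \<Longrightarrow> n \<ge> M \<Longrightarrow> d (s m) (s n) < \<epsilon> / (2 * B)"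
      using CauE[OF s e'] by metis
    obtain M' where M': "\<And>m n. m \<ge> M' \<Longrightarrow> n \<ge> M' \<Longrightarrow> d (t m) (t n) < \<epsilon> / (2 * B)"
      using CauE[OF t e'] by metis
    have "d (f (s m) (t m)) (f (s n) (t n)) < \<epsilon>" if "m \<ge> max M M'" "n \<ge> max M M'" for m n
    proof -
      have "d (f (s m) (t m)) (f (s n) (t n)) \<le> d (s m) (s n) * p (t m) + q (s n) * d (t m) (t n)"
        by (intro le CauD[OF s] CauD[OF t])
      also have "\<dots> \<le> d (s m) (s n) * B + B * d (t m) (t n)"
        by (intro add_mono mult_left_mono mult_right_mono B dist_nonneg CauD[OF s] CauD[OF t])
      also have "\<dots> < \<epsilon> / (2 * B) * B + B * (\<epsilon> / (2 * B))"
        using M[of m n] M'[of m n] B(1) that by (intro add_strict_mono mult_strict_left_mono mult_strict_right_mono) auto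
      also have "\<dots> = \<epsilon>"
        using B(1) by simp
      finally show ?thesis .
    qed
    then show "\<exists>M. \<forall>m\<ge>M. \<forall>n\<ge>M. d (f (s m) (t m)) (f (s n) (t n)) < \<epsilon>"
      by blast
  qed (use op CauD s t in blast)
  show "(\<lambda>n. f (s n) (t n)) \<in> Cau"
    by (rule cau[OF s t])
  assume "s' \<in> cls s" "t' \<in> cls t"
  then have st': "s' \<in> Cau" "t' \<in> Cau" and lim: "(\<lambda>n. d (s n) (s' n)) \<longlonglongrightarrow> 0" "(\<lambda>n. d (t n) (t' n)) \<longlonglongrightarrow> 0"
    using cls_mem s t by auto
  obtain P where P: "\<forall>n. p (t n) \<le> P"
    using p[OF t] by (elim exE) (rule that)
  obtain Q where Q: "\<forall>n. q (s' n) \<le> Q"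
    using q[OF st'(1)] by (elim exE) (rule that)
  have "(\<lambda>n. d (s n) (s' n) * P + Q * d (t n) (t' n)) \<longlonglongrightarrow> 0 * P + Q * 0"
    by (intro tendsto_intros lim)
  then have "(\<lambda>n. d (s n) (s' n) * P + Q * d (t n) (t' n)) \<longlonglongrightarrow> 0"
    by simp
  then have "(\<lambda>n. d (f (s n) (t n)) (f (s' n) (t' n))) \<longlonglongrightarrow> 0"
  proof (rule tendsto_sandwich[rotated 3])
    show "\<forall>\<^sub>F n in sequentially. 0 \<le> d (f (s n) (t n)) (f (s' n) (t' n))"
      by (intro always_eventually allI dist_nonneg op CauD[OF s] CauD[OF t] CauD[OF st'(1)] CauD[OF st'(2)])
    have "d (f (s n) (t n)) (f (s' n) (t' n)) \<le> d (s n) (s' n) * P + Q * d (t n) (t' n)" for n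
    proof -
      have "d (f (s n) (t n)) (f (s' n) (t' n)) \<le> d (s n) (s' n) * p (t n) + q (s' n) * d (t n) (t' n)"
        by (intro le CauD[OF s] CauD[OF t] CauD[OF st'(1)] CauD[OF st'(2)])
      also have "\<dots> \<le> d (s n) (s' n) * P + Q * d (t n) (t' n)"
        using P Q by (intro add_mono mult_left_mono mult_right_mono dist_nonneg
            CauD[OF s] CauD[OF t] CauD[OF st'(1)] CauD[OF st'(2)]) auto
      finally show ?thesis .
    qed
    then show "\<forall>\<^sub>F n in sequentially. d (f (s n) (t n)) (f (s' n) (t' n)) \<le> d (s n) (s' n) * P + Q * d (t n) (t' n)"
      by (intro always_eventually allI)
  qed simp_all
  then show "cls (\<lambda>n. f (s' n) (t' n)) = cls (\<lambda>n. f (s n) (t n))"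
    using cls_eq_iff[OF cau[OF s t] cau[OF st']] by simp
qed

lemma self_in_cls: "s \<in> Cau \<Longrightarrow> s \<in> cls s"
  using equiv_class_self[OF null_rel_equiv] .

text \<open>The operation on classes is a union over all pairs of representatives. All of them yield
  the same class, and there is at least one pair, so the union is that class.\<close>

lemma completion_add:
  assumes s: "s \<in> Cau" and t: "t \<in> Cau"
  shows "(\<lambda>n. aadd A (s n) (t n)) \<in> Cau"
    and "aadd (completion A N) (cls s) (cls t) = cls (\<lambda>n. aadd A (s n) (t n))"
proof -
  have b: "\<exists>B. \<forall>n::nat. (1::real) \<le> B"
    by blast
  note * = Cau_binary[of "aadd A" "\<lambda>_. 1" "\<lambda>_. 1" s t, OF add_in _ b b s t, simplified, OF dist_add]
  show "(\<lambda>n. aadd A (s n) (t n)) \<in> Cau"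
    by (rule *(1))
  have "(\<Union>s'\<in>cls s. \<Union>t'\<in>cls t. cls (\<lambda>n. aadd A (s' n) (t' n))) = cls (\<lambda>n. aadd A (s n) (t n))"
    using self_in_cls[OF s] self_in_cls[OF t] *(2) by (intro equalityI subsetI) blast+
  then show "aadd (completion A N) (cls s) (cls t) = cls (\<lambda>n. aadd A (s n) (t n))"
    by (simp add: completion_def)
qed

lemma completion_mult:
  assumes s: "s \<in> Cau" and t: "t \<in> Cau"
  shows "(\<lambda>n. amult A (s n) (t n)) \<in> Cau"
    and "amult (completion A N) (cls s) (cls t) = cls (\<lambda>n. amult A (s n) (t n))"
proof -
  have b: "\<exists>B. \<forall>n. N (s n) \<le> B" if "s \<in> Cau" for s
    using Cau_bounded[OF that] by metis
  note * = Cau_binary[of "amult A" N N s t, OF mult_in dist_mult b b s t]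
  show "(\<lambda>n. amult A (s n) (t n)) \<in> Cau"
    by (rule *(1))
  have "(\<Union>s'\<in>cls s. \<Union>t'\<in>cls t. cls (\<lambda>n. amult A (s' n) (t' n))) = cls (\<lambda>n. amult A (s n) (t n))"
    using self_in_cls[OF s] self_in_cls[OF t] *(2) by (intro equalityI subsetI) blast+
  then show "amult (completion A N) (cls s) (cls t) = cls (\<lambda>n. amult A (s n) (t n))"
    by (simp add: completion_def)
qed

lemma completion_smult:
  assumes s: "s \<in> Cau"
  shows "(\<lambda>n. asmult A r (s n)) \<in> Cau"
    and "asmult (completion A N) r (cls s) = cls (\<lambda>n. asmult A r (s n))"
proof -
  have b: "\<exists>B. \<forall>n::nat. (c::real) \<le> B" for c
    by blast
  have le: "d (asmult A r u) (asmult A r v) \<le> d u v * cmod r + 0 * d u' v'"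
    if "u \<in> acarrier A" "v \<in> acarrier A" for u v u' v'
    using dist_smult[OF that] by (simp add: mult.commute)
  note * = Cau_binary[of "\<lambda>u v. asmult A r u" "\<lambda>_. cmod r" "\<lambda>_. 0" s s, OF smult_in le b b s s]
  show "(\<lambda>n. asmult A r (s n)) \<in> Cau"
    by (rule *(1))
  have "(\<Union>s'\<in>cls s. cls (\<lambda>n. asmult A r (s' n))) = cls (\<lambda>n. asmult A r (s n))"
    using self_in_cls[OF s] *(2) by (intro equalityI subsetI) blast+
  then show "asmult (completion A N) r (cls s) = cls (\<lambda>n. asmult A r (s n))"
    by (simp add: completion_def)
qed

lemma completion_star:
  assumes s: "s \<in> Cau"
  shows "(\<lambda>n. astar A (s n)) \<in> Cau"
    and "astar (completion A N) (cls s) = cls (\<lambda>n. astar A (s n))"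
proof -
  have b: "\<exists>B. \<forall>n::nat. (c::real) \<le> B" for c
    by blast
  have le: "d (astar A u) (astar A v) \<le> d u v * 1 + 0 * d u' v'"
    if "u \<in> acarrier A" "v \<in> acarrier A" for u v u' v'
    using dist_star[OF that] by simp
  note * = Cau_binary[of "\<lambda>u v. astar A u" "\<lambda>_. 1" "\<lambda>_. 0" s s, OF star_in le b b s s]
  show "(\<lambda>n. astar A (s n)) \<in> Cau"
    by (rule *(1))
  have "(\<Union>s'\<in>cls s. cls (\<lambda>n. astar A (s' n))) = cls (\<lambda>n. astar A (s n))"
    using self_in_cls[OF s] *(2) by (intro equalityI subsetI) blast+
  then show "astar (completion A N) (cls s) = cls (\<lambda>n. astar A (s n))"
    by (simp add: completion_def)
qed

definition dense :: "'a set \<Rightarrow> bool" where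
  "dense A0 \<longleftrightarrow> A0 \<subseteq> acarrier A \<and> (\<forall>u \<in> acarrier A. \<forall>\<epsilon>>0. \<exists>v\<in>A0. d u v < \<epsilon>)"

lemma dense_approximation:
  assumes "dense A0" "\<And>n. t n \<in> acarrier A"
  obtains s where "\<And>n. s n \<in> A0" "\<And>n. s n \<in> acarrier A" "(\<lambda>n. d (t n) (s n)) \<longlonglongrightarrow> 0"
proof -
  have "\<forall>n. \<exists>v\<in>A0. d (t n) v < inverse (real (Suc n))"
    using assms unfolding dense_def by simp
  then obtain s where s: "\<And>n. s n \<in> A0" "\<And>n. d (t n) (s n) < inverse (real (Suc n))"
    by metis
  have in_A: "s n \<in> acarrier A" for n
    using assms(1) s(1) unfolding dense_def by blast
  from LIMSEQ_inverse_real_of_nat have "(\<lambda>n. d (t n) (s n)) \<longlonglongrightarrow> 0"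
  proof (rule tendsto_sandwich[rotated 3])
    show "\<forall>\<^sub>F n in sequentially. 0 \<le> d (t n) (s n)"
      by (intro always_eventually allI dist_nonneg in_A assms(2))
    show "\<forall>\<^sub>F n in sequentially. d (t n) (s n) \<le> inverse (real (Suc n))"
      by (intro always_eventually allI less_imp_le s(2))
  qed simp
  with s(1) in_A show ?thesis
    by (rule that)
qed

text \<open>The terms of any representative are replaced by elements of \<open>A0\<close> at
  distance less than \<open>1/(n+1)\<close>, which changes neither the Cauchy property nor the
  class.\<close>

lemma dense_representative:
  assumes "dense A0" "S \<in> acarrier (completion A N)"
  obtains s where "s \<in> Cau" "\<And>n. s n \<in> A0" "S = cls s"
proof -
  obtain t where t: "t \<in> Cau" "S = cls t"
    using completion_cases[OF assms(2)] by metis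
  obtain s where s: "\<And>n. s n \<in> A0" "\<And>n. s n \<in> acarrier A" "(\<lambda>n. d (t n) (s n)) \<longlonglongrightarrow> 0"
    by (rule dense_approximation[OF assms(1), of t, OF CauD[OF t(1)]]) (rule that)
  have "s \<in> Cau"
    by (rule Cau_near[OF t(1) s(2,3)])
  moreover from this have "S = cls s"
    using cls_eq_iff[OF t(1)] s(3) t(2) by simp
  ultimately show ?thesis
    using s(1) by (intro that)
qed

end

section \<open>Extension of an isometric isomorphism between dense subalgebras\<close>

locale dense_isometry = A: normed_star_algebra A N + B: normed_star_algebra B N'
  for A :: "(complex, 'a, 'm) star_alg_scheme" and N and B :: "(complex, 'b, 'n) star_alg_scheme" and N' +
  fixes A0 :: "'a set" and B0 :: "'b set" and \<Psi> :: "'a \<Rightarrow> 'b"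
  assumes denseA: "A.dense A0" and denseB: "B.dense B0" and bij: "bij_betw \<Psi> A0 B0"
    and A0_closed: "u \<in> A0 \<Longrightarrow> v \<in> A0 \<Longrightarrow> aadd A u v \<in> A0" "u \<in> A0 \<Longrightarrow> v \<in> A0 \<Longrightarrow> amult A u v \<in> A0"
      "u \<in> A0 \<Longrightarrow> asmult A r u \<in> A0" "u \<in> A0 \<Longrightarrow> astar A u \<in> A0"
    and hom: "u \<in> A0 \<Longrightarrow> v \<in> A0 \<Longrightarrow> \<Psi> (aadd A u v) = aadd B (\<Psi> u) (\<Psi> v)"
      "u \<in> A0 \<Longrightarrow> v \<in> A0 \<Longrightarrow> \<Psi> (amult A u v) = amult B (\<Psi> u) (\<Psi> v)"
      "u \<in> A0 \<Longrightarrow> \<Psi> (asmult A r u) = asmult B r (\<Psi> u)" "u \<in> A0 \<Longrightarrow> \<Psi> (astar A u) = astar B (\<Psi> u)"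
    and isometric: "u \<in> A0 \<Longrightarrow> v \<in> A0 \<Longrightarrow> adist B N' (\<Psi> u) (\<Psi> v) = adist A N u v"
begin

lemma A0_carrier: "u \<in> A0 \<Longrightarrow> u \<in> acarrier A"
  using denseA unfolding A.dense_def by blast

lemma map_in: "u \<in> A0 \<Longrightarrow> \<Psi> u \<in> B0" "u \<in> A0 \<Longrightarrow> \<Psi> u \<in> acarrier B"
  using bij denseB unfolding B.dense_def by (auto dest: bij_betw_apply)

lemma Cau_map_iff: "(\<And>n. s n \<in> A0) \<Longrightarrow> (\<lambda>n. \<Psi> (s n)) \<in> B.Cau \<longleftrightarrow> s \<in> A.Cau"
  using isometric A0_carrier map_in by (simp add: cauchy_seqs_def)

lemma cls_map_eq_iff:
  assumes "\<And>n. s n \<in> A0" "\<And>n. t n \<in> A0" "s \<in> A.Cau" "t \<in> A.Cau"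
  shows "B.cls (\<lambda>n. \<Psi> (s n)) = B.cls (\<lambda>n. \<Psi> (t n)) \<longleftrightarrow> A.cls s = A.cls t"
  using A.cls_eq_iff[OF assms(3,4)] B.cls_eq_iff Cau_map_iff assms isometric by simp

text \<open>The homomorphism laws and the isometry are available on \<open>A0\<close> only, so the
  representative is picked among sequences in \<open>A0\<close>; by the isometry the resulting class
  does not depend on the pick.\<close>

definition extension where
  "extension S = B.cls (\<lambda>n. \<Psi> ((SOME s. s \<in> A.Cau \<and> (\<forall>n. s n \<in> A0) \<and> S = A.cls s) n))"

lemma extension_cls:
  assumes "s \<in> A.Cau" "\<And>n. s n \<in> A0"
  shows "extension (A.cls s) = B.cls (\<lambda>n. \<Psi> (s n))"
proof -
  define t where "t = (SOME t. t \<in> A.Cau \<and> (\<forall>n. t n \<in> A0) \<and> A.cls s = A.cls t)"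
  have "t \<in> A.Cau \<and> (\<forall>n. t n \<in> A0) \<and> A.cls s = A.cls t"
    unfolding t_def by (rule someI[of _ s]) (use assms in auto)
  then have "B.cls (\<lambda>n. \<Psi> (t n)) = B.cls (\<lambda>n. \<Psi> (s n))"
    using cls_map_eq_iff[of t s] assms by simp
  then show ?thesis
    unfolding extension_def t_def .
qed

lemma extension_iso: "star_alg_iso (completion A N) (completion B N') extension"
  unfolding star_alg_iso_def alg_iso_def
proof (intro conjI ballI allI)
  show "bij_betw extension (acarrier (completion A N)) (acarrier (completion B N'))"
  proof (rule bij_betw_imageI)
    show "inj_on extension (acarrier (completion A N))"
    proof (rule inj_onI)
      fix S T assume ST: "S \<in> acarrier (completion A N)" "T \<in> acarrier (completion A N)" "extension S = extension T"
      obtain s where s: "s \<in> A.Cau" "\<And>n. s n \<in> A0" "S = A.cls s"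
        by (rule A.dense_representative[OF denseA ST(1)]) (rule that)
      obtain t where t: "t \<in> A.Cau" "\<And>n. t n \<in> A0" "T = A.cls t"
        by (rule A.dense_representative[OF denseA ST(2)]) (rule that)
      show "S = T"
        using ST(3) cls_map_eq_iff[OF s(2) t(2) s(1) t(1)] extension_cls[OF s(1,2)] extension_cls[OF t(1,2)] s(3) t(3)
        by simp
    qed
    show "extension ` acarrier (completion A N) = acarrier (completion B N')"
    proof (intro equalityI subsetI)
      fix T assume "T \<in> extension ` acarrier (completion A N)"
      then obtain S where S: "S \<in> acarrier (completion A N)" "T = extension S"
        by blast
      obtain s where s: "s \<in> A.Cau" "\<And>n. s n \<in> A0" "S = A.cls s"
        by (rule A.dense_representative[OF denseA S(1)]) (rule that)
      show "T \<in> acarrier (completion B N')"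
        unfolding S(2) s(3) extension_cls[OF s(1,2)] using Cau_map_iff[OF s(2)] s(1) by (intro B.cls_in) simp
    next
      fix T assume "T \<in> acarrier (completion B N')"
      then obtain t where t: "t \<in> B.Cau" "\<And>n. t n \<in> B0" "T = B.cls t"
        by (rule B.dense_representative[OF denseB]) (rule that)
      define s where "s = (\<lambda>n. the_inv_into A0 \<Psi> (t n))"
      have s: "s n \<in> A0" "\<Psi> (s n) = t n" for n
        unfolding s_def using bij_betw_apply[OF bij_betw_the_inv_into[OF bij] t(2)]
          f_the_inv_into_f_bij_betw[OF bij] t(2) by auto
      then have "s \<in> A.Cau"
        using Cau_map_iff[of s] t(1) by simp
      then have "T = extension (A.cls s)"
        using extension_cls[of s] s t(3) by simp
      then show "T \<in> extension ` acarrier (completion A N)"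
        using A.cls_in[OF \<open>s \<in> A.Cau\<close>] by blast
    qed
  qed
next
  fix S T assume ST: "S \<in> acarrier (completion A N)" "T \<in> acarrier (completion A N)"
  obtain s where s: "s \<in> A.Cau" "\<And>n. s n \<in> A0" "S = A.cls s"
    by (rule A.dense_representative[OF denseA ST(1)]) (rule that)
  obtain t where t: "t \<in> A.Cau" "\<And>n. t n \<in> A0" "T = A.cls t"
    by (rule A.dense_representative[OF denseA ST(2)]) (rule that)
  have im: "(\<lambda>n. \<Psi> (s n)) \<in> B.Cau" "(\<lambda>n. \<Psi> (t n)) \<in> B.Cau"
    using Cau_map_iff s t by simp_all
  show "extension (aadd (completion A N) S T) = aadd (completion B N') (extension S) (extension T)"
    using A.completion_add[OF s(1) t(1)] B.completion_add(2)[OF im] extension_cls A0_closed(1) hom(1) s t by simp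
  show "extension (amult (completion A N) S T) = amult (completion B N') (extension S) (extension T)"
    using A.completion_mult[OF s(1) t(1)] B.completion_mult(2)[OF im] extension_cls A0_closed(2) hom(2) s t by simp
next
  fix S and r assume S: "S \<in> acarrier (completion A N)"
  obtain s where s: "s \<in> A.Cau" "\<And>n. s n \<in> A0" "S = A.cls s"
    by (rule A.dense_representative[OF denseA S]) (rule that)
  have im: "(\<lambda>n. \<Psi> (s n)) \<in> B.Cau"
    using Cau_map_iff s by simp
  show "extension (asmult (completion A N) r S) = asmult (completion B N') r (extension S)"
    using A.completion_smult[OF s(1)] B.completion_smult(2)[OF im] extension_cls A0_closed(3) hom(3) s by simp
next
  fix S assume S: "S \<in> acarrier (completion A N)"
  obtain s where s: "s \<in> A.Cau" "\<And>n. s n \<in> A0" "S = A.cls s"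
    by (rule A.dense_representative[OF denseA S]) (rule that)
  have im: "(\<lambda>n. \<Psi> (s n)) \<in> B.Cau"
    using Cau_map_iff s by simp
  show "extension (astar (completion A N) S) = astar (completion B N') (extension S)"
    using A.completion_star[OF s(1)] B.completion_star(2)[OF im] extension_cls A0_closed(4) hom(4) s by simp
qed

end

section \<open>The reduced crossed product\<close>

lemma C0_level: "f \<in> C0 X \<Longrightarrow> 0 < \<epsilon> \<Longrightarrow> compactin X {x \<in> topspace X. cmod (f x) \<ge> \<epsilon>}"
  by (simp add: C0_def)

lemma C0_dominated:
  assumes f: "f \<in> C0 X" and h: "continuous_map X euclidean h" "\<And>x. x \<notin> topspace X \<Longrightarrow> h x = 0"
    and le: "\<And>x. cmod (h x) \<le> B * cmod (f x)" and B: "0 < B"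
  shows "h \<in> C0 X"
proof -
  have "compactin X {x \<in> topspace X. cmod (h x) \<ge> \<epsilon>}" if "0 < \<epsilon>" for \<epsilon>
  proof (rule closed_compactin)
    show "compactin X {x \<in> topspace X. cmod (f x) \<ge> \<epsilon> / B}"
      using f that B by (simp add: C0_def)
    show "{x \<in> topspace X. cmod (h x) \<ge> \<epsilon>} \<subseteq> {x \<in> topspace X. cmod (f x) \<ge> \<epsilon> / B}"
    proof (intro subsetI CollectI conjI)
      fix x assume "x \<in> {x \<in> topspace X. cmod (h x) \<ge> \<epsilon>}"
      then have "\<epsilon> \<le> B * cmod (f x)"
        using le[of x] by simp
      then show "cmod (f x) \<ge> \<epsilon> / B"
        using B by (simp add: divide_le_eq mult.commute)
    qed simp
    have "closed {z. \<epsilon> \<le> cmod z}"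
      by (intro closed_Collect_le continuous_intros)
    then have "closedin X {x \<in> topspace X. h x \<in> {z. \<epsilon> \<le> cmod z}}"
      by (intro closedin_continuous_map_preimage[OF h(1)]) simp
    then show "closedin X {x \<in> topspace X. cmod (h x) \<ge> \<epsilon>}"
      by simp
  qed
  then show ?thesis
    using h by (simp add: C0_def)
qed

lemma C0_bounded:
  assumes "f \<in> C0 X"
  obtains B where "0 < B" "\<And>x. cmod (f x) \<le> B"
proof -
  have K: "compactin X {x \<in> topspace X. cmod (f x) \<ge> 1}" and c: "continuous_map X euclidean f"
    using assms by (simp_all add: C0_def)
  have "bounded (f ` {x \<in> topspace X. cmod (f x) \<ge> 1})"
    using image_compactin[OF K c] compact_imp_bounded by auto
  then obtain B where B: "\<And>x. x \<in> topspace X \<Longrightarrow> cmod (f x) \<ge> 1 \<Longrightarrow> cmod (f x) \<le> B"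
    unfolding bounded_iff by auto
  have "cmod (f x) \<le> max 1 B" for x
  proof (cases "x \<in> topspace X \<and> cmod (f x) \<ge> 1")
    case True
    then show ?thesis
      using B[of x] by simp
  next
    case False
    then show ?thesis
      using assms by (cases "x \<in> topspace X") (auto simp: C0_def)
  qed
  then show ?thesis
    using that[of "max 1 B"] by simp
qed

lemma C0_add:
  assumes "f \<in> C0 X" "f' \<in> C0 X"
  shows "(\<lambda>x. f x + f' x) \<in> C0 X"
proof -
  have c: "continuous_map X euclidean (\<lambda>x. f x + f' x)"
    using assms by (intro continuous_map_add) (auto simp: C0_def)
  have "compactin X {x \<in> topspace X. cmod (f x + f' x) \<ge> \<epsilon>}" if e: "0 < \<epsilon>" for \<epsilon>
  proof (rule closed_compactin)
    have "0 < \<epsilon> / 2"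
      using e by simp
    then show "compactin X ({x \<in> topspace X. cmod (f x) \<ge> \<epsilon> / 2} \<union> {x \<in> topspace X. cmod (f' x) \<ge> \<epsilon> / 2})"
      by (intro compactin_Un C0_level assms)
    show "{x \<in> topspace X. cmod (f x + f' x) \<ge> \<epsilon>} \<subseteq>
        {x \<in> topspace X. cmod (f x) \<ge> \<epsilon> / 2} \<union> {x \<in> topspace X. cmod (f' x) \<ge> \<epsilon> / 2}"
    proof
      fix x assume "x \<in> {x \<in> topspace X. cmod (f x + f' x) \<ge> \<epsilon>}"
      then show "x \<in> {x \<in> topspace X. cmod (f x) \<ge> \<epsilon> / 2} \<union> {x \<in> topspace X. cmod (f' x) \<ge> \<epsilon> / 2}"
        using norm_triangle_ineq[of "f x" "f' x"] by auto
    qed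
    have "closed {z. \<epsilon> \<le> cmod z}"
      by (intro closed_Collect_le continuous_intros)
    then have "closedin X {x \<in> topspace X. f x + f' x \<in> {z. \<epsilon> \<le> cmod z}}"
      by (intro closedin_continuous_map_preimage[OF c]) simp
    then show "closedin X {x \<in> topspace X. cmod (f x + f' x) \<ge> \<epsilon>}"
      by simp
  qed
  then show ?thesis
    using assms c by (simp add: C0_def)
qed

lemma continuous_map_complex_mult:
  assumes "continuous_map X euclidean f" "continuous_map X euclidean f'"
  shows "continuous_map X euclidean (\<lambda>x. f x * f' x :: complex)"
proof -
  have "continuous_map X euclidean (\<lambda>x. (f x, f' x))"
    using assms continuous_map_pairwise[of X euclidean euclidean "\<lambda>x. (f x, f' x)"] by (simp add: o_def)
  moreover have "continuous_map euclidean euclidean (\<lambda>p. fst p * snd p :: complex)"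
    by (auto intro!: continuous_intros)
  ultimately have "continuous_map X euclidean ((\<lambda>p. fst p * snd p) \<circ> (\<lambda>x. (f x, f' x)))"
    by (rule continuous_map_compose)
  then show ?thesis
    by (simp add: o_def)
qed

lemma continuous_map_clopen_extension:
  assumes "openin X U" "closedin X U" "continuous_map (subtopology X U) euclidean h"
    and "\<And>x. x \<notin> U \<Longrightarrow> h x = 0"
  shows "continuous_map X euclidean (h :: 'x \<Rightarrow> complex)"
  unfolding continuous_map_def
proof (intro conjI allI impI)
  fix V :: "complex set" assume "openin euclidean V"
  then have "openin (subtopology X U) {x \<in> topspace (subtopology X U). h x \<in> V}"
    by (rule openin_continuous_map_preimage[OF assms(3)])
  then have 1: "openin X {x \<in> topspace (subtopology X U). h x \<in> V}"
    using assms(1) openin_open_subtopology by blast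
  have "{x \<in> topspace X. h x \<in> V} = {x \<in> topspace (subtopology X U). h x \<in> V} \<union> (if 0 \<in> V then topspace X - U else {})"
    using assms(4) by (auto simp: topspace_subtopology) metis+
  moreover have "openin X (topspace X - U)"
    using assms(2) by (simp add: closedin_def)
  ultimately show "openin X {x \<in> topspace X. h x \<in> V}"
    using 1 by auto
qed simp

locale clopen_partial_action = stone_space X + partial_action X D \<theta>
  for X :: "'x topology" and D :: "'g::group_add \<Rightarrow> 'x set" and \<theta> :: "'g \<Rightarrow> 'x \<Rightarrow> 'x" +
  assumes clopen: "closedin X (D g)"
begin

text \<open>The composite with \<open>\<theta> (- g)\<close> is continuous on \<open>D g\<close>. As
  \<open>D g\<close> is clopen, the product extends continuously by 0, and as \<open>f'\<close> is
  bounded, the product is dominated by a multiple of \<open>f\<close>.\<close>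

lemma C0_mult_act:
  assumes f: "f \<in> C0 X" and f': "f' \<in> C0 X" and van: "\<And>x. x \<notin> D g \<Longrightarrow> f x = 0"
  shows "(\<lambda>x. f x * f' (\<theta> (- g) x)) \<in> C0 X"
proof -
  obtain B where B: "0 < B" "\<And>x. cmod (f' x) \<le> B"
    using C0_bounded[OF f'] by metis
  have "continuous_map (subtopology X (D g)) euclidean (f' \<circ> \<theta> (- g))"
  proof (rule continuous_map_compose)
    show "continuous_map (subtopology X (D g)) X (\<theta> (- g))"
      using homeo[of "- g"] continuous_map_in_subtopology unfolding homeomorphic_maps_def by auto
    show "continuous_map X euclidean f'"
      using f' by (simp add: C0_def)
  qed
  moreover have "continuous_map (subtopology X (D g)) euclidean f"
    using f by (simp add: C0_def continuous_map_from_subtopology)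
  ultimately have "continuous_map (subtopology X (D g)) euclidean (\<lambda>x. f x * f' (\<theta> (- g) x))"
    using continuous_map_complex_mult[of _ f "f' \<circ> \<theta> (- g)"] by (simp add: o_def)
  then have c: "continuous_map X euclidean (\<lambda>x. f x * f' (\<theta> (- g) x))"
    using van by (intro continuous_map_clopen_extension[OF open_dom clopen]) auto
  show ?thesis
  proof (rule C0_dominated[OF f c _ _ B(1)])
    show "f x * f' (\<theta> (- g) x) = 0" if "x \<notin> topspace X" for x
      using f that by (simp add: C0_def)
    show "cmod (f x * f' (\<theta> (- g) x)) \<le> B * cmod (f x)" for x
      using mult_right_mono[OF B(2)[of "\<theta> (- g) x"] norm_ge_zero[of "f x"]] by (simp add: norm_mult mult.commute)
  qed
qed

sublocale C0: coefficient_functions X D \<theta> "C0 X"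
proof
  show "(\<lambda>_. 0) \<in> C0 X"
    by (simp add: C0_def)
next
  fix f and r :: complex assume f: "f \<in> C0 X"
  have "continuous_map X euclidean (\<lambda>x. r * f x)"
    using f by (intro continuous_map_complex_mult) (auto simp: C0_def)
  then show "(\<lambda>x. r * f x) \<in> C0 X"
    by (rule C0_dominated[OF f, where B = "cmod r + 1"])
      (use f in \<open>auto simp: C0_def norm_mult mult_right_mono add_nonneg_pos\<close>)
qed (use C0_add C0_mult_act in auto)

sublocale Lc: coefficient_functions X D \<theta> "Lc X :: ('x \<Rightarrow> complex) set"
  by (rule Lc_coefficient_functions[OF clopen])

abbreviation CX where "CX \<equiv> crossed_product_C0 X D \<theta>"
abbreviation N where "N \<equiv> reduced_norm X D \<theta>"
abbreviation I where "I x \<equiv> orbit_index D x"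
abbreviation M where "M x \<equiv> reg_matrix \<theta> x"

lemma CX_simps [simp]:
  "acarrier CX = acarrier C0.A"
  "aadd CX = aadd C0.A" "amult CX = cp_mult D \<theta>" "asmult CX = asmult C0.A"
  "astar CX = (\<lambda>F k. pull D \<theta> k (\<lambda>x. cnj (F (- k) x)))"
  by (simp_all add: crossed_product_C0_def crossed_product_def alg.defs star_alg.defs)

lemma fsupp_monomial_finite: "finite (fsupp (monomial g f))"
  by (rule finite_subset[OF fsupp_monomial]) simp

lemma carrierD:
  assumes "F \<in> acarrier C0.A"
  shows "finite (fsupp F)" "F g \<in> C0 X" "x \<notin> D g \<Longrightarrow> F g x = 0"
  using assms by auto

text \<open>Multiplicativity of the regular representation: with \<open>j = - g + k\<close> the sum
  over \<open>g\<close> becomes a matrix product. If \<open>j\<close> is not in \<open>I x\<close>,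
  then \<open>\<theta> k x\<close> lies outside \<open>D g\<close> and the term is 0. The index set
  is formed from all of \<open>K\<close>, so that it does not depend on the row \<open>k\<close>, as
  \<open>mat_bounded_mult\<close> requires.\<close>

lemma reg_matrix_mult:
  assumes F: "finite S" "fsupp F \<subseteq> S" "\<And>g x. x \<notin> D g \<Longrightarrow> F g x = 0" and F': "finite (fsupp F')"
    and K: "K \<subseteq> I x" "k \<in> K" "finite K"
  shows "M x (cp_mult D \<theta> F F') k l =
    (\<Sum>j \<in> {j \<in> (\<lambda>(g, k). - g + k) ` (S \<times> K). j \<in> I x}. M x F k j * M x F' j l)"
proof -
  have k: "x \<in> D (- k)"
    using K by (auto simp: orbit_index_def)
  have [simp]: "k - (- g + k) = g" for g
    by (simp add: diff_conv_add_uminus minus_add del: add_uminus_conv_diff)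
  have zero: "F g (\<theta> k x) = 0" if "- g + k \<notin> I x" for g
  proof -
    have "\<theta> k x \<in> D (- (- g)) \<longleftrightarrow> x \<in> D (- (- g + k))"
      by (rule act_in_dom_iff[OF k])
    then show ?thesis
      using that F(3) by (simp add: orbit_index_def)
  qed
  have act: "\<theta> (- g) (\<theta> k x) = \<theta> (- g + k) x" if "- g + k \<in> I x" for g
    using act_act[OF k, of "- g"] that by (simp add: orbit_index_def)
  let ?J = "{j \<in> (\<lambda>(g, k). - g + k) ` (S \<times> K). j \<in> I x}"
  have "M x (cp_mult D \<theta> F F') k l = (\<Sum>g\<in>S. F g (\<theta> k x) * F' (- g + (k - l)) (\<theta> (- g) (\<theta> k x)))"
    unfolding reg_matrix_def by (rule cp_mult_apply_on[OF F(1,2) F' F(3)])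
  also have "\<dots> = (\<Sum>g\<in>{g \<in> S. - g + k \<in> I x}. F g (\<theta> k x) * F' (- g + (k - l)) (\<theta> (- g) (\<theta> k x)))"
    using F(1) zero by (intro sum.mono_neutral_right) auto
  also have "\<dots> = (\<Sum>j\<in>{j \<in> (\<lambda>g. - g + k) ` S. j \<in> I x}. M x F k j * M x F' j l)"
    by (rule sum.reindex_bij_witness[of _ "\<lambda>j. k - j" "\<lambda>g. - g + k"])
      (auto simp: reg_matrix_def act minus_diff_eq add_diff_eq)
  also have "\<dots> = (\<Sum>j\<in>?J. M x F k j * M x F' j l)"
  proof (rule sum.mono_neutral_left)
    show "finite ?J"
      using F(1) K(3) by simp
    show "{j \<in> (\<lambda>g. - g + k) ` S. j \<in> I x} \<subseteq> ?J"
      using K by force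
    show "\<forall>j \<in> ?J - {j \<in> (\<lambda>g. - g + k) ` S. j \<in> I x}. M x F k j * M x F' j l = 0"
    proof
      fix j assume j: "j \<in> ?J - {j \<in> (\<lambda>g. - g + k) ` S. j \<in> I x}"
      have "j = - (k - j) + k"
        by (simp add: minus_diff_eq)
      then have "k - j \<notin> S"
        using j by blast
      then show "M x F k j * M x F' j l = 0"
        using F(2) not_in_fsupp[of "k - j" F] by (auto simp: reg_matrix_def)
    qed
  qed
  finally show ?thesis .
qed

end

lemma mat_bounded_cong:
  assumes "\<And>k l. k \<in> I \<Longrightarrow> l \<in> I \<Longrightarrow> M k l = M' k l" "mat_bounded I M C"
  shows "mat_bounded I M' C"
  using mat_bounded_reindex[of id I I M M' C] assms by simp

context clopen_partial_action
begin

text \<open>The matrix is a sum of weighted partial permutations, one for each \<open>g\<close>,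
  sending the row \<open>k\<close> to the column \<open>- g + k\<close>. Hence the sum of the sup
  norms of the coefficients is a bound.\<close>

lemma mat_bounded_sup:
  assumes S: "finite S" "fsupp F \<subseteq> S" and c: "\<And>g x. g \<in> S \<Longrightarrow> cmod (F g x) \<le> c g" "\<And>g. g \<in> S \<Longrightarrow> 0 \<le> c g"
  shows "mat_bounded (I x) (M x F) (\<Sum>g\<in>S. c g)"
proof -
  have [simp]: "k - (- g + k) = g" "l = - g + k \<longleftrightarrow> g = k - l" for g k l :: 'g
    by (auto simp: diff_conv_add_uminus minus_add add.assoc[symmetric] simp del: add_uminus_conv_diff)
      (auto simp: diff_conv_add_uminus minus_add add.assoc simp del: add_uminus_conv_diff)
  have "mat_bounded (I x) (\<lambda>k l. \<Sum>g\<in>S. (if l = - g + k then F g (\<theta> k x) else 0)) (\<Sum>g\<in>S. c g)"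
    using S(1) c by (intro mat_bounded_sum mat_bounded_partial_permutation) (auto intro: inj_onI)
  moreover have "(\<Sum>g\<in>S. (if l = - g + k then F g (\<theta> k x) else 0)) = M x F k l" for k l
    using S not_in_fsupp[of "k - l" F] by (auto simp: reg_matrix_def)
  ultimately show ?thesis
    by simp
qed

lemma reduced_norm_bounded:
  assumes "F \<in> acarrier C0.A"
  obtains C where "0 \<le> C" "\<And>x. mat_bounded (I x) (M x F) C"
proof -
  have "\<forall>g. \<exists>B. 0 < B \<and> (\<forall>x. cmod (F g x) \<le> B)"
    using C0_bounded carrierD(2)[OF assms] by metis
  then obtain c where c: "\<And>g. 0 < c g" "\<And>g x. cmod (F g x) \<le> c g"
    by metis
  have "0 \<le> (\<Sum>g\<in>fsupp F. c g)"
    by (intro sum_nonneg less_imp_le c)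
  moreover have "mat_bounded (I x) (M x F) (\<Sum>g\<in>fsupp F. c g)" for x
    by (intro mat_bounded_sup carrierD(1)[OF assms] order_refl c(2) less_imp_le[OF c(1)])
  ultimately show ?thesis
    by (rule that)
qed

lemma norm_mat_bounded:
  assumes "F \<in> acarrier C0.A" "x \<in> topspace X"
  shows "mat_bounded (I x) (M x F) (N F)"
  by (rule reduced_norm_bounded[OF assms(1)])
    (rule reduced_norm_mat_bounded(3)[OF carrierD(1)[OF assms(1)]]; use assms(2) in blast)

lemma reduced_norm_nonneg:
  assumes "F \<in> acarrier C0.A"
  shows "0 \<le> N F"
  by (rule reduced_norm_bounded[OF assms])
    (rule reduced_norm_mat_bounded(2)[OF carrierD(1)[OF assms]]; blast)

lemma norm_leI:
  assumes "F \<in> acarrier C0.A" "0 \<le> C" "\<And>x. x \<in> topspace X \<Longrightarrow> mat_bounded (I x) (M x F) C"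
  shows "N F \<le> C"
  using reduced_norm_mat_bounded(1)[OF carrierD(1)[OF assms(1)]] assms(2,3) by blast

lemma norm_sup_le:
  assumes F: "F \<in> acarrier C0.A" and S: "finite S" "fsupp F \<subseteq> S"
    and c: "\<And>g x. g \<in> S \<Longrightarrow> cmod (F g x) \<le> c g" "\<And>g. g \<in> S \<Longrightarrow> 0 \<le> c g"
  shows "N F \<le> (\<Sum>g\<in>S. c g)"
  by (rule norm_leI[OF F sum_nonneg mat_bounded_sup[OF S c]]) (rule c(2))

text \<open>The value \<open>F g x\<close> is the matrix entry at \<open>(g, 0)\<close> for the base
  point \<open>\<theta> (- g) x\<close>. This uniform control of coefficients is what lets them pass
  to the completion.\<close>

lemma entry_le_norm:
  assumes F: "F \<in> acarrier C0.A"
  shows "cmod (F g x) \<le> N F"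
proof (cases "x \<in> D g")
  case True
  have dom: "\<theta> (- g) x \<in> D (- g)" "\<theta> (- g) x \<in> topspace X"
    using act_neg_in_dom[OF True] dom_subset by blast+
  have "g \<in> I (\<theta> (- g) x)" "0 \<in> I (\<theta> (- g) x)"
    using dom by (simp_all add: orbit_index_def dom_unit)
  from mat_bounded_entry[OF norm_mat_bounded[OF F dom(2)] this] show ?thesis
    by (simp add: reg_matrix_def act_act_neg[OF True])
next
  case False
  then show ?thesis
    using carrierD(3)[OF F] reduced_norm_nonneg[OF F] by simp
qed

definition diff :: "('g \<Rightarrow> 'x \<Rightarrow> complex) \<Rightarrow> ('g \<Rightarrow> 'x \<Rightarrow> complex) \<Rightarrow> 'g \<Rightarrow> 'x \<Rightarrow> complex" where
  "diff u v = (\<lambda>g x. u g x - v g x)"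

lemma adist_diff: "adist CX N u v = N (diff u v)"
  by (simp add: adist_def diff_def)

lemma diff_in: "u \<in> acarrier C0.A \<Longrightarrow> v \<in> acarrier C0.A \<Longrightarrow> diff u v \<in> acarrier C0.A"
  using C0.add_closed[of u "\<lambda>g x. - 1 * v g x"] C0.smult_closed[of v "- 1"]
  by (simp add: diff_def del: crossed_product_simps(1))

lemma reg_matrix_diff: "M x (diff u v) k l = M x u k l - M x v k l"
  by (simp add: reg_matrix_def diff_def)

text \<open>The coefficients of the adjoint are continuous by extension from clopen sets. Their
  level sets are images under \<open>\<theta> k\<close> of the compact level sets of
  \<open>F (- k)\<close>, which lie in \<open>D (- k)\<close> because \<open>F (- k)\<close>
  vanishes elsewhere.\<close>

lemma star_closed:
  assumes F: "F \<in> acarrier C0.A"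
  shows "astar CX F \<in> acarrier C0.A"
proof -
  have "fsupp (\<lambda>k. pull D \<theta> k (\<lambda>x. cnj (F (- k) x))) \<subseteq> uminus ` fsupp F"
  proof
    fix k assume "k \<in> fsupp (\<lambda>k. pull D \<theta> k (\<lambda>x. cnj (F (- k) x)))"
    then obtain x where "F (- k) (\<theta> (- k) x) \<noteq> 0"
      by (auto simp: fsupp_def pull_def fun_eq_iff split: if_splits)
    then have "- k \<in> fsupp F"
      by (rule in_fsupp)
    then show "k \<in> uminus ` fsupp F"
      by force
  qed
  then have "finite (fsupp (\<lambda>k. pull D \<theta> k (\<lambda>x. cnj (F (- k) x))))"
    by (rule finite_subset) (use carrierD(1)[OF F] in simp)
  moreover have "pull D \<theta> k (\<lambda>x. cnj (F (- k) x)) \<in> C0 X" for k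
  proof -
    have f: "F (- k) \<in> C0 X"
      by (rule carrierD(2)[OF F])
    have cont: "continuous_map (subtopology X (D k)) (subtopology X (D (- k))) (\<theta> (- k))"
      using homeo[of "- k"] unfolding homeomorphic_maps_def by simp
    then have "continuous_map (subtopology X (D k)) X (\<theta> (- k))"
      using continuous_map_in_subtopology by blast
    moreover have "continuous_map X euclidean (F (- k))"
      using f by (simp add: C0_def)
    ultimately have "continuous_map (subtopology X (D k)) euclidean (F (- k) \<circ> \<theta> (- k))"
      by (rule continuous_map_compose)
    moreover have "continuous_map euclidean euclidean cnj"
      by (auto intro!: continuous_intros)
    ultimately have "continuous_map (subtopology X (D k)) euclidean (cnj \<circ> (F (- k) \<circ> \<theta> (- k)))"
      by (rule continuous_map_compose)
    then have "continuous_map (subtopology X (D k)) euclidean (pull D \<theta> k (\<lambda>x. cnj (F (- k) x)))"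
      by (rule continuous_map_eq) (auto simp: pull_def)
    then have 1: "continuous_map X euclidean (pull D \<theta> k (\<lambda>x. cnj (F (- k) x)))"
      by (rule continuous_map_clopen_extension[OF open_dom clopen]) (simp add: pull_def)
    have "compactin X {x \<in> topspace X. cmod (pull D \<theta> k (\<lambda>x. cnj (F (- k) x)) x) \<ge> \<epsilon>}" if e: "0 < \<epsilon>" for \<epsilon>
    proof -
      have sub: "{x \<in> topspace X. cmod (F (- k) x) \<ge> \<epsilon>} \<subseteq> D (- k)"
        using carrierD(3)[OF F] e by fastforce
      have "compactin (subtopology X (D (- k))) {x \<in> topspace X. cmod (F (- k) x) \<ge> \<epsilon>}"
        using C0_level[OF f e] sub by (simp add: compactin_subtopology)
      moreover have "continuous_map (subtopology X (D (- k))) X (\<theta> k)"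
        using homeo[of k] continuous_map_in_subtopology unfolding homeomorphic_maps_def by blast
      ultimately have "compactin X (\<theta> k ` {x \<in> topspace X. cmod (F (- k) x) \<ge> \<epsilon>})"
        by (rule image_compactin)
      moreover have "\<theta> k ` {x \<in> topspace X. cmod (F (- k) x) \<ge> \<epsilon>} =
          {x \<in> topspace X. cmod (pull D \<theta> k (\<lambda>x. cnj (F (- k) x)) x) \<ge> \<epsilon>}"
        unfolding act_image[OF sub]
      proof (intro equalityI subsetI)
        fix x assume x: "x \<in> {x \<in> topspace X. cmod (pull D \<theta> k (\<lambda>x. cnj (F (- k) x)) x) \<ge> \<epsilon>}"
        then have "x \<in> D k" "\<epsilon> \<le> cmod (F (- k) (\<theta> (- k) x))"
          using e by (auto simp: pull_def split: if_splits)
        then show "x \<in> {z \<in> D k. \<theta> (- k) z \<in> {x \<in> topspace X. cmod (F (- k) x) \<ge> \<epsilon>}}"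
          using subsetD[OF dom_subset act_neg_in_dom[of x k]] by simp
      next
        fix x assume "x \<in> {z \<in> D k. \<theta> (- k) z \<in> {x \<in> topspace X. cmod (F (- k) x) \<ge> \<epsilon>}}"
        then show "x \<in> {x \<in> topspace X. cmod (pull D \<theta> k (\<lambda>x. cnj (F (- k) x)) x) \<ge> \<epsilon>}"
          using subsetD[OF dom_subset[of k], of x] by (simp add: pull_def)
      qed
      ultimately show ?thesis
        by simp
    qed
    moreover have "pull D \<theta> k (\<lambda>x. cnj (F (- k) x)) x = 0" if "x \<notin> topspace X" for x
      using that dom_subset by (auto simp: pull_def)
    ultimately show ?thesis
      using 1 by (simp add: C0_def)
  qed
  ultimately show ?thesis
    by (simp add: pull_def)
qed

text \<open>The map \<open>\<theta> (- (k - l))\<close> takes \<open>\<theta> k x\<close> to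
  \<open>\<theta> l x\<close>, so the coefficient of the adjoint at \<open>k - l\<close> is
  evaluated where the transposed entry is.\<close>

lemma reg_matrix_star:
  assumes "k \<in> I x" "l \<in> I x"
  shows "M x (astar CX F) k l = cnj (M x F l k)"
proof -
  have kl: "x \<in> D (- k)" "x \<in> D (- l)"
    using assms by (simp_all add: orbit_index_def)
  have [simp]: "- (k - l) + k = l" "- (k - l) = l - k"
    by (simp_all add: minus_diff_eq)
  have "\<theta> k x \<in> D (k - l)"
    using act_in_dom_iff[OF kl(1), of "- (k - l)"] kl(2) by simp
  moreover have "\<theta> (- (k - l)) (\<theta> k x) = \<theta> l x"
    using act_act[OF kl(1), of "- (k - l)"] kl(2) by simp
  ultimately show ?thesis
    by (simp add: reg_matrix_def pull_def)
qed

lemma norm_mult_le: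
  assumes u: "u \<in> acarrier C0.A" and v: "v \<in> acarrier C0.A"
  shows "N (cp_mult D \<theta> u v) \<le> N u * N v"
proof (rule norm_leI[OF C0.mult_closed[OF u v]])
  show "0 \<le> N u * N v"
    using reduced_norm_nonneg u v by simp
  fix x assume x: "x \<in> topspace X"
  show "mat_bounded (I x) (M x (cp_mult D \<theta> u v)) (N u * N v)"
  proof (rule mat_bounded_mult[OF norm_mat_bounded[OF u x] norm_mat_bounded[OF v x]])
    fix K L :: "'g set" assume K: "finite K" "finite L" "K \<subseteq> I x" "L \<subseteq> I x"
    let ?J = "{j \<in> (\<lambda>(g, k). - g + k) ` (fsupp u \<times> K). j \<in> I x}"
    have "M x (cp_mult D \<theta> u v) k l = (\<Sum>j\<in>?J. M x u k j * M x v j l)" if "k \<in> K" for k l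
      using K that by (intro reg_matrix_mult carrierD(1)[OF u] carrierD(1)[OF v] carrierD(3)[OF u] order_refl) auto
    moreover have "finite ?J" "?J \<subseteq> I x"
      using K carrierD(1)[OF u] by auto
    ultimately show "\<exists>J. finite J \<and> J \<subseteq> I x \<and>
        (\<forall>k\<in>K. \<forall>l\<in>L. M x (cp_mult D \<theta> u v) k l = (\<Sum>j\<in>J. M x u k j * M x v j l))"
      by blast
  qed (use reduced_norm_nonneg u v in auto)
qed

lemma norm_add_le:
  assumes "u \<in> acarrier C0.A" "v \<in> acarrier C0.A" "w \<in> acarrier C0.A"
    and eq: "\<And>g x. w g x = u g x + v g x"
  shows "N w \<le> N u + N v"
proof (rule norm_leI[OF assms(3)])
  show "0 \<le> N u + N v"
    using reduced_norm_nonneg assms by simp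
  fix x assume x: "x \<in> topspace X"
  show "mat_bounded (I x) (M x w) (N u + N v)"
    using mat_bounded_add[OF norm_mat_bounded[OF assms(1) x] norm_mat_bounded[OF assms(2) x]]
    by (simp add: reg_matrix_def[abs_def] eq)
qed

lemma norm_smult_le:
  assumes "u \<in> acarrier C0.A" "w \<in> acarrier C0.A" and eq: "\<And>g x. w g x = r * u g x"
  shows "N w \<le> cmod r * N u"
proof (rule norm_leI[OF assms(2)])
  show "0 \<le> cmod r * N u"
    using reduced_norm_nonneg assms by simp
  fix x assume x: "x \<in> topspace X"
  show "mat_bounded (I x) (M x w) (cmod r * N u)"
    using mat_bounded_smult[OF norm_mat_bounded[OF assms(1) x], of r]
    by (simp add: reg_matrix_def[abs_def] eq)
qed

text \<open>The four products are expanded over one index set, the union of the supports of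
  \<open>u\<close> and \<open>v\<close>; the identity then holds term by term.\<close>

lemma cp_mult_diff:
  assumes "u \<in> acarrier C0.A" "v \<in> acarrier C0.A" "u' \<in> acarrier C0.A" "v' \<in> acarrier C0.A"
  shows "diff (cp_mult D \<theta> u u') (cp_mult D \<theta> v v') k x =
    cp_mult D \<theta> (diff u v) u' k x + cp_mult D \<theta> v (diff u' v') k x"
proof -
  let ?S = "fsupp u \<union> fsupp v"
  have "fsupp (diff u v) \<subseteq> ?S"
    by (auto simp: fsupp_def diff_def)
  moreover have "finite ?S"
    using carrierD(1) assms by simp
  ultimately have e: "cp_mult D \<theta> (diff u v) u' k x = (\<Sum>g\<in>?S. diff u v g x * u' (- g + k) (\<theta> (- g) x))"
    "cp_mult D \<theta> v (diff u' v') k x = (\<Sum>g\<in>?S. v g x * diff u' v' (- g + k) (\<theta> (- g) x))"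
    "cp_mult D \<theta> u u' k x = (\<Sum>g\<in>?S. u g x * u' (- g + k) (\<theta> (- g) x))"
    "cp_mult D \<theta> v v' k x = (\<Sum>g\<in>?S. v g x * v' (- g + k) (\<theta> (- g) x))"
    using assms diff_in carrierD(1) carrierD(3) by (auto intro!: cp_mult_apply_on simp del: crossed_product_simps)
  show ?thesis
    unfolding diff_def[of "cp_mult D \<theta> u u'"] e
    by (simp add: diff_def algebra_simps sum.distrib sum_subtractf)
qed

sublocale reduced: normed_star_algebra CX N
proof
  fix u v :: "'g \<Rightarrow> 'x \<Rightarrow> complex" and r
  assume u: "u \<in> acarrier CX" and v: "v \<in> acarrier CX"
  note uv = u[unfolded CX_simps] v[unfolded CX_simps]
  show "aadd CX u v \<in> acarrier CX" "amult CX u v \<in> acarrier CX"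
    using C0.add_closed[OF uv] C0.mult_closed[OF uv] by (simp_all only: CX_simps)
  show "adist CX N u v = adist CX N v u"
  proof (rule antisym)
    show "adist CX N u v \<le> adist CX N v u"
      unfolding adist_diff using norm_smult_le[OF diff_in[OF uv(2,1)] diff_in[OF uv], of "- 1"] by (simp add: diff_def)
    show "adist CX N v u \<le> adist CX N u v"
      unfolding adist_diff using norm_smult_le[OF diff_in[OF uv] diff_in[OF uv(2,1)], of "- 1"] by (simp add: diff_def)
  qed
  show "adist CX N (asmult CX r u) (asmult CX r v) \<le> cmod r * adist CX N u v"
    unfolding adist_diff CX_simps
    by (rule norm_smult_le[OF diff_in[OF uv] diff_in[OF C0.smult_closed[OF uv(1)] C0.smult_closed[OF uv(2)]]])
      (simp add: diff_def algebra_simps)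
  show "adist CX N (astar CX u) (astar CX v) \<le> adist CX N u v"
    unfolding adist_diff
  proof (rule norm_leI)
    show "diff (astar CX u) (astar CX v) \<in> acarrier C0.A"
      by (intro diff_in star_closed uv)
    show "0 \<le> N (diff u v)"
      by (intro reduced_norm_nonneg diff_in uv)
    fix x assume x: "x \<in> topspace X"
    show "mat_bounded (I x) (M x (diff (astar CX u) (astar CX v))) (N (diff u v))"
      by (rule mat_bounded_cong[OF _ mat_bounded_adjoint[OF norm_mat_bounded[OF diff_in[OF uv] x]]])
        (simp only: reg_matrix_diff reg_matrix_star complex_cnj_diff)
  qed
  show "N u \<le> N v + adist CX N u v"
    unfolding adist_diff by (rule norm_add_le[OF uv(2) diff_in[OF uv] uv(1)]) (simp add: diff_def)
next
  fix u :: "'g \<Rightarrow> 'x \<Rightarrow> complex" and r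
  assume u: "u \<in> acarrier CX"
  note u' = u[unfolded CX_simps]
  show "asmult CX r u \<in> acarrier CX" "astar CX u \<in> acarrier CX" "0 \<le> N u"
    using C0.smult_closed[OF u'] star_closed[OF u'] reduced_norm_nonneg[OF u'] by (simp_all only: CX_simps)
  have "N (diff u u) \<le> cmod 0 * N u"
    by (rule norm_smult_le[OF u' diff_in[OF u' u']]) (simp add: diff_def)
  then show "adist CX N u u = 0"
    unfolding adist_diff using reduced_norm_nonneg[OF diff_in[OF u' u']] by simp
next
  fix u v w :: "'g \<Rightarrow> 'x \<Rightarrow> complex"
  assume "u \<in> acarrier CX" "v \<in> acarrier CX" "w \<in> acarrier CX"
  note uvw = this[unfolded CX_simps(1)]
  show "adist CX N u w \<le> adist CX N u v + adist CX N v w"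
    unfolding adist_diff
    by (rule norm_add_le[OF diff_in[OF uvw(1,2)] diff_in[OF uvw(2,3)] diff_in[OF uvw(1,3)]]) (simp add: diff_def)
next
  fix u v u' v' :: "'g \<Rightarrow> 'x \<Rightarrow> complex"
  assume "u \<in> acarrier CX" "v \<in> acarrier CX" "u' \<in> acarrier CX" "v' \<in> acarrier CX"
  note uv = this[unfolded CX_simps(1)]
  show "adist CX N (aadd CX u u') (aadd CX v v') \<le> adist CX N u v + adist CX N u' v'"
    unfolding adist_diff CX_simps
    by (rule norm_add_le[OF diff_in[OF uv(1,2)] diff_in[OF uv(3,4)]
          diff_in[OF C0.add_closed[OF uv(1,3)] C0.add_closed[OF uv(2,4)]]]) (simp add: diff_def)
  have "N (diff (cp_mult D \<theta> u u') (cp_mult D \<theta> v v')) \<le>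
      N (cp_mult D \<theta> (diff u v) u') + N (cp_mult D \<theta> v (diff u' v'))"
    by (intro norm_add_le diff_in C0.mult_closed uv) (rule cp_mult_diff[OF uv])
  also have "\<dots> \<le> N (diff u v) * N u' + N v * N (diff u' v')"
    by (intro add_mono norm_mult_le diff_in uv)
  finally show "adist CX N (amult CX u u') (amult CX v v') \<le> adist CX N u v * N u' + N v * adist CX N u' v'"
    unfolding adist_diff CX_simps .
qed

end

section \<open>Groupoid isomorphisms induce isomorphisms of reduced crossed products\<close>

lemma mat_bounded_reindex_iff:
  assumes \<sigma>: "bij_betw \<sigma> I I'" and eq: "\<And>k l. k \<in> I \<Longrightarrow> l \<in> I \<Longrightarrow> M' (\<sigma> k) (\<sigma> l) = M k l"
  shows "mat_bounded I M C \<longleftrightarrow> mat_bounded I' M' C"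
proof
  let ?\<tau> = "the_inv_into I \<sigma>"
  have \<tau>: "bij_betw ?\<tau> I' I"
    by (rule bij_betw_the_inv_into[OF \<sigma>])
  have "M (?\<tau> k) (?\<tau> l) = M' k l" if "k \<in> I'" "l \<in> I'" for k l
    using eq[of "?\<tau> k" "?\<tau> l"] bij_betw_apply[OF \<tau>] f_the_inv_into_f_bij_betw[OF \<sigma>] that by simp
  then show "mat_bounded I M C \<Longrightarrow> mat_bounded I' M' C"
    by (rule mat_bounded_reindex[of ?\<tau> I' I M M', OF \<tau>])
qed (rule mat_bounded_reindex[of \<sigma> I I' M' M, OF assms])

lemma transport_fun_C0:
  assumes "homeomorphic_maps X Y \<phi> \<psi>" "f \<in> C0 X"
  shows "transport_fun Y \<psi> f \<in> C0 Y"
  unfolding C0_def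
proof (intro CollectI conjI allI impI)
  show "continuous_map Y euclidean (transport_fun Y \<psi> f)"
    by (rule transport_fun_continuous[OF assms(1)]) (use assms(2) in \<open>simp add: C0_def\<close>)
  fix \<epsilon> :: real assume "0 < \<epsilon>"
  then show "compactin Y {y \<in> topspace Y. \<epsilon> \<le> cmod (transport_fun Y \<psi> f y)}"
    by (intro transport_fun_level[OF assms(1)] C0_level[OF assms(2)])
qed (simp add: transport_fun_def)

context clopen_partial_action
begin

lemma Lc_subset_C0:
  assumes "f \<in> Lc X"
  shows "f \<in> C0 X"
  unfolding C0_def
proof (intro CollectI conjI allI impI)
  show c: "continuous_map X euclidean f"
    using assms continuous_map_compose[of X "discrete_topology UNIV" f euclidean id] by (simp add: Lc_iff)
  fix \<epsilon> :: real assume e: "0 < \<epsilon>"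
  have "closed {z. \<epsilon> \<le> cmod z}"
    by (intro closed_Collect_le continuous_intros)
  then have "closedin X {x \<in> topspace X. f x \<in> {z. \<epsilon> \<le> cmod z}}"
    by (intro closedin_continuous_map_preimage[OF c]) simp
  moreover have "{x \<in> topspace X. \<epsilon> \<le> cmod (f x)} \<subseteq> {x \<in> topspace X. f x \<noteq> 0}"
    using e by auto
  moreover have "compactin X {x \<in> topspace X. f x \<noteq> 0}"
    using assms by (simp add: Lc_iff)
  ultimately show "compactin X {x \<in> topspace X. \<epsilon> \<le> cmod (f x)}"
    by (rule_tac closed_compactin[of X "{x \<in> topspace X. f x \<noteq> 0}"]) simp_all
qed (use assms in \<open>simp add: Lc_iff\<close>)

lemma Lc_if:
  fixes f :: "'x \<Rightarrow> complex"
  assumes U: "compact_open X U" and f: "f \<in> Lc X"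
  shows "(\<lambda>z. if z \<in> U then c else f z) \<in> Lc X"
proof -
  let ?h = "\<lambda>z. if z \<in> U then c else f z"
  have op: "openin X U" "openin X (topspace X - U)"
    using U compact_open_closedin by (auto simp: compact_open_def closedin_def)
  have c: "continuous_map X (discrete_topology UNIV) ?h"
    unfolding continuous_map_discrete_iff
  proof
    fix x assume x: "x \<in> topspace X"
    show "\<exists>P. openin X P \<and> x \<in> P \<and> (\<forall>z\<in>P. ?h z = ?h x)"
    proof (cases "x \<in> U")
      case True
      then show ?thesis
        using op(1) by (intro exI[of _ U]) simp
    next
      case False
      obtain P where P: "openin X P" "x \<in> P" "\<forall>z\<in>P. f z = f x"
        using Lc_near[OF f x] by (elim exE conjE) (rule that)
      show ?thesis
      proof (intro exI[of _ "P \<inter> (topspace X - U)"] conjI ballI)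
        show "openin X (P \<inter> (topspace X - U))"
          using P(1) op(2) by (rule openin_Int)
        show "x \<in> P \<inter> (topspace X - U)"
          using P(2) x False by blast
        fix z assume "z \<in> P \<inter> (topspace X - U)"
        then have "z \<notin> U" "f z = f x"
          using P(3) by blast+
        then show "?h z = ?h x"
          using False by simp
      qed
    qed
  qed
  have "closedin X {x \<in> topspace X. ?h x \<in> - {0}}"
    by (rule closedin_continuous_map_preimage[OF c]) auto
  moreover have "compactin X (U \<union> {x \<in> topspace X. f x \<noteq> 0})"
    using U f by (intro compactin_Un) (auto simp: Lc_iff compact_open_def)
  ultimately have "compactin X {x \<in> topspace X. ?h x \<noteq> 0}"
    by (rule_tac closed_compactin) auto
  then show ?thesis
    using c f compact_open_subset[OF U] unfolding Lc_iff by auto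
qed

text \<open>The sets may overlap: each new \<open>U\<close> overrides the function built so far by
  its own constant, and the estimate survives on the remaining sets.\<close>

lemma Lc_piecewise:
  assumes "finite \<U>" "\<And>U. U \<in> \<U> \<Longrightarrow> compact_open X U \<and> (\<exists>c. \<forall>z\<in>U. cmod (f z - c) < \<delta>)"
  shows "\<exists>f0 \<in> Lc X. (\<forall>z\<in>\<Union>\<U>. cmod (f z - f0 z) < \<delta>) \<and> (\<forall>z. z \<notin> \<Union>\<U> \<longrightarrow> f0 z = 0)"
  using assms
proof (induction \<U> rule: finite_induct)
  case empty
  then show ?case
    using Lc.zero_coeff by force
next
  case (insert U \<U>)
  have "\<exists>f0 \<in> Lc X. (\<forall>z\<in>\<Union>\<U>. cmod (f z - f0 z) < \<delta>) \<and> (\<forall>z. z \<notin> \<Union>\<U> \<longrightarrow> f0 z = 0)"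
    by (rule insert.IH) (use insert.prems in blast)
  then obtain f0 where f0: "f0 \<in> Lc X" "\<forall>z\<in>\<Union>\<U>. cmod (f z - f0 z) < \<delta>" "\<forall>z. z \<notin> \<Union>\<U> \<longrightarrow> f0 z = 0"
    by (elim bexE conjE) (rule that)
  obtain c where c: "\<And>z. z \<in> U \<Longrightarrow> cmod (f z - c) < \<delta>" and U: "compact_open X U"
    using insert.prems[of U] by auto
  show ?case
    by (rule bexI[OF _ Lc_if[OF U f0(1), of c]]) (use f0 c in auto)
qed

text \<open>The compact set where \<open>f\<close> has modulus at least \<open>\<delta>\<close> is
  covered by finitely many compact open sets on which \<open>f\<close> is nearly constant. The
  clause about zeros ensures that an approximant of a coefficient still vanishes off its domain and
  that a zero coefficient stays zero.\<close>

lemma Lc_approximates: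
  assumes f: "f \<in> C0 X" and \<delta>: "0 < \<delta>"
  shows "\<exists>f0 \<in> Lc X. \<forall>x. cmod (f x - f0 x) \<le> \<delta> \<and> (f x = 0 \<longrightarrow> f0 x = 0)"
proof -
  define K where "K = {x \<in> topspace X. cmod (f x) \<ge> \<delta>}"
  have K: "compactin X K"
    unfolding K_def by (rule C0_level[OF f \<delta>])
  \<comment> \<open>Members of the cover avoid the zeros of \<open>f\<close>; this is how the clause
    about zeros is obtained.\<close>
  define \<C> where "\<C> = {U. compact_open X U \<and> (\<exists>c. \<forall>z\<in>U. cmod (f z - c) < \<delta>) \<and> (\<forall>z\<in>U. f z \<noteq> 0)}"
  have cover: "K \<subseteq> \<Union>\<C>"
  proof
    fix x assume x: "x \<in> K"
    then have "f x \<noteq> 0" "x \<in> topspace X"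
      using \<delta> by (auto simp: K_def)
    have c: "continuous_map X euclidean f"
      using f by (simp add: C0_def)
    have "open {z. cmod (z - f x) < \<delta> \<and> z \<noteq> 0}"
      by (intro open_Collect_conj open_Collect_less open_Collect_neq continuous_intros)
    then have "openin X {z \<in> topspace X. f z \<in> {z. cmod (z - f x) < \<delta> \<and> z \<noteq> 0}}"
      by (intro openin_continuous_map_preimage[OF c]) simp
    moreover have "x \<in> {z \<in> topspace X. f z \<in> {z. cmod (z - f x) < \<delta> \<and> z \<noteq> 0}}"
      using \<open>f x \<noteq> 0\<close> \<open>x \<in> topspace X\<close> \<delta> by simp
    ultimately obtain U where "compact_open X U" "x \<in> U" "U \<subseteq> {z \<in> topspace X. f z \<in> {z. cmod (z - f x) < \<delta> \<and> z \<noteq> 0}}"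
      by (rule compact_open_base)
    then have "U \<in> \<C>"
      unfolding \<C>_def by auto
    then show "x \<in> \<Union>\<C>"
      using \<open>x \<in> U\<close> by blast
  qed
  have "\<forall>U\<in>\<C>. openin X U"
    unfolding \<C>_def compact_open_def by blast
  then obtain \<U> where \<U>: "finite \<U>" "\<U> \<subseteq> \<C>" "K \<subseteq> \<Union>\<U>"
    using K cover unfolding compactin_def by meson
  have "\<exists>f0 \<in> Lc X. (\<forall>z\<in>\<Union>\<U>. cmod (f z - f0 z) < \<delta>) \<and> (\<forall>z. z \<notin> \<Union>\<U> \<longrightarrow> f0 z = 0)"
    using \<U>(1,2) unfolding \<C>_def by (intro Lc_piecewise) auto
  then obtain f0 where f0: "f0 \<in> Lc X" "\<And>z. z \<in> \<Union>\<U> \<Longrightarrow> cmod (f z - f0 z) < \<delta>" "\<And>z. z \<notin> \<Union>\<U> \<Longrightarrow> f0 z = 0"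
    by blast
  have "cmod (f x - f0 x) \<le> \<delta> \<and> (f x = 0 \<longrightarrow> f0 x = 0)" for x
  proof (cases "x \<in> \<Union>\<U>")
    case True
    then have "f x \<noteq> 0"
      using \<U>(2) unfolding \<C>_def by blast
    then show ?thesis
      using f0(2)[OF True] by simp
  next
    case False
    then have "x \<notin> K"
      using \<U>(3) by blast
    then have "cmod (f x) \<le> \<delta>"
      using f \<delta> by (cases "x \<in> topspace X") (auto simp: K_def C0_def)
    then show ?thesis
      using f0(3)[OF False] by simp
  qed
  then show ?thesis
    using f0(1) by blast
qed

lemma skew_subset: "F \<in> acarrier Lc.A \<Longrightarrow> F \<in> acarrier C0.A"
  using Lc_subset_C0 by simp

lemma skew_dense: "reduced.dense (acarrier Lc.A)"
  unfolding reduced.dense_def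
proof (intro conjI ballI allI impI)
  show "acarrier Lc.A \<subseteq> acarrier CX"
    using skew_subset unfolding CX_simps(1) by blast
next
  fix F and \<epsilon> :: real assume F: "F \<in> acarrier CX" and e: "0 < \<epsilon>"
  note F = F[unfolded CX_simps(1)]
  \<comment> \<open>Each coefficient in the support costs at most \<open>\<delta>\<close>. The added
    1 keeps the denominator positive for \<open>F = 0\<close> and makes the final inequality
    strict.\<close>
  define \<delta> where "\<delta> = \<epsilon> / (real (card (fsupp F)) + 1)"
  have \<delta>: "0 < \<delta>" "real (card (fsupp F)) * \<delta> < \<epsilon>"
  proof -
    show "0 < \<delta>"
      unfolding \<delta>_def using e by (intro divide_pos_pos) (simp_all add: add_nonneg_pos)
    then have "real (card (fsupp F)) * \<delta> < (real (card (fsupp F)) + 1) * \<delta>"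
      by (intro mult_strict_right_mono) simp_all
    also have "\<dots> = \<epsilon>"
      unfolding \<delta>_def by simp
    finally show "real (card (fsupp F)) * \<delta> < \<epsilon>" .
  qed
  have "\<forall>g. \<exists>f0 \<in> Lc X. \<forall>x. cmod (F g x - f0 x) \<le> \<delta> \<and> (F g x = 0 \<longrightarrow> f0 x = 0)"
    using Lc_approximates[OF carrierD(2)[OF F] \<delta>(1)] by blast
  then obtain f0 where f0: "\<And>g. f0 g \<in> Lc X" "\<And>g x. cmod (F g x - f0 g x) \<le> \<delta>" "\<And>g x. F g x = 0 \<Longrightarrow> f0 g x = 0"
    by metis
  have sub: "fsupp f0 \<subseteq> fsupp F"
    using f0(3) by (auto simp: fsupp_def fun_eq_iff)
  then have f0_in: "f0 \<in> acarrier Lc.A"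
    using f0 finite_subset[OF sub] carrierD[OF F] by simp
  have "N (diff F f0) \<le> (\<Sum>g\<in>fsupp F. \<delta>)"
  proof (rule norm_sup_le[OF diff_in[OF F skew_subset[OF f0_in]] carrierD(1)[OF F]])
    show "fsupp (diff F f0) \<subseteq> fsupp F"
    proof (intro subsetI, rule ccontr)
      fix g assume g: "g \<in> fsupp (diff F f0)" "g \<notin> fsupp F"
      have "diff F f0 g = (\<lambda>_. 0)"
        using not_in_fsupp[OF g(2)] f0(3) by (simp add: diff_def)
      then show False
        using g(1) by (simp add: fsupp_def)
    qed
  qed (use f0 \<delta> in \<open>auto simp: diff_def\<close>)
  then have "adist CX N F f0 < \<epsilon>"
    unfolding adist_diff using \<delta> by simp
  then show "\<exists>v\<in>acarrier Lc.A. adist CX N F v < \<epsilon>"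
    using f0_in by blast
qed

text \<open>The support of \<open>F (- k)\<close> is compact open and \<open>\<theta> k\<close>
  carries it to a compact open set. Multiplication by the indicator of that image exhibits the
  pulled-back coefficient as a twisted product, to which \<open>Lc.mult_coeff\<close>
  applies.\<close>

lemma skew_star_closed:
  assumes F: "F \<in> acarrier Lc.A"
  shows "astar CX F \<in> acarrier Lc.A"
proof -
  have "pull D \<theta> k (\<lambda>x. cnj (F (- k) x)) \<in> Lc X" for k
  proof -
    let ?f = "\<lambda>x. cnj (F (- k) x)" and ?U = "{x \<in> topspace X. F (- k) x \<noteq> 0}"
    have Fk: "F (- k) \<in> Lc X"
      using F by simp
    then have "continuous_map X (discrete_topology UNIV) (cnj \<circ> F (- k))"
      by (intro continuous_map_compose[where X' = "discrete_topology UNIV"]) (auto simp: Lc_iff)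
    then have f: "?f \<in> Lc X"
      by (intro Lc_dominated[OF Fk]) (auto simp: o_def)
    have "openin X {x \<in> topspace X. F (- k) x \<in> - {0}}"
      using Fk by (intro openin_continuous_map_preimage[of _ "discrete_topology UNIV"]) (auto simp: Lc_iff)
    then have U: "compact_open X ?U" "?U \<subseteq> D (- k)"
      using F Fk by (auto simp: compact_open_def Lc_iff)
    have V: "compact_open X (\<theta> k ` ?U)" "\<theta> k ` ?U = {z \<in> D k. \<theta> (- k) z \<in> ?U}"
      by (rule act_image_compact_open[OF U]) (rule act_image[OF U(2)])
    have "(\<lambda>x. (if x \<in> \<theta> k ` ?U then 1 else 0) * ?f (\<theta> (- k) x)) \<in> Lc X"
      by (rule Lc.mult_coeff[OF indicator_in_Lc[OF stone_space_axioms V(1)] f, of k]) (use V(2) in auto)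
    moreover have "(\<lambda>x. (if x \<in> \<theta> k ` ?U then 1 else 0) * ?f (\<theta> (- k) x)) = pull D \<theta> k ?f"
    proof
      fix x
      show "(if x \<in> \<theta> k ` ?U then 1 else 0) * ?f (\<theta> (- k) x) = pull D \<theta> k ?f x"
        unfolding V(2) using subsetD[OF dom_subset act_neg_in_dom[of x k]] by (auto simp: pull_def)
    qed
    ultimately show ?thesis
      by simp
  qed
  moreover have "astar CX F \<in> acarrier C0.A"
    by (rule star_closed[OF skew_subset[OF F]])
  ultimately show ?thesis
    by (simp add: pull_def)
qed

lemma monomial_C0_in: "f \<in> C0 X \<Longrightarrow> monomial 0 f \<in> acarrier C0.A"
  by (rule C0.monomial_closed) (auto simp: C0_def dom_unit)

lemma monomial_Lc_in: "f \<in> Lc X \<Longrightarrow> monomial 0 f \<in> acarrier Lc.A"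
  by (rule Lc.monomial_closed) (auto simp: Lc_def dom_unit)

lemma monomial_dist_le:
  assumes "f \<in> C0 X" "f' \<in> C0 X" "\<And>x. cmod (f x - f' x) \<le> \<delta>" "0 \<le> \<delta>"
  shows "adist CX N (monomial 0 f) (monomial 0 f') \<le> \<delta>"
proof -
  have "N (diff (monomial 0 f) (monomial 0 f')) \<le> (\<Sum>g\<in>{0::'g}. \<delta>)"
  proof (rule norm_sup_le[OF diff_in[OF monomial_C0_in[OF assms(1)] monomial_C0_in[OF assms(2)]]])
    show "fsupp (diff (monomial 0 f) (monomial 0 f')) \<subseteq> {0::'g}"
      by (auto simp: diff_def monomial_def fsupp_def)
  qed (use assms in \<open>auto simp: diff_def monomial_def\<close>)
  then show ?thesis
    unfolding adist_diff by simp
qed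

end

section \<open>The isometry of skew group rings induced by a groupoid isomorphism\<close>

locale clopen_pair = X: clopen_partial_action X D \<theta> + Y: clopen_partial_action Y E \<gamma>
  for X :: "'x topology" and D :: "'g::group_add \<Rightarrow> 'x set" and \<theta> :: "'g \<Rightarrow> 'x \<Rightarrow> 'x"
    and Y :: "'y topology" and E :: "'h::group_add \<Rightarrow> 'y set" and \<gamma> :: "'h \<Rightarrow> 'y \<Rightarrow> 'y"
begin

sublocale partial_action_pair X D \<theta> Y E \<gamma>
  by unfold_locales

end

locale groupoid_iso_pair = clopen_pair X D \<theta> Y E \<gamma>
  for X :: "'x topology" and D :: "'g::group_add \<Rightarrow> 'x set" and \<theta> :: "'g \<Rightarrow> 'x \<Rightarrow> 'x"
    and Y :: "'y topology" and E :: "'h::group_add \<Rightarrow> 'y set" and \<gamma> :: "'h \<Rightarrow> 'y \<Rightarrow> 'y" +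
  fixes \<kappa> :: "'g \<times> 'x \<Rightarrow> 'h \<times> 'y" and \<kappa>' :: "'h \<times> 'y \<Rightarrow> 'g \<times> 'x"
  assumes iso: "groupoid_iso X.groupoid Y.groupoid \<kappa>" and iso': "groupoid_iso Y.groupoid X.groupoid \<kappa>'"
    and maps: "homeomorphic_maps (gtop X.groupoid) (gtop Y.groupoid) \<kappa> \<kappa>'"
begin

sublocale swapped: partial_action_pair Y E \<gamma> X D \<theta>
  by (rule swap_pair)

definition \<phi> where "\<phi> x = snd (\<kappa> (0, x))"
definition \<psi> where "\<psi> y = snd (\<kappa>' (0, y))"

lemma inv: "c \<in> Sigma UNIV D \<Longrightarrow> \<kappa>' (\<kappa> c) = c" "c' \<in> Sigma UNIV E \<Longrightarrow> \<kappa> (\<kappa>' c') = c'"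
proof -
  note m = maps[unfolded homeomorphic_maps_def X.topspace_gtop_groupoid Y.topspace_gtop_groupoid]
  show "c \<in> Sigma UNIV D \<Longrightarrow> \<kappa>' (\<kappa> c) = c"
    by (rule bspec[OF m[THEN conjunct2, THEN conjunct2, THEN conjunct1]])
  show "c' \<in> Sigma UNIV E \<Longrightarrow> \<kappa> (\<kappa>' c') = c'"
    by (rule bspec[OF m[THEN conjunct2, THEN conjunct2, THEN conjunct2]])
qed

lemma homeo_maps: "homeomorphic_maps X Y \<phi> \<psi>"
  unfolding \<phi>_def[abs_def] \<psi>_def[abs_def] by (rule groupoid_iso_homeo[OF iso iso' maps])

lemmas form = groupoid_iso_form(2-5)[OF iso, folded \<phi>_def]
lemmas form' = swapped.groupoid_iso_form(2-5)[OF iso', folded \<psi>_def]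

lemma points: "x \<in> topspace X \<Longrightarrow> \<psi> (\<phi> x) = x \<and> \<phi> x \<in> topspace Y"
    "y \<in> topspace Y \<Longrightarrow> \<phi> (\<psi> y) = y \<and> \<psi> y \<in> topspace X"
proof -
  note m = homeo_maps[unfolded homeomorphic_maps_def]
  note m(1)[THEN conjunct1, THEN continuous_map_funspace]
    m(1)[THEN conjunct2, THEN conjunct1, THEN continuous_map_funspace]
    m[THEN conjunct2, THEN conjunct2, THEN conjunct1] m[THEN conjunct2, THEN conjunct2, THEN conjunct2]
  then show "x \<in> topspace X \<Longrightarrow> \<psi> (\<phi> x) = x \<and> \<phi> x \<in> topspace Y"
      "y \<in> topspace Y \<Longrightarrow> \<phi> (\<psi> y) = y \<and> \<psi> y \<in> topspace X"
    by blast+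
qed

text \<open>The transport of Steinberg algebras, conjugated by currying. Scalars are complex here,
  whatever the ring in the theorem is.\<close>

definition skew_map :: "('g \<Rightarrow> 'x \<Rightarrow> complex) \<Rightarrow> 'h \<Rightarrow> 'y \<Rightarrow> complex" where
  "skew_map = the_inv_into (acarrier Y.Lc.A) case_prod \<circ> (transport_fun (gtop Y.groupoid) \<kappa>' \<circ> case_prod)"

lemma skew_map_iso: "alg_iso X.Lc.A Y.Lc.A skew_map"
  unfolding skew_map_def
proof (rule alg_iso_compose)
  show "alg_iso X.Lc.A (steinberg_algebra Y.groupoid) (transport_fun (gtop Y.groupoid) \<kappa>' \<circ> case_prod)"
    by (rule alg_iso_compose[OF X.uncurry_iso[OF X.clopen, unfolded partial_skew_group_ring_def]
          groupoid_iso_steinberg(1)[OF iso iso' X.groupoid_is_closed Y.groupoid_is_closed maps]])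
  show "alg_iso (steinberg_algebra Y.groupoid) Y.Lc.A (the_inv_into (acarrier Y.Lc.A) case_prod)"
    by (rule alg_iso_inverse[OF Y.uncurry_iso[OF Y.clopen] Y.skew_group_ring_closed[OF Y.clopen],
          unfolded partial_skew_group_ring_def])
qed

lemma skew_map_apply:
  assumes F: "F \<in> acarrier X.Lc.A"
  shows "skew_map F h y = (if y \<in> E h then case_prod F (\<kappa>' (h, y)) else 0)"
proof -
  let ?T = "transport_fun (gtop Y.groupoid) \<kappa>' (case_prod F)"
  have "case_prod F \<in> Lc (gtop X.groupoid)"
    using X.uncurry_in_Lc[OF F] by simp
  then have "?T \<in> Lc (gtop Y.groupoid)"
    by (rule transport_fun_Lc[OF maps])
  then have T: "curry ?T \<in> acarrier Y.Lc.A"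
    using Y.curry_in_crossed_product[OF _ Y.clopen] by simp
  have "inj_on case_prod (acarrier Y.Lc.A)"
    using Y.uncurry_iso[OF Y.clopen, where 'r = complex]
    by (simp add: alg_iso_def bij_betw_def partial_skew_group_ring_def del: crossed_product_simps)
  then have "skew_map F = curry ?T"
    unfolding skew_map_def o_def by (rule the_inv_into_f_eq[OF _ _ T]) simp
  then show ?thesis
    unfolding transport_fun_def Y.topspace_gtop_groupoid by simp
qed

text \<open>The arrow with group element \<open>k\<close> and source \<open>x\<close> is
  \<open>(k, \<theta> k x)\<close>; \<open>\<sigma> x k\<close> is the group component of its image.
  Thus \<open>\<sigma> x\<close> relabels the basis vectors of the regular representation at
  \<open>x\<close> as those at \<open>\<phi> x\<close>.\<close>

definition \<sigma> where "\<sigma> x k = fst (\<kappa> (k, \<theta> k x))"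

lemma \<sigma>:
  assumes x: "x \<in> topspace X" and k: "k \<in> X.I x"
  shows "\<kappa> (k, \<theta> k x) = (\<sigma> x k, \<phi> (\<theta> k x))" "\<phi> x \<in> E (- \<sigma> x k)" "\<phi> (\<theta> k x) = \<gamma> (\<sigma> x k) (\<phi> x)"
    "\<theta> k x \<in> D k"
proof -
  have k': "x \<in> D (- k)"
    using k by (simp add: orbit_index_def)
  show dom: "\<theta> k x \<in> D k"
    by (rule X.act_in_dom[OF k'])
  show "\<kappa> (k, \<theta> k x) = (\<sigma> x k, \<phi> (\<theta> k x))"
    unfolding \<sigma>_def by (rule form(2)[OF dom])
  show "\<phi> x \<in> E (- \<sigma> x k)" "\<phi> (\<theta> k x) = \<gamma> (\<sigma> x k) (\<phi> x)"
    using groupoid_iso_cocycle(2)[OF iso] k' unfolding \<phi>_def \<sigma>_def by auto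
qed

text \<open>The matrix entry at \<open>(k, l)\<close> is a value at the arrow
  \<open>(k - l, \<theta> k x)\<close>, and the product of this arrow with
  \<open>(l, \<theta> l x)\<close> is \<open>(k, \<theta> k x)\<close>. Applying
  \<open>\<kappa>\<close> to this product determines the group component of its image.\<close>

lemma \<sigma>_diff:
  assumes x: "x \<in> topspace X" and k: "k \<in> X.I x" and l: "l \<in> X.I x"
  shows "\<kappa> (k - l, \<theta> k x) = (\<sigma> x k - \<sigma> x l, \<gamma> (\<sigma> x k) (\<phi> x))" "\<theta> k x \<in> D (k - l)"
proof -
  have kl: "x \<in> D (- k)" "x \<in> D (- l)"
    using k l by (simp_all add: orbit_index_def)
  have [simp]: "- (k - l) + k = l"
    by (simp add: minus_diff_eq)
  show dom: "\<theta> k x \<in> D (k - l)"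
    using X.act_in_dom_iff[OF kl(1), of "- (k - l)"] kl(2) by simp
  have act: "\<theta> (- (k - l)) (\<theta> k x) = \<theta> l x"
    using X.act_act[OF kl(1), of "- (k - l)"] kl(2) by simp
  have comp: "((k - l, \<theta> k x), (l, \<theta> l x)) \<in> gcomposable X.groupoid"
    unfolding X.groupoid_composable using dom act \<sigma>(4)[OF x l] by simp
  have "\<kappa> (k, \<theta> k x) = gmul Y.groupoid (\<kappa> (k - l, \<theta> k x)) (\<kappa> (l, \<theta> l x))"
    using groupoid_iso_composable(2)[OF iso comp] by simp
  then have "\<sigma> x k = fst (\<kappa> (k - l, \<theta> k x)) + \<sigma> x l"
    unfolding \<sigma>(1)[OF x k] \<sigma>(1)[OF x l] by (subst (asm) form(2)[OF dom]) simp
  then have "fst (\<kappa> (k - l, \<theta> k x)) = \<sigma> x k - \<sigma> x l"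
    by simp
  then show "\<kappa> (k - l, \<theta> k x) = (\<sigma> x k - \<sigma> x l, \<gamma> (\<sigma> x k) (\<phi> x))"
    using form(2)[OF dom] \<sigma>(3)[OF x k] by metis
qed

lemma \<sigma>_bij:
  assumes x: "x \<in> topspace X"
  shows "bij_betw (\<sigma> x) (X.I x) (Y.I (\<phi> x))"
proof (rule bij_betw_byWitness[where f' = "\<lambda>h. fst (\<kappa>' (h, \<gamma> h (\<phi> x)))"])
  have "fst (\<kappa>' (\<sigma> x k, \<gamma> (\<sigma> x k) (\<phi> x))) = k" if k: "k \<in> X.I x" for k
    using inv(1)[of "(k, \<theta> k x)"] \<sigma>[OF x k] by simp
  then show "\<forall>k\<in>X.I x. fst (\<kappa>' (\<sigma> x k, \<gamma> (\<sigma> x k) (\<phi> x))) = k"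
    by blast
  show "\<sigma> x ` X.I x \<subseteq> Y.I (\<phi> x)"
    using \<sigma>(2)[OF x] by (auto simp: orbit_index_def)
  have inverse: "x \<in> D (- fst (\<kappa>' (h, \<gamma> h (\<phi> x)))) \<and> \<sigma> x (fst (\<kappa>' (h, \<gamma> h (\<phi> x)))) = h" if h: "h \<in> Y.I (\<phi> x)" for h
  proof
    have h': "\<phi> x \<in> E (- h)"
      using h by (simp add: orbit_index_def)
    have dom: "\<gamma> h (\<phi> x) \<in> E h"
      by (rule Y.act_in_dom[OF h'])
    let ?t = "fst (\<kappa>' (h, \<gamma> h (\<phi> x)))"
    have t: "x \<in> D (- ?t)" "\<psi> (\<gamma> h (\<phi> x)) = \<theta> ?t x"
      using swapped.groupoid_iso_cocycle(2)[OF iso'] h' points(1)[OF x] unfolding \<psi>_def by force+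
    show "x \<in> D (- ?t)"
      by fact
    have "\<kappa> (?t, \<theta> ?t x) = (h, \<gamma> h (\<phi> x))"
      using inv(2)[of "(h, \<gamma> h (\<phi> x))"] dom form'(2)[OF dom] t(2) by (metis SigmaI UNIV_I)
    then show "\<sigma> x ?t = h"
      by (simp add: \<sigma>_def)
  qed
  then show "\<forall>h\<in>Y.I (\<phi> x). \<sigma> x (fst (\<kappa>' (h, \<gamma> h (\<phi> x)))) = h"
      "(\<lambda>h. fst (\<kappa>' (h, \<gamma> h (\<phi> x)))) ` Y.I (\<phi> x) \<subseteq> X.I x"
    by (auto simp: orbit_index_def)
qed

lemma skew_map_matrix:
  assumes F: "F \<in> acarrier X.Lc.A" and x: "x \<in> topspace X" and k: "k \<in> X.I x" and l: "l \<in> X.I x"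
  shows "Y.M (\<phi> x) (skew_map F) (\<sigma> x k) (\<sigma> x l) = X.M x F k l"
proof -
  note d = \<sigma>_diff[OF x k l]
  have "(\<sigma> x k - \<sigma> x l, \<gamma> (\<sigma> x k) (\<phi> x)) \<in> Sigma UNIV E"
    using form(3)[OF d(2)] form(2)[OF d(2)] unfolding d(1) by simp
  then have "skew_map F (\<sigma> x k - \<sigma> x l) (\<gamma> (\<sigma> x k) (\<phi> x)) = case_prod F (\<kappa>' (\<kappa> (k - l, \<theta> k x)))"
    unfolding skew_map_apply[OF F] d(1) by simp
  also have "\<dots> = F (k - l) (\<theta> k x)"
    using inv(1)[of "(k - l, \<theta> k x)"] d(2) by simp
  finally show ?thesis
    by (simp add: reg_matrix_def)
qed

lemma skew_map_bij: "bij_betw skew_map (acarrier X.Lc.A) (acarrier Y.Lc.A)"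
  by (rule conjunct1[OF skew_map_iso[unfolded alg_iso_def]])

lemma skew_map_in: "F \<in> acarrier X.Lc.A \<Longrightarrow> skew_map F \<in> acarrier Y.Lc.A"
  by (rule bij_betw_apply[OF skew_map_bij])

lemma skew_map_mat_bounded:
  assumes F: "F \<in> acarrier X.Lc.A" and x: "x \<in> topspace X"
  shows "mat_bounded (X.I x) (X.M x F) C \<longleftrightarrow> mat_bounded (Y.I (\<phi> x)) (Y.M (\<phi> x) (skew_map F)) C"
  by (rule mat_bounded_reindex_iff[of "\<sigma> x" "X.I x" "Y.I (\<phi> x)" "Y.M (\<phi> x) (skew_map F)" "X.M x F",
        OF \<sigma>_bij[OF x] skew_map_matrix[OF F x]])

text \<open>The matrices at \<open>x\<close> and at \<open>\<phi> x\<close> agree up to the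
  relabelling \<open>\<sigma> x\<close>, and \<open>\<phi>\<close> is onto, so both norms are
  governed by the same bounds.\<close>

lemma skew_map_isometric:
  assumes F: "F \<in> acarrier X.Lc.A"
  shows "Y.N (skew_map F) = X.N F"
proof (rule antisym)
  note F' = X.skew_subset[OF F] and G = Y.skew_subset[OF skew_map_in[OF F]]
  show "Y.N (skew_map F) \<le> X.N F"
  proof (rule Y.norm_leI[OF G X.reduced_norm_nonneg[OF F']])
    fix y assume y: "y \<in> topspace Y"
    show "mat_bounded (Y.I y) (Y.M y (skew_map F)) (X.N F)"
      using skew_map_mat_bounded[OF F, of "\<psi> y"] X.norm_mat_bounded[OF F', of "\<psi> y"] points(2)[OF y] by simp
  qed
  show "X.N F \<le> Y.N (skew_map F)"
  proof (rule X.norm_leI[OF F' Y.reduced_norm_nonneg[OF G]])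
    fix x assume x: "x \<in> topspace X"
    show "mat_bounded (X.I x) (X.M x F) (Y.N (skew_map F))"
      using skew_map_mat_bounded[OF F x] Y.norm_mat_bounded[OF G, of "\<phi> x"] points(1)[OF x] by simp
  qed
qed

lemma skew_map_star:
  assumes F: "F \<in> acarrier X.Lc.A"
  shows "skew_map (astar X.CX F) = astar Y.CX (skew_map F)"
proof (intro ext)
  fix h y
  show "skew_map (astar X.CX F) h y = astar Y.CX (skew_map F) h y"
  proof (cases "y \<in> E h")
    case True
    define t where "t = fst (\<kappa>' (h, y))"
    have t: "\<kappa>' (h, y) = (t, \<psi> y)" "\<psi> y \<in> D t" "\<theta> (- t) (\<psi> y) = \<psi> (\<gamma> (- h) y)"
      unfolding t_def by (rule form'(2)[OF True] form'(3)[OF True] form'(4)[OF True])+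
    have dom: "\<gamma> (- h) y \<in> E (- h)"
      by (rule Y.act_neg_in_dom[OF True])
    have y: "y \<in> topspace Y"
      using True Y.dom_subset by blast
    \<comment> \<open>The arrow \<open>(h, y)\<close> times its inverse is a unit. Its image under
      \<open>\<kappa>'\<close> is a unit as well, which identifies the group component of the image
      of the inverse as \<open>- t\<close>.\<close>
    have "((h, y), (- h, \<gamma> (- h) y)) \<in> gcomposable Y.groupoid"
      unfolding Y.groupoid_composable using True dom by simp
    then have "\<kappa>' (0, y) = gmul X.groupoid (\<kappa>' (h, y)) (\<kappa>' (- h, \<gamma> (- h) y))"
      using groupoid_iso_composable(2)[OF iso', of "(h, y)" "(- h, \<gamma> (- h) y)"] by simp
    then have "t + fst (\<kappa>' (- h, \<gamma> (- h) y)) = 0"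
      unfolding form'(1)[OF y] t(1) by (cases "\<kappa>' (- h, \<gamma> (- h) y)") simp
    then have "fst (\<kappa>' (- h, \<gamma> (- h) y)) = - t"
      by (metis minus_unique)
    then have "\<kappa>' (- h, \<gamma> (- h) y) = (- t, \<theta> (- t) (\<psi> y))"
      using form'(2)[OF dom] unfolding t(3) by simp
    then show ?thesis
      using True dom t(1,2) skew_map_apply[OF F] skew_map_apply[OF X.skew_star_closed[OF F]]
      by (simp add: pull_def)
  next
    case False
    then show ?thesis
      unfolding skew_map_apply[OF X.skew_star_closed[OF F]] by (simp add: pull_def)
  qed
qed

lemma skew_map_hom:
  "u \<in> acarrier X.Lc.A \<Longrightarrow> v \<in> acarrier X.Lc.A \<Longrightarrow> skew_map (aadd X.CX u v) = aadd Y.CX (skew_map u) (skew_map v)"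
  "u \<in> acarrier X.Lc.A \<Longrightarrow> v \<in> acarrier X.Lc.A \<Longrightarrow> skew_map (amult X.CX u v) = amult Y.CX (skew_map u) (skew_map v)"
  "u \<in> acarrier X.Lc.A \<Longrightarrow> skew_map (asmult X.CX r u) = asmult Y.CX r (skew_map u)"
  unfolding X.CX_simps Y.CX_simps
  using skew_map_iso[unfolded alg_iso_def, THEN conjunct2, THEN conjunct1, rule_format, of u v]
    skew_map_iso[unfolded alg_iso_def, THEN conjunct2, THEN conjunct2, rule_format, of u r]
  by (simp_all del: crossed_product_simps(1))

lemma skew_closed:
  "u \<in> acarrier X.Lc.A \<Longrightarrow> v \<in> acarrier X.Lc.A \<Longrightarrow> aadd X.CX u v \<in> acarrier X.Lc.A"
  "u \<in> acarrier X.Lc.A \<Longrightarrow> v \<in> acarrier X.Lc.A \<Longrightarrow> amult X.CX u v \<in> acarrier X.Lc.A"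
  "u \<in> acarrier X.Lc.A \<Longrightarrow> asmult X.CX r u \<in> acarrier X.Lc.A"
  using X.Lc.add_closed[of u v] X.Lc.mult_closed[of u v] X.Lc.smult_closed[of u r]
  by (simp_all del: crossed_product_simps(1))

sublocale dense_isometry X.CX X.N Y.CX Y.N "acarrier X.Lc.A" "acarrier Y.Lc.A" skew_map
proof
  show "X.reduced.dense (acarrier X.Lc.A)" "Y.reduced.dense (acarrier Y.Lc.A)"
    by (rule X.skew_dense Y.skew_dense)+
  show "bij_betw skew_map (acarrier X.Lc.A) (acarrier Y.Lc.A)"
    by (rule skew_map_bij)
next
  fix u v assume uv: "u \<in> acarrier X.Lc.A" "v \<in> acarrier X.Lc.A"
  show "adist Y.CX Y.N (skew_map u) (skew_map v) = adist X.CX X.N u v"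
    unfolding adist_def using skew_map_hom(1,3) skew_closed uv skew_map_isometric by metis
qed (rule skew_closed skew_map_hom X.skew_star_closed skew_map_star; assumption)+

lemma skew_map_monomial:
  assumes f: "f \<in> Lc X"
  shows "skew_map (monomial 0 f) = monomial 0 (transport_fun Y \<psi> f)"
proof (intro ext)
  fix h y
  show "skew_map (monomial 0 f) h y = monomial 0 (transport_fun Y \<psi> f) h y"
  proof (cases "y \<in> E h")
    case True
    have y: "y \<in> topspace Y"
      using True Y.dom_subset by blast
    define t where "t = fst (\<kappa>' (h, y))"
    have t: "\<kappa>' (h, y) = (t, \<psi> y)" "\<psi> y \<in> D t"
      unfolding t_def by (rule form'(2)[OF True] form'(3)[OF True] form'(4)[OF True])+
    \<comment> \<open>Units correspond to units under \<open>\<kappa>\<close> and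
      \<open>\<kappa>'\<close>.\<close>
    have "t = 0 \<longleftrightarrow> h = 0"
    proof
      assume "t = 0"
      then show "h = 0"
        using inv(2)[of "(h, y)"] True t form(1) points(2)[OF y] by simp
    next
      assume "h = 0"
      then show "t = 0"
        using form'(1)[OF y] t by simp
    qed
    then show ?thesis
      using True y t skew_map_apply[OF X.monomial_Lc_in[OF f]] by (auto simp: monomial_def transport_fun_def)
  next
    case False
    then show ?thesis
      using skew_map_apply[OF X.monomial_Lc_in[OF f]] Y.dom_unit
      by (auto simp: monomial_def transport_fun_def)
  qed
qed

text \<open>A continuous \<open>f\<close> need not be locally constant, so
  \<open>extension_cls\<close> cannot be applied to the constant sequence representing it. The class
  of \<open>f\<close> is rewritten with uniform locally constant approximants, and their transports
  approximate the transport of \<open>f\<close> equally well.\<close>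

lemma extension_monomial:
  assumes f: "f \<in> C0 X"
  shows "extension (completion_embed X.CX X.N (monomial 0 f)) = completion_embed Y.CX Y.N (monomial 0 (transport_fun Y \<psi> f))"
proof -
  have "\<forall>n. \<exists>f0 \<in> Lc X. \<forall>x. cmod (f x - f0 x) \<le> inverse (real (Suc n)) \<and> (f x = 0 \<longrightarrow> f0 x = 0)"
    using X.Lc_approximates[OF f] by simp
  then obtain s where s: "\<And>n. s n \<in> Lc X" "\<And>n x. cmod (f x - s n x) \<le> inverse (real (Suc n))"
    by metis
  note f' = transport_fun_C0[OF homeo_maps f] and s' = transport_fun_Lc[OF homeo_maps s(1)]
  note lim0 = LIMSEQ_inverse_real_of_nat
  from lim0 have lim: "(\<lambda>n. adist X.CX X.N (monomial 0 f) (monomial 0 (s n))) \<longlonglongrightarrow> 0"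
  proof (rule tendsto_sandwich[rotated 3])
    show "\<forall>\<^sub>F n in sequentially. 0 \<le> adist X.CX X.N (monomial 0 f) (monomial 0 (s n))"
      using X.monomial_C0_in f X.Lc_subset_C0[OF s(1)]
      by (intro always_eventually allI X.reduced.dist_nonneg) (simp_all only: X.CX_simps)
    show "\<forall>\<^sub>F n in sequentially. adist X.CX X.N (monomial 0 f) (monomial 0 (s n)) \<le> inverse (real (Suc n))"
      by (intro always_eventually allI X.monomial_dist_le f X.Lc_subset_C0[OF s(1)] s(2)) simp
  qed simp
  from lim0 have lim': "(\<lambda>n. adist Y.CX Y.N (monomial 0 (transport_fun Y \<psi> f)) (monomial 0 (transport_fun Y \<psi> (s n)))) \<longlonglongrightarrow> 0"
  proof (rule tendsto_sandwich[rotated 3])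
    show "\<forall>\<^sub>F n in sequentially. 0 \<le> adist Y.CX Y.N (monomial 0 (transport_fun Y \<psi> f)) (monomial 0 (transport_fun Y \<psi> (s n)))"
      using Y.monomial_C0_in f' Y.Lc_subset_C0[OF s']
      by (intro always_eventually allI Y.reduced.dist_nonneg) (simp_all only: Y.CX_simps)
    show "\<forall>\<^sub>F n in sequentially. adist Y.CX Y.N (monomial 0 (transport_fun Y \<psi> f)) (monomial 0 (transport_fun Y \<psi> (s n))) \<le> inverse (real (Suc n))"
      by (intro always_eventually allI Y.monomial_dist_le f' Y.Lc_subset_C0[OF s'])
        (use s(2) in \<open>auto simp: transport_fun_def\<close>)
  qed simp
  have m: "monomial 0 f \<in> acarrier X.CX" "\<And>n. monomial 0 (s n) \<in> acarrier X.CX"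
    "monomial 0 (transport_fun Y \<psi> f) \<in> acarrier Y.CX" "\<And>n. monomial 0 (transport_fun Y \<psi> (s n)) \<in> acarrier Y.CX"
    using X.monomial_C0_in f X.Lc_subset_C0[OF s(1)] Y.monomial_C0_in f' Y.Lc_subset_C0[OF s']
    by (simp_all only: X.CX_simps Y.CX_simps)
  note c = X.reduced.Cau_const[OF m(1)] X.reduced.Cau_near[OF X.reduced.Cau_const[OF m(1)] m(2) lim]
  note c' = Y.reduced.Cau_const[OF m(3)] Y.reduced.Cau_near[OF Y.reduced.Cau_const[OF m(3)] m(4) lim']
  have "completion_embed X.CX X.N (monomial 0 f) = X.reduced.cls (\<lambda>n. monomial 0 (s n))"
    unfolding completion_embed_def X.reduced.cls_eq_iff[OF c] by (rule lim)
  then have "extension (completion_embed X.CX X.N (monomial 0 f)) = Y.reduced.cls (\<lambda>n. monomial 0 (transport_fun Y \<psi> (s n)))"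
    using extension_cls[OF c(2) X.monomial_Lc_in[OF s(1)]] skew_map_monomial[OF s(1)] by simp
  also have "\<dots> = completion_embed Y.CX Y.N (monomial 0 (transport_fun Y \<psi> f))"
    unfolding completion_embed_def using Y.reduced.cls_eq_iff[OF c'] lim' by simp
  finally show ?thesis .
qed

lemma reduced_iso:
  "\<exists>\<Phi>. star_alg_iso (reduced_crossed_product X D \<theta>) (reduced_crossed_product Y E \<gamma>) \<Phi> \<and>
    \<Phi> ` C0_subalgebra X D \<theta> = C0_subalgebra Y E \<gamma>"
proof (intro exI conjI)
  show "star_alg_iso (reduced_crossed_product X D \<theta>) (reduced_crossed_product Y E \<gamma>) extension"
    unfolding reduced_crossed_product_def by (rule extension_iso)
  have maps': "homeomorphic_maps Y X \<psi> \<phi>"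
    using homeo_maps homeomorphic_maps_sym by blast
  have "f \<in> transport_fun Y \<psi> ` C0 X" if f: "f \<in> C0 Y" for f
  proof -
    have "f = transport_fun Y \<psi> (transport_fun X \<phi> f)"
      using f by (intro transport_fun_inverse[OF maps', symmetric]) (simp add: C0_def)
    then show ?thesis
      using transport_fun_C0[OF maps' f] by blast
  qed
  then have "transport_fun Y \<psi> ` C0 X = C0 Y"
    using transport_fun_C0[OF homeo_maps] by blast
  moreover have "extension ` C0_subalgebra X D \<theta> =
      (\<lambda>f. completion_embed Y.CX Y.N (monomial 0 f)) ` (transport_fun Y \<psi> ` C0 X)"
    unfolding C0_subalgebra_def image_image using extension_monomial by (intro image_cong) auto
  ultimately show "extension ` C0_subalgebra X D \<theta> = C0_subalgebra Y E \<gamma>"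
    unfolding C0_subalgebra_def by simp
qed

end

section \<open>The reduced crossed product determines the orbit structure\<close>

context clopen_partial_action
begin

text \<open>The coefficient of \<open>\<delta>_h\<close> of an element of the completion, as the
  limit of the coefficients of some representative; \<open>coef_cls\<close> shows that every
  representative gives the same limit.\<close>

definition coef :: "(nat \<Rightarrow> 'g \<Rightarrow> 'x \<Rightarrow> complex) set \<Rightarrow> 'g \<Rightarrow> 'x \<Rightarrow> complex" where
  "coef S h x = lim (\<lambda>n. (SOME s. s \<in> S) n h x)"

lemma Cau_in: "s \<in> reduced.Cau \<Longrightarrow> s n \<in> acarrier C0.A"
  using reduced.CauD by (simp only: CX_simps)

lemma entry_dist_le: "u \<in> acarrier C0.A \<Longrightarrow> v \<in> acarrier C0.A \<Longrightarrow> cmod (u h x - v h x) \<le> adist CX N u v"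
  unfolding adist_diff using entry_le_norm[OF diff_in, of u v h x] by (simp add: diff_def)

text \<open>Coefficients are 1-Lipschitz for the reduced distance. Hence those of the picked
  representative form Cauchy sequences, and those of an equivalent sequence have the same
  limit.\<close>

lemma coef_cls:
  assumes s: "s \<in> reduced.Cau"
  shows "(\<lambda>n. s n h x) \<longlonglongrightarrow> coef (reduced.cls s) h x"
proof -
  define r where "r = (SOME r. r \<in> reduced.cls s)"
  have "r \<in> reduced.cls s"
    unfolding r_def by (rule someI[of "\<lambda>r. r \<in> reduced.cls s", OF reduced.self_in_cls[OF s]])
  then have r: "r \<in> reduced.Cau" "(\<lambda>n. adist CX N (s n) (r n)) \<longlonglongrightarrow> 0"
    using reduced.cls_mem[OF s] by simp_all
  have "Cauchy (\<lambda>n. r n h x)"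
  proof (rule CauchyI)
    fix e :: real assume e: "0 < e"
    obtain K where K: "\<And>m n. m \<ge> K \<Longrightarrow> n \<ge> K \<Longrightarrow> adist CX N (r m) (r n) < e"
      using reduced.CauE[OF r(1) e] by metis
    have "norm (r m h x - r n h x) < e" if "m \<ge> K" "n \<ge> K" for m n
      using entry_dist_le[OF Cau_in[OF r(1)] Cau_in[OF r(1)], of m h x n] K[OF that] by linarith
    then show "\<exists>M. \<forall>m\<ge>M. \<forall>n\<ge>M. norm (r m h x - r n h x) < e"
      by blast
  qed
  then have lim: "(\<lambda>n. r n h x) \<longlonglongrightarrow> coef (reduced.cls s) h x"
    unfolding coef_def r_def[symmetric] by (simp add: Cauchy_convergent_iff convergent_LIMSEQ_iff)
  have "(\<lambda>n. s n h x - r n h x) \<longlonglongrightarrow> 0"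
    by (rule Lim_null_comparison[OF _ r(2)])
      (intro always_eventually allI entry_dist_le Cau_in s r)
  from tendsto_add[OF this lim] show ?thesis
    by simp
qed

lemma coef_eq: "s \<in> reduced.Cau \<Longrightarrow> (\<lambda>n. s n h x) \<longlonglongrightarrow> c \<Longrightarrow> coef (reduced.cls s) h x = c"
  using coef_cls LIMSEQ_unique by blast

lemma coef_supp_open:
  assumes s: "s \<in> reduced.Cau"
  shows "openin X {x \<in> D h. coef (reduced.cls s) h x \<noteq> 0}"
proof (subst openin_subopen, intro ballI)
  fix x assume x: "x \<in> {x \<in> D h. coef (reduced.cls s) h x \<noteq> 0}"
  \<comment> \<open>With a third of the modulus at \<open>x\<close>, a term \<open>s n\<close> that
    is uniformly within \<open>\<epsilon>\<close> of the limit has modulus at least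
    \<open>2 * \<epsilon>\<close> at \<open>x\<close>, and wherever its modulus exceeds
    \<open>\<epsilon>\<close> the limit is nonzero.\<close>
  define \<epsilon> where "\<epsilon> = cmod (coef (reduced.cls s) h x) / 3"
  have e: "0 < \<epsilon>"
    using x by (simp add: \<epsilon>_def)
  obtain n where n: "\<And>m k. m \<ge> n \<Longrightarrow> k \<ge> n \<Longrightarrow> adist CX N (s m) (s k) < \<epsilon>"
    using reduced.CauE[OF s e] by metis
  have near: "cmod (s n h z - coef (reduced.cls s) h z) \<le> \<epsilon>" for z
  proof (rule LIMSEQ_le_const2)
    show "(\<lambda>m. cmod (s n h z - s m h z)) \<longlonglongrightarrow> cmod (s n h z - coef (reduced.cls s) h z)"
      by (intro tendsto_intros coef_cls s)
    have "cmod (s n h z - s m h z) \<le> \<epsilon>" if "m \<ge> n" for m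
      using entry_dist_le[OF Cau_in[OF s] Cau_in[OF s], of n h z m] n[of n m] that by linarith
    then show "\<exists>K. \<forall>m\<ge>K. cmod (s n h z - s m h z) \<le> \<epsilon>"
      by blast
  qed
  define P where "P = {z \<in> topspace X. s n h z \<in> {c. \<epsilon> < cmod c}}"
  have "open {c. \<epsilon> < cmod c}"
    by (intro open_Collect_less continuous_intros)
  moreover have "continuous_map X euclidean (s n h)"
    using carrierD(2)[OF Cau_in[OF s]] by (simp add: C0_def)
  ultimately have "openin X P"
    unfolding P_def by (intro openin_continuous_map_preimage[of X euclidean]) simp_all
  moreover have "x \<in> P"
  proof -
    have "3 * \<epsilon> = cmod (coef (reduced.cls s) h x)"
      by (simp add: \<epsilon>_def)
    also have "\<dots> \<le> cmod (s n h x) + cmod (s n h x - coef (reduced.cls s) h x)"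
      by (rule norm_triangle_sub[of "coef (reduced.cls s) h x" "s n h x", unfolded norm_minus_commute])
    finally have "\<epsilon> < cmod (s n h x)"
      using near[of x] e by linarith
    then show ?thesis
      unfolding P_def using x dom_subset by blast
  qed
  moreover have "P \<subseteq> {x \<in> D h. coef (reduced.cls s) h x \<noteq> 0}"
  proof
    fix z assume "z \<in> P"
    then have z: "\<epsilon> < cmod (s n h z)"
      by (simp add: P_def)
    have "z \<in> D h"
      using carrierD(3)[OF Cau_in[OF s], of z h n] z e by fastforce
    moreover have "coef (reduced.cls s) h z \<noteq> 0"
      using near[of z] z by auto
    ultimately show "z \<in> {x \<in> D h. coef (reduced.cls s) h x \<noteq> 0}"
      by blast
  qed
  ultimately show "\<exists>T. openin X T \<and> x \<in> T \<and> T \<subseteq> {x \<in> D h. coef (reduced.cls s) h x \<noteq> 0}"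
    by blast
qed

text \<open>The limit of these columns is \<open>\<pi>\<^sub>x(u) e\<^sub>0\<close>, whose entries are the coefficients of \<open>u\<close> along the orbit
  of \<open>x\<close>.\<close>

lemma column_small:
  assumes s: "s \<in> reduced.Cau" and x: "x \<in> topspace X"
    and zero: "\<And>k. k \<in> I x \<Longrightarrow> coef (reduced.cls s) k (\<theta> k x) = 0" and e: "0 < \<epsilon>"
  obtains n0 where "\<And>n K. n \<ge> n0 \<Longrightarrow> finite K \<Longrightarrow> K \<subseteq> I x \<Longrightarrow> L2_set (\<lambda>k. cmod (M x (s n) k 0)) K \<le> \<epsilon>"
proof -
  obtain n0 where n0: "\<And>m n. m \<ge> n0 \<Longrightarrow> n \<ge> n0 \<Longrightarrow> adist CX N (s m) (s n) < \<epsilon>"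
    using reduced.CauE[OF s e] by metis
  have I0: "0 \<in> I x"
    using x by (simp add: orbit_index_def dom_unit)
  \<comment> \<open>The column of \<open>s n\<close> is at most \<open>\<epsilon>\<close> plus the
    column of \<open>s m\<close>. On the finite set \<open>K\<close> the latter tends to 0 as
    \<open>m\<close> grows, and the bound does not depend on \<open>K\<close>.\<close>
  have "L2_set (\<lambda>k. cmod (M x (s n) k 0)) K \<le> \<epsilon>" if n: "n \<ge> n0" and K: "finite K" "K \<subseteq> I x" for n K
  proof (rule LIMSEQ_le_const)
    have "(\<lambda>m. cmod (M x (s m) k 0)) \<longlonglongrightarrow> 0" if "k \<in> K" for k
    proof -
      have "k \<in> I x"
        using K that by blast
      from coef_cls[OF s, of k "\<theta> k x"] show ?thesis
        unfolding zero[OF \<open>k \<in> I x\<close>] by (auto simp: reg_matrix_def intro: tendsto_norm_zero)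
    qed
    then have "(\<lambda>m. sqrt (\<Sum>k\<in>K. (cmod (M x (s m) k 0))\<^sup>2)) \<longlonglongrightarrow> sqrt (\<Sum>k\<in>K. 0\<^sup>2)"
      by (intro tendsto_intros)
    then have "(\<lambda>m. \<epsilon> + L2_set (\<lambda>k. cmod (M x (s m) k 0)) K) \<longlonglongrightarrow> \<epsilon> + 0"
      by (intro tendsto_add tendsto_const) (simp add: L2_set_def)
    then show "(\<lambda>m. \<epsilon> + L2_set (\<lambda>k. cmod (M x (s m) k 0)) K) \<longlonglongrightarrow> \<epsilon>"
      by simp
    have "L2_set (\<lambda>k. cmod (M x (s n) k 0)) K \<le> \<epsilon> + L2_set (\<lambda>k. cmod (M x (s m) k 0)) K" if m: "m \<ge> n0" for m
    proof -
      note dm = diff_in[OF Cau_in[OF s, of n] Cau_in[OF s, of m]]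
      have "L2_set (\<lambda>k. cmod (M x (s n) k 0)) K \<le>
          L2_set (\<lambda>k. cmod (M x (diff (s n) (s m)) k 0) + cmod (M x (s m) k 0)) K"
      proof (rule L2_set_mono)
        fix k
        show "cmod (M x (s n) k 0) \<le> cmod (M x (diff (s n) (s m)) k 0) + cmod (M x (s m) k 0)"
          unfolding reg_matrix_diff using norm_triangle_ineq[of "M x (s n) k 0 - M x (s m) k 0" "M x (s m) k 0"] by simp
      qed simp
      also have "\<dots> \<le> L2_set (\<lambda>k. cmod (M x (diff (s n) (s m)) k 0)) K + L2_set (\<lambda>k. cmod (M x (s m) k 0)) K"
        by (rule L2_set_triangle_ineq)
      also have "L2_set (\<lambda>k. cmod (M x (diff (s n) (s m)) k 0)) K \<le> N (diff (s n) (s m))"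
        by (rule mat_bounded_column[OF norm_mat_bounded[OF dm x] K I0 reduced_norm_nonneg[OF dm]])
      also have "N (diff (s n) (s m)) \<le> \<epsilon>"
        using n0[OF n m] unfolding adist_diff by simp
      finally show ?thesis
        by simp
    qed
    then show "\<exists>n1. \<forall>m\<ge>n1. L2_set (\<lambda>k. cmod (M x (s n) k 0)) K \<le> \<epsilon> + L2_set (\<lambda>k. cmod (M x (s m) k 0)) K"
      by blast
  qed
  then show ?thesis
    by (rule that)
qed

text \<open>The value in question is the entry at \<open>(0, 0)\<close> of a matrix product, that
  is, row 0 of \<open>t n\<close> paired with column 0 of \<open>s n\<close>. Cauchy-Schwarz bounds
  it by the bounded norms of the \<open>t n\<close> times the column norms, which tend to 0 by
  \<open>column_small\<close>.\<close>

lemma product_entry_vanishes: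
  assumes s: "s \<in> reduced.Cau" and t: "t \<in> reduced.Cau" and x: "x \<in> topspace X"
    and zero: "\<And>k. k \<in> I x \<Longrightarrow> coef (reduced.cls s) k (\<theta> k x) = 0"
  shows "(\<lambda>n. cp_mult D \<theta> (t n) (s n) 0 x) \<longlonglongrightarrow> 0"
proof (rule LIMSEQ_I)
  fix r :: real assume r: "0 < r"
  obtain B where B: "\<And>n. N (t n) \<le> B" "0 \<le> B"
    using reduced.Cau_bounded[OF t] by metis
  \<comment> \<open>\<open>B + 1\<close> is positive even for \<open>B = 0\<close>, and the factor 2
    leaves \<open>r / 2\<close>, which is strictly below \<open>r\<close>.\<close>
  have e: "0 < r / (2 * (B + 1))"
    using r B(2) by simp
  obtain n0 where n0: "\<And>n K. n \<ge> n0 \<Longrightarrow> finite K \<Longrightarrow> K \<subseteq> I x \<Longrightarrow>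
      L2_set (\<lambda>k. cmod (M x (s n) k 0)) K \<le> r / (2 * (B + 1))"
    using column_small[OF s x zero e] by metis
  have I0: "{0} \<subseteq> I x"
    using x by (simp add: orbit_index_def dom_unit)
  have "cmod (cp_mult D \<theta> (t n) (s n) 0 x) < r" if n: "n \<ge> n0" for n
  proof -
    note tn = Cau_in[OF t, of n] and sn = Cau_in[OF s, of n]
    let ?J = "{j \<in> (\<lambda>(g, k). - g + k) ` (fsupp (t n) \<times> {0}). j \<in> I x}"
    have J: "finite ?J" "?J \<subseteq> I x"
      using carrierD(1)[OF tn] by auto
    have "cp_mult D \<theta> (t n) (s n) 0 x = M x (cp_mult D \<theta> (t n) (s n)) 0 0"
      using act_unit[OF x] by (simp add: reg_matrix_def)
    also have "\<dots> = (\<Sum>j\<in>?J. M x (t n) 0 j * M x (s n) j 0)"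
      by (rule reg_matrix_mult[OF carrierD(1)[OF tn] order_refl carrierD(3)[OF tn] carrierD(1)[OF sn] I0]) simp_all
    finally have "cmod (cp_mult D \<theta> (t n) (s n) 0 x) \<le> (\<Sum>j\<in>?J. \<bar>cmod (M x (t n) 0 j)\<bar> * \<bar>cmod (M x (s n) j 0)\<bar>)"
      using norm_sum[of "\<lambda>j. M x (t n) 0 j * M x (s n) j 0" ?J] by (simp add: norm_mult)
    also have "\<dots> \<le> L2_set (\<lambda>j. cmod (M x (t n) 0 j)) ?J * L2_set (\<lambda>j. cmod (M x (s n) j 0)) ?J"
      by (rule L2_set_mult_ineq)
    also have "\<dots> \<le> (B + 1) * (r / (2 * (B + 1)))"
    proof (rule mult_mono)
      have "L2_set (\<lambda>j. cmod (M x (t n) 0 j)) ?J \<le> N (t n)"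
        using I0 by (intro mat_bounded_row[OF norm_mat_bounded[OF tn x] J _ reduced_norm_nonneg[OF tn]]) simp
      then show "L2_set (\<lambda>j. cmod (M x (t n) 0 j)) ?J \<le> B + 1"
        using B(1)[of n] by linarith
    qed (use n0[OF n J] B(2) in \<open>simp_all add: L2_set_nonneg\<close>)
    also have "\<dots> < r"
      using r B(2) mult_nonneg_nonneg[of B r] by (simp add: field_simps add_pos_nonneg)
    finally show ?thesis .
  qed
  then show "\<exists>no. \<forall>n\<ge>no. norm (cp_mult D \<theta> (t n) (s n) 0 x - 0) < r"
    by auto
qed

abbreviation RX where "RX \<equiv> completion CX N"

definition reduced_monomial where
  "reduced_monomial g U = completion_embed CX N (indicator_monomial g U)"

lemma indicator_monomial_in:
  assumes "compact_open X U" "U \<subseteq> D g"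
  shows "indicator_monomial g U \<in> acarrier CX"
  unfolding CX_simps(1) indicator_monomial_def
  using indicator_in_Lc[OF stone_space_axioms assms(1)] assms(2)
  by (intro skew_subset Lc.monomial_closed) auto

lemma reduced_mult_right:
  assumes s: "s \<in> reduced.Cau" and v: "v \<in> acarrier CX"
  shows "(\<lambda>n. cp_mult D \<theta> (s n) v) \<in> reduced.Cau"
    and "amult RX (reduced.cls s) (completion_embed CX N v) = reduced.cls (\<lambda>n. cp_mult D \<theta> (s n) v)"
  using reduced.completion_mult[OF s reduced.Cau_const[OF v]] by (simp_all add: completion_embed_def)

lemma reduced_mult_left:
  assumes s: "s \<in> reduced.Cau" and v: "v \<in> acarrier CX"
  shows "(\<lambda>n. cp_mult D \<theta> v (s n)) \<in> reduced.Cau"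
    and "amult RX (completion_embed CX N v) (reduced.cls s) = reduced.cls (\<lambda>n. cp_mult D \<theta> v (s n))"
  using reduced.completion_mult[OF reduced.Cau_const[OF v] s] by (simp_all add: completion_embed_def)

lemma embed_in: "v \<in> acarrier CX \<Longrightarrow> completion_embed CX N v \<in> acarrier RX"
  unfolding completion_embed_def by (intro reduced.cls_in reduced.Cau_const)

lemma coef_embed: "v \<in> acarrier CX \<Longrightarrow> coef (completion_embed CX N v) h x = v h x"
  unfolding completion_embed_def by (intro coef_eq reduced.Cau_const tendsto_const)

text \<open>The coefficient at 0 recovers \<open>f\<close> from its class in the completion, so
  idempotence in the completion gives \<open>f x * f x = f x\<close> at each point of the
  space.\<close>

lemma reduced_Diag_idempotent:
  assumes u: "u \<in> C0_subalgebra X D \<theta>" and idem: "amult RX u u = u"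
  shows "\<exists>U. compact_open X U \<and> u = reduced_monomial 0 U"
proof -
  obtain f where f: "f \<in> C0 X" "u = completion_embed CX N (monomial 0 f)"
    using u unfolding C0_subalgebra_def by blast
  have m: "monomial 0 f \<in> acarrier CX"
    using monomial_C0_in[OF f(1)] by (simp only: CX_simps)
  have van: "f x = 0" if "x \<notin> topspace X" for x
    using f(1) that by (simp add: C0_def)
  have val: "f x = 0 \<or> f x = 1" for x
  proof (cases "x \<in> topspace X")
    case True
    have "coef (amult RX u u) 0 x = cp_mult D \<theta> (monomial 0 f) (monomial 0 f) 0 x"
      unfolding f(2) completion_embed_def
      using reduced.completion_mult[OF reduced.Cau_const[OF m] reduced.Cau_const[OF m]]
      by (simp add: coef_eq)
    also have "\<dots> = f x * f x"
      using van act_unit[OF True] fsupp_monomial_finite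
      by (subst cp_mult_monomial_left) (auto simp: monomial_def dom_unit)
    finally have "coef u 0 x = f x * f x"
      unfolding idem .
    moreover have "coef u 0 x = f x"
      unfolding f(2) coef_embed[OF m] by (simp add: monomial_def)
    ultimately show ?thesis
      by simp
  qed (simp add: van)
  define U where "U = {x \<in> topspace X. f x \<noteq> 0}"
  have "continuous_map X euclidean f"
    using f by (simp add: C0_def)
  then have "openin X {x \<in> topspace X. f x \<in> - {0}}"
    by (rule openin_continuous_map_preimage) (simp add: open_Compl)
  \<comment> \<open>Since \<open>f\<close> takes only the values 0 and 1, its support is the level
    set at 1, which is compact because \<open>f\<close> vanishes at infinity.\<close>
  moreover have "U = {x \<in> topspace X. cmod (f x) \<ge> 1}"
    unfolding U_def
  proof (intro Collect_cong conj_cong refl)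
    fix x
    show "f x \<noteq> 0 \<longleftrightarrow> 1 \<le> cmod (f x)"
      using val[of x] by (elim disjE) simp_all
  qed
  then have "compactin X U"
    using C0_level[OF f(1) zero_less_one] by simp
  ultimately have "compact_open X U"
    unfolding compact_open_def U_def by simp
  moreover have "f = (\<lambda>x. if x \<in> U then 1 else 0)"
  proof
    fix x show "f x = (if x \<in> U then 1 else 0)"
      using val[of x] van[of x] unfolding U_def by auto
  qed
  then have "u = reduced_monomial 0 U"
    unfolding reduced_monomial_def indicator_monomial_def f(2) by simp
  ultimately show ?thesis
    by blast
qed

lemma reduced_coefficient_algebra:
  "coefficient_algebra X D \<theta> (acarrier RX) (amult RX) (C0_subalgebra X D \<theta>) reduced_monomial
    (\<lambda>u h. {x \<in> D h. coef u h x \<noteq> 0})"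
proof
  fix u v assume "u \<in> acarrier RX" "v \<in> acarrier RX"
  then obtain s t where "s \<in> reduced.Cau" "u = reduced.cls s" "t \<in> reduced.Cau" "v = reduced.cls t"
    using reduced.completion_cases by metis
  then show "amult RX u v \<in> acarrier RX"
    using reduced.completion_mult by (simp add: reduced.cls_in)
next
  fix U g assume "compact_open X U" "U \<subseteq> D g"
  then show "reduced_monomial g U \<in> acarrier RX"
    unfolding reduced_monomial_def by (intro embed_in indicator_monomial_in)
next
  show "C0_subalgebra X D \<theta> \<subseteq> acarrier RX"
    unfolding C0_subalgebra_def using monomial_C0_in embed_in by (auto simp del: crossed_product_simps(1))
next
  fix U assume "compact_open X U"
  then show "reduced_monomial 0 U \<in> C0_subalgebra X D \<theta>"
    unfolding reduced_monomial_def indicator_monomial_def C0_subalgebra_def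
    using Lc_subset_C0 indicator_in_Lc[OF stone_space_axioms] by blast
next
  fix u assume "u \<in> C0_subalgebra X D \<theta>" "amult RX u u = u"
  then show "\<exists>U. compact_open X U \<and> u = reduced_monomial 0 U"
    by (rule reduced_Diag_idempotent)
next
  fix U V g h assume U: "compact_open X U" "U \<subseteq> D g" and V: "compact_open X V" "V \<subseteq> D h"
  show "amult RX (reduced_monomial g U) (reduced_monomial h V) = reduced_monomial (g + h) (U \<inter> {x \<in> D g. \<theta> (- g) x \<in> V})"
    using reduced_mult_right(2)[OF reduced.Cau_const[OF indicator_monomial_in[OF U]] indicator_monomial_in[OF V]]
    unfolding reduced_monomial_def cp_mult_indicator[OF U(2)] completion_embed_def .
next
  fix U assume U: "compact_open X U"
  then have "U \<subseteq> D 0"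
    using compact_open_subset by (simp add: dom_unit)
  then show "{x \<in> D 0. coef (reduced_monomial 0 U) 0 x \<noteq> 0} = U"
    unfolding reduced_monomial_def coef_embed[OF indicator_monomial_in[OF U \<open>U \<subseteq> D 0\<close>]]
    by (auto simp: indicator_monomial_def monomial_def)
next
  fix u h assume "u \<in> acarrier RX"
  then obtain s where "s \<in> reduced.Cau" "u = reduced.cls s"
    using reduced.completion_cases by metis
  then show "openin X {x \<in> D h. coef u h x \<noteq> 0}"
    using coef_supp_open by simp
next
  fix u V h assume "u \<in> acarrier RX" and V: "compact_open X V"
  then obtain s where s: "s \<in> reduced.Cau" "u = reduced.cls s"
    using reduced.completion_cases by metis
  have "V \<subseteq> D 0"
    using compact_open_subset[OF V] by (simp add: dom_unit)
  note v = indicator_monomial_in[OF V this]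
  have "coef (amult RX u (reduced_monomial 0 V)) h x = coef u h x * (if \<theta> (- h) x \<in> V then 1 else 0)" for x
    unfolding reduced_monomial_def s(2) reduced_mult_right(2)[OF s(1) v]
  proof (rule coef_eq[OF reduced_mult_right(1)[OF s(1) v]])
    have "cp_mult D \<theta> (s n) (indicator_monomial 0 V) h x = s n h x * (if \<theta> (- h) x \<in> V then 1 else 0)" for n
      unfolding indicator_monomial_def
      by (rule cp_mult_monomial_zero_right[OF carrierD(3)[OF Cau_in[OF s(1)]] carrierD(1)[OF Cau_in[OF s(1)]]])
    then show "(\<lambda>n. cp_mult D \<theta> (s n) (indicator_monomial 0 V) h x) \<longlonglongrightarrow>
        coef (reduced.cls s) h x * (if \<theta> (- h) x \<in> V then 1 else 0)"
      using tendsto_mult[OF coef_cls[OF s(1)] tendsto_const] by simp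
  qed
  then show "{x \<in> D h. coef (amult RX u (reduced_monomial 0 V)) h x \<noteq> 0} =
      {x \<in> D h. coef u h x \<noteq> 0} \<inter> {x. \<theta> (- h) x \<in> V}"
    by auto
next
  fix u V h assume "u \<in> acarrier RX" and V: "compact_open X V"
  then obtain s where s: "s \<in> reduced.Cau" "u = reduced.cls s"
    using reduced.completion_cases by metis
  have V0: "V \<subseteq> D 0"
    using compact_open_subset[OF V] by (simp add: dom_unit)
  note v = indicator_monomial_in[OF V V0]
  \<comment> \<open>Left multiplication evaluates \<open>u\<close> at
    \<open>\<theta> (- 0) x\<close>, which is known to be \<open>x\<close> only inside the space;
    hence the restriction to \<open>D h\<close>.\<close>
  have "coef (amult RX (reduced_monomial 0 V) u) h x = (if x \<in> V then 1 else 0) * coef u h x"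
    if x: "x \<in> D h" for x
    unfolding reduced_monomial_def s(2) reduced_mult_left(2)[OF s(1) v]
  proof (rule coef_eq[OF reduced_mult_left(1)[OF s(1) v]])
    have "cp_mult D \<theta> (indicator_monomial 0 V) (s n) h x = (if x \<in> V then 1 else 0) * s n h x" for n
      unfolding indicator_monomial_def using V0 act_unit[OF subsetD[OF dom_subset x]]
      by (subst cp_mult_monomial_left[OF _ carrierD(1)[OF Cau_in[OF s(1)]]]) auto
    then show "(\<lambda>n. cp_mult D \<theta> (indicator_monomial 0 V) (s n) h x) \<longlonglongrightarrow>
        (if x \<in> V then 1 else 0) * coef (reduced.cls s) h x"
      using tendsto_mult[OF tendsto_const coef_cls[OF s(1)]] by simp
  qed
  then show "{x \<in> D h. coef (amult RX (reduced_monomial 0 V) u) h x \<noteq> 0} = V \<inter> {x \<in> D h. coef u h x \<noteq> 0}"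
    by (auto split: if_splits)
next
  fix u u' W x
  assume "u \<in> acarrier RX" "u' \<in> acarrier RX" and W: "compact_open X W" "x \<in> W"
    and eq: "amult RX u' u = reduced_monomial 0 W"
  then obtain s t where st: "s \<in> reduced.Cau" "u = reduced.cls s" "t \<in> reduced.Cau" "u' = reduced.cls t"
    using reduced.completion_cases by metis
  have x: "x \<in> topspace X" and W0: "W \<subseteq> D 0"
    using W compact_open_subset by (auto simp: dom_unit)
  note m = reduced.completion_mult[OF st(3,1), unfolded CX_simps(3)]
  show "\<exists>h. x \<in> D (- h) \<and> \<theta> h x \<in> {x \<in> D h. coef u h x \<noteq> 0}"
  proof (rule ccontr)
    assume no: "\<nexists>h. x \<in> D (- h) \<and> \<theta> h x \<in> {x \<in> D h. coef u h x \<noteq> 0}"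
    have "coef (reduced.cls s) k (\<theta> k x) = 0" if "k \<in> I x" for k
      using no that act_in_dom[of x k] unfolding orbit_index_def st(2) by blast
    from product_entry_vanishes[OF st(1,3) x this]
    have "coef (amult RX u' u) 0 x = 0"
      unfolding st(2,4) m(2) by (intro coef_eq[OF m(1)])
    then show False
      unfolding eq reduced_monomial_def coef_embed[OF indicator_monomial_in[OF W(1) W0]]
      using W(2) by (simp add: indicator_monomial_def monomial_def)
  qed
qed

end

section \<open>The equivalence\<close>

context clopen_pair
begin

lemma groupoid_iso_witness:
  assumes "groupoid_iso X.groupoid Y.groupoid \<kappa>"
  obtains \<kappa>' where "groupoid_iso_pair X D \<theta> Y E \<gamma> \<kappa> \<kappa>'"
proof -
  obtain \<kappa>' where "homeomorphic_maps (gtop X.groupoid) (gtop Y.groupoid) \<kappa> \<kappa>'" "groupoid_iso Y.groupoid X.groupoid \<kappa>'"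
    by (rule groupoid_iso_inverse[OF assms X.groupoid_is_closed]) (rule that)
  then have "groupoid_iso_pair X D \<theta> Y E \<gamma> \<kappa> \<kappa>'"
    using assms by unfold_locales
  then show ?thesis
    by (rule that)
qed

lemma groupoid_iso_imp_steinberg_iso:
  assumes "groupoid_iso X.groupoid Y.groupoid \<kappa>"
  shows "\<exists>\<Gamma> :: ('g \<times> 'x \<Rightarrow> 'r::comm_ring_1) \<Rightarrow> ('h \<times> 'y \<Rightarrow> 'r).
    alg_iso (steinberg_algebra X.groupoid) (steinberg_algebra Y.groupoid) \<Gamma> \<and>
    \<Gamma> ` steinberg_diagonal X.groupoid = steinberg_diagonal Y.groupoid"
proof -
  obtain \<kappa>' where "homeomorphic_maps (gtop X.groupoid) (gtop Y.groupoid) \<kappa> \<kappa>'" "groupoid_iso Y.groupoid X.groupoid \<kappa>'"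
    by (rule groupoid_iso_inverse[OF assms X.groupoid_is_closed]) (rule that)
  then show ?thesis
    using groupoid_iso_steinberg[OF assms _ X.groupoid_is_closed Y.groupoid_is_closed] by blast
qed

text \<open>Conjugation of \<open>\<Gamma>\<close> by currying on both sides. The monomials at 0
  correspond to the Steinberg diagonals, so the condition on diagonals carries over.\<close>

lemma steinberg_iso_imp_skew_iso:
  fixes \<Gamma> :: "('g \<times> 'x \<Rightarrow> 'r::comm_ring_1) \<Rightarrow> ('h \<times> 'y \<Rightarrow> 'r)"
  assumes \<Gamma>: "alg_iso (steinberg_algebra X.groupoid) (steinberg_algebra Y.groupoid) \<Gamma>"
    and diag: "\<Gamma> ` steinberg_diagonal X.groupoid = steinberg_diagonal Y.groupoid"
  shows "\<exists>\<Phi> :: ('g \<Rightarrow> 'x \<Rightarrow> 'r) \<Rightarrow> ('h \<Rightarrow> 'y \<Rightarrow> 'r).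
    alg_iso (partial_skew_group_ring X D \<theta>) (partial_skew_group_ring Y E \<gamma>) \<Phi> \<and>
    \<Phi> ` (monomial 0 ` Lc X) = monomial 0 ` Lc Y"
proof -
  interpret LY: coefficient_functions Y E \<gamma> "Lc Y :: ('y \<Rightarrow> 'r) set"
    by (rule Y.Lc_coefficient_functions[OF Y.clopen])
  let ?S = "acarrier (partial_skew_group_ring Y E \<gamma> :: ('r, 'h \<Rightarrow> 'y \<Rightarrow> 'r) alg)"
  let ?\<Psi> = "the_inv_into ?S case_prod"
  note uX = X.uncurry_iso[OF X.clopen, where 'r = 'r] and uY = Y.uncurry_iso[OF Y.clopen, where 'r = 'r]
  have "alg_iso (partial_skew_group_ring X D \<theta>) (partial_skew_group_ring Y E \<gamma>) (?\<Psi> \<circ> (\<Gamma> \<circ> case_prod))"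
    by (rule alg_iso_compose[OF alg_iso_compose[OF uX \<Gamma>] alg_iso_inverse[OF uY Y.skew_group_ring_closed[OF Y.clopen]]])
  moreover have "(?\<Psi> \<circ> (\<Gamma> \<circ> case_prod)) ` (monomial 0 ` Lc X) = monomial 0 ` Lc Y"
  proof -
    have "(?\<Psi> \<circ> (\<Gamma> \<circ> case_prod)) ` (monomial 0 ` Lc X) = ?\<Psi> ` (\<Gamma> ` (case_prod ` (monomial 0 ` Lc X)))"
      by (simp only: image_comp o_assoc)
    also have "\<dots> = ?\<Psi> ` (case_prod ` (monomial 0 ` Lc Y))"
      unfolding X.uncurry_diagonal diag Y.uncurry_diagonal ..
    also have "\<dots> = (\<lambda>u. ?\<Psi> (case_prod u)) ` (monomial 0 ` Lc Y)"
      by (rule image_image)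
    also have "\<dots> = (\<lambda>u. u) ` (monomial 0 ` Lc Y)"
    proof (rule image_cong[OF refl])
      fix u :: "'h \<Rightarrow> 'y \<Rightarrow> 'r" assume "u \<in> monomial 0 ` Lc Y"
      then have "u \<in> ?S"
        unfolding partial_skew_group_ring_def
        using LY.monomial_closed[of _ 0] by (auto simp: Lc_def Y.dom_unit simp del: crossed_product_simps)
      moreover have "inj_on case_prod ?S"
        by (rule inj_onI) (metis curry_case_prod)
      ultimately show "?\<Psi> (case_prod u) = u"
        by (rule the_inv_into_f_f[rotated])
    qed
    finally show ?thesis
      by simp
  qed
  ultimately show ?thesis
    by blast
qed

lemma skew_iso_orbit_maps:
  fixes \<Phi> :: "('g \<Rightarrow> 'x \<Rightarrow> 'r::idom) \<Rightarrow> ('h \<Rightarrow> 'y \<Rightarrow> 'r)"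
  assumes iso: "alg_iso (partial_skew_group_ring X D \<theta>) (partial_skew_group_ring Y E \<gamma>) \<Phi>"
    and diag: "\<Phi> ` (monomial 0 ` Lc X) = monomial 0 ` Lc Y"
  obtains \<phi> \<psi> where "homeomorphic_maps X Y \<phi> \<psi>" "orbit_map X D \<theta> E \<gamma> \<phi>" "orbit_map Y E \<gamma> D \<theta> \<psi>"
proof (rule diagonal_iso_orbit_maps)
  show "coefficient_algebra X D \<theta> (acarrier (crossed_product (Lc X :: ('x \<Rightarrow> 'r) set) D \<theta>))
      (cp_mult D \<theta>) (monomial 0 ` Lc X) X.indicator_monomial (\<lambda>u h. {x \<in> D h. u h x \<noteq> 0})"
    by (rule X.skew_coefficient_algebra[OF X.stone_space_axioms X.clopen])
  show "coefficient_algebra Y E \<gamma> (acarrier (crossed_product (Lc Y :: ('y \<Rightarrow> 'r) set) E \<gamma>))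
      (cp_mult E \<gamma>) (monomial 0 ` Lc Y) Y.indicator_monomial (\<lambda>u h. {x \<in> E h. u h x \<noteq> 0})"
    by (rule Y.skew_coefficient_algebra[OF Y.stone_space_axioms Y.clopen])
  note i = iso[unfolded alg_iso_def partial_skew_group_ring_def]
  show "bij_betw \<Phi> (acarrier (crossed_product (Lc X) D \<theta>)) (acarrier (crossed_product (Lc Y) E \<gamma>))"
    by (rule conjunct1[OF i])
  show "\<Phi> (cp_mult D \<theta> u v) = cp_mult E \<gamma> (\<Phi> u) (\<Phi> v)"
    if "u \<in> acarrier (crossed_product (Lc X) D \<theta>)" "v \<in> acarrier (crossed_product (Lc X) D \<theta>)" for u v
    using bspec[OF bspec[OF i[THEN conjunct2, THEN conjunct1] that(1)] that(2)]
    unfolding crossed_product_simps(3) by (rule conjunct2)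
qed (rule diag, rule that)

lemma reduced_iso_orbit_maps:
  assumes iso: "star_alg_iso (reduced_crossed_product X D \<theta>) (reduced_crossed_product Y E \<gamma>) \<Phi>"
    and diag: "\<Phi> ` C0_subalgebra X D \<theta> = C0_subalgebra Y E \<gamma>"
  obtains \<phi> \<psi> where "homeomorphic_maps X Y \<phi> \<psi>" "orbit_map X D \<theta> E \<gamma> \<phi>" "orbit_map Y E \<gamma> D \<theta> \<psi>"
proof (rule diagonal_iso_orbit_maps[OF X.reduced_coefficient_algebra Y.reduced_coefficient_algebra])
  note i = iso[unfolded star_alg_iso_def alg_iso_def reduced_crossed_product_def, THEN conjunct1]
  show "bij_betw \<Phi> (acarrier X.RX) (acarrier Y.RX)"
    by (rule conjunct1[OF i])
  show "\<Phi> (amult X.RX u v) = amult Y.RX (\<Phi> u) (\<Phi> v)"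
    if "u \<in> acarrier X.RX" "v \<in> acarrier X.RX" for u v
    using bspec[OF bspec[OF i[THEN conjunct2, THEN conjunct1] that(1)] that(2)] by (rule conjunct2)
qed (rule diag, rule that)

end

theorem theorem4p9:
  fixes X :: "'x topology" and D :: "'g::group_add \<Rightarrow> 'x set" and \<theta> :: "'g \<Rightarrow> 'x \<Rightarrow> 'x"
    and Y :: "'y topology" and E :: "'h::group_add \<Rightarrow> 'y set" and \<gamma> :: "'h \<Rightarrow> 'y \<Rightarrow> 'y"
  assumes "totally_disconnected_space X" "locally_compact_space X" "Hausdorff_space X"
    and "totally_disconnected_space Y" "locally_compact_space Y" "Hausdorff_space Y"
    and "partial_action X D \<theta>" "\<And>g. closedin X (D g)"
    and "partial_action Y E \<gamma>" "\<And>h. closedin Y (E h)"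
  shows
    "(topologically_free X D \<theta> \<and> topologically_free Y E \<gamma> \<longrightarrow>
        (continuously_orbit_equivalent X D \<theta> Y E \<gamma> \<longleftrightarrow>
          (\<exists>\<kappa>. groupoid_iso (transformation_groupoid X D \<theta>) (transformation_groupoid Y E \<gamma>) \<kappa>)) \<and>
        (continuously_orbit_equivalent X D \<theta> Y E \<gamma> \<longleftrightarrow>
          (\<exists>\<Gamma> :: ('g \<times> 'x \<Rightarrow> 'r::idom) \<Rightarrow> ('h \<times> 'y \<Rightarrow> 'r).
            alg_iso (steinberg_algebra (transformation_groupoid X D \<theta>))
                    (steinberg_algebra (transformation_groupoid Y E \<gamma>)) \<Gamma> \<and>
            \<Gamma> ` steinberg_diagonal (transformation_groupoid X D \<theta>)
              = steinberg_diagonal (transformation_groupoid Y E \<gamma>))) \<and>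
        (continuously_orbit_equivalent X D \<theta> Y E \<gamma> \<longleftrightarrow>
          (\<exists>\<Phi> :: ('g \<Rightarrow> 'x \<Rightarrow> 'r) \<Rightarrow> ('h \<Rightarrow> 'y \<Rightarrow> 'r).
            alg_iso (partial_skew_group_ring X D \<theta>) (partial_skew_group_ring Y E \<gamma>) \<Phi> \<and>
            \<Phi> ` (monomial 0 ` Lc X) = monomial 0 ` Lc Y)) \<and>
        (continuously_orbit_equivalent X D \<theta> Y E \<gamma> \<longleftrightarrow>
          (\<exists>\<Phi>. star_alg_iso (reduced_crossed_product X D \<theta>) (reduced_crossed_product Y E \<gamma>) \<Phi> \<and>
            \<Phi> ` C0_subalgebra X D \<theta> = C0_subalgebra Y E \<gamma>)))
     \<and> ((\<exists>\<kappa>. groupoid_iso (transformation_groupoid X D \<theta>) (transformation_groupoid Y E \<gamma>) \<kappa>)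
          \<longrightarrow> continuously_orbit_equivalent X D \<theta> Y E \<gamma>)"
proof -
  interpret X: stone_space X
    using assms(1-3) by unfold_locales
  interpret Y: stone_space Y
    using assms(4-6) by unfold_locales
  interpret PX: partial_action X D \<theta>
    by (rule assms(7))
  interpret PY: partial_action Y E \<gamma>
    by (rule assms(9))
  interpret clopen_pair X D \<theta> Y E \<gamma>
    using assms(8,10) by unfold_locales
  let ?COE = "continuously_orbit_equivalent X D \<theta> Y E \<gamma>"
  let ?iso = "\<exists>\<kappa>. groupoid_iso (transformation_groupoid X D \<theta>) (transformation_groupoid Y E \<gamma>) \<kappa>"
  let ?steinberg = "\<exists>\<Gamma> :: ('g \<times> 'x \<Rightarrow> 'r) \<Rightarrow> ('h \<times> 'y \<Rightarrow> 'r).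
    alg_iso (steinberg_algebra (transformation_groupoid X D \<theta>)) (steinberg_algebra (transformation_groupoid Y E \<gamma>)) \<Gamma> \<and>
    \<Gamma> ` steinberg_diagonal (transformation_groupoid X D \<theta>) = steinberg_diagonal (transformation_groupoid Y E \<gamma>)"
  let ?skew = "\<exists>\<Phi> :: ('g \<Rightarrow> 'x \<Rightarrow> 'r) \<Rightarrow> ('h \<Rightarrow> 'y \<Rightarrow> 'r).
    alg_iso (partial_skew_group_ring X D \<theta>) (partial_skew_group_ring Y E \<gamma>) \<Phi> \<and>
    \<Phi> ` (monomial 0 ` Lc X) = monomial 0 ` Lc Y"
  let ?reduced = "\<exists>\<Phi>. star_alg_iso (reduced_crossed_product X D \<theta>) (reduced_crossed_product Y E \<gamma>) \<Phi> \<and>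
    \<Phi> ` C0_subalgebra X D \<theta> = C0_subalgebra Y E \<gamma>"
  \<comment> \<open>Stated before freeness is assumed, because this implication is also the last
    clause of the theorem.\<close>
  have iso_COE: "?iso \<Longrightarrow> ?COE"
    by (elim exE) (rule groupoid_iso_imp_orbit_equivalent)
  have iso_steinberg: "?iso \<Longrightarrow> ?steinberg"
    by (elim exE) (rule groupoid_iso_imp_steinberg_iso)
  have steinberg_skew: "?steinberg \<Longrightarrow> ?skew"
    by (elim exE conjE) (rule steinberg_iso_imp_skew_iso)
  have iso_reduced: "?iso \<Longrightarrow> ?reduced"
  proof (elim exE)
    fix \<kappa> assume "groupoid_iso (transformation_groupoid X D \<theta>) (transformation_groupoid Y E \<gamma>) \<kappa>"
    then obtain \<kappa>' where "groupoid_iso_pair X D \<theta> Y E \<gamma> \<kappa> \<kappa>'"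
      by (rule groupoid_iso_witness)
    then show ?reduced
      by (rule groupoid_iso_pair.reduced_iso)
  qed
  \<comment> \<open>The implications form the cycle \<open>?COE\<close>, \<open>?iso\<close>,
    \<open>?steinberg\<close>, \<open>?skew\<close>, \<open>?COE\<close> and a second one through
    \<open>?iso\<close> and \<open>?reduced\<close>.\<close>
  have equivalences: "(?COE \<longleftrightarrow> ?iso) \<and> (?COE \<longleftrightarrow> ?steinberg) \<and> (?COE \<longleftrightarrow> ?skew) \<and> (?COE \<longleftrightarrow> ?reduced)"
    if free: "topologically_free X D \<theta> \<and> topologically_free Y E \<gamma>"
  proof -
    have COE_iso: "?COE \<Longrightarrow> ?iso"
    proof -
      assume ?COE
      then obtain \<phi> \<psi> where "homeomorphic_maps X Y \<phi> \<psi>" "orbit_map X D \<theta> E \<gamma> \<phi>" "orbit_map Y E \<gamma> D \<theta> \<psi>"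
        by (rule orbit_equivalent_imp_orbit_maps)
      then show ?iso
        by (rule orbit_maps_imp_groupoid_iso[OF conjunct1[OF free] conjunct2[OF free]])
    qed
    have skew_COE: "?skew \<Longrightarrow> ?COE"
    proof (elim exE conjE)
      fix \<Phi> :: "('g \<Rightarrow> 'x \<Rightarrow> 'r) \<Rightarrow> ('h \<Rightarrow> 'y \<Rightarrow> 'r)"
      assume "alg_iso (partial_skew_group_ring X D \<theta>) (partial_skew_group_ring Y E \<gamma>) \<Phi>"
        "\<Phi> ` (monomial 0 ` Lc X) = monomial 0 ` Lc Y"
      then obtain \<phi> \<psi> where "homeomorphic_maps X Y \<phi> \<psi>" "orbit_map X D \<theta> E \<gamma> \<phi>" "orbit_map Y E \<gamma> D \<theta> \<psi>"
        by (rule skew_iso_orbit_maps)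
      then show ?COE
        by (rule orbit_maps_imp_orbit_equivalent[OF conjunct1[OF free] conjunct2[OF free]])
    qed
    have reduced_COE: "?reduced \<Longrightarrow> ?COE"
    proof (elim exE conjE)
      fix \<Phi>
      assume "star_alg_iso (reduced_crossed_product X D \<theta>) (reduced_crossed_product Y E \<gamma>) \<Phi>"
        "\<Phi> ` C0_subalgebra X D \<theta> = C0_subalgebra Y E \<gamma>"
      then obtain \<phi> \<psi> where "homeomorphic_maps X Y \<phi> \<psi>" "orbit_map X D \<theta> E \<gamma> \<phi>" "orbit_map Y E \<gamma> D \<theta> \<psi>"
        by (rule reduced_iso_orbit_maps)
      then show ?COE
        by (rule orbit_maps_imp_orbit_equivalent[OF conjunct1[OF free] conjunct2[OF free]])
    qed
    show ?thesis
      by (intro conjI iffI;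
          (erule COE_iso iso_COE skew_COE reduced_COE COE_iso[THEN iso_steinberg] COE_iso[THEN iso_reduced]
            COE_iso[THEN iso_steinberg, THEN steinberg_skew] steinberg_skew[THEN skew_COE]))
  qed
  show ?thesis
    by (rule conjI[OF impI[OF equivalences] impI[OF iso_COE]])
qed

end
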